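(* Consider system (B) of the context, under its standing hypotheses, and suppose that $H:\mathbb{R}^+\times C\to\mathcal Y$ is equivalent to the finite-dimensional mapping $h:[-r,+\infty)\times\mathbb{R}^n\to\mathbb{R}^p$. Moreover, suppose that there exist a locally Lipschitz function $V:[-r,+\infty)\times\mathbb{R}^n\to\mathbb{R}^+$, functions $a_1,a_2,a,\zeta$ of class $K_\infty$ with $a(s)<s$ for all $s>0$, $\beta,\delta$ of class $K^+$ and a continuous positive definite function $\rho:\mathbb{R}^+\to\mathbb{R}^+$ such that $$a_1(|h(t-r,x)|)\le V(t-r,x)\le a_2(\beta(t)|x|),\quad\forall(t,x)\in\mathbb{R}^+\times\mathbb{R}^n,$$ $$D^+V(t,x(0);f(t,x,u,d))\le-\rho(V(t,x(0)))$$ for all $(t,x,u,d)\in\mathbb{R}^+\times C\times U\times D$ with $\max\Big\{\zeta(\delta(t)|u|),\,a\Big(\sup_{\theta\in[-r,0]}V(t+\theta,x(\theta))\Big)\Big\}\le V(t,x(0))$. Finally, suppose that one of the following holds: (i) system (B) is RFC from the input $u\in M_U$; (ii) there exist functions $p\in K_\infty$, $\mu\in K^+$ and a constant $R\ge0$ such that $p(\mu(t)|x|)\le V(t-r,x)+R$ for all $(t,x)\in\mathbb{R}^+\times\mathbb{R}^n$. Let $a_3\in K_\infty$ be a function with the property $\|H(t,x)\|_{\mathcal Y}\le a_3\big(\sup_{\theta\in[-r,0]}|h(t+\theta,x(\theta))|\big)$ for all $(t,x)\in\mathbb{R}^+\times C$. Then system (B) satisfies the non-uniform in time IOS property from the input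 $u\in M_U$ with gain $\gamma(s):=a_3(a_1^{-1}(\zeta(s)))$ and weight $\delta$. Moreover, if $\beta,\delta$ are bounded then system (B) satisfies the UIOS property from the input $u\in M_U$.
   Context: **Notation.** $\mathbb{R}^+=[0,+\infty)$; $|\cdot|$ is the Euclidean norm. $r>0$ is a constant, $C:=C^0([-r,0];\mathbb{R}^n)$, $\|x\|_r:=\max_{\theta\in[-r,0]}|x(\theta)|$. For a function $x$ defined on an interval containing $[t-r,t]$, $T_r(t)x$ denotes the function $\theta\mapsto x(t+\theta)$, $\theta\in[-r,0]$. $K^+$: positive continuous functions on $\mathbb{R}^+$. $\rho:\mathbb{R}^+\to\mathbb{R}^+$ is positive definite if $\rho(0)=0$ and $\rho(s)>0$ for $s>0$. $K$: positive definite, (strictly) increasing, continuous functions $\mathbb{R}^+\to\mathbb{R}^+$; $K_\infty$: those in $K$ tending to $+\infty$ at $+\infty$. $KL$: continuous $\sigma:\mathbb{R}^+\times\mathbb{R}^+\to\mathbb{R}^+$ with $\sigma(\cdot,t)\in K$ for each $t$ and $\sigma(s,\cdot)$ non-increasing with limit $0$ at $+\infty$ for each $s$. For a nonempty subset $D$ of a Euclidean space, $M_D$ is the class of Lebesgue measurable, locally essentially bounded $d:\mathbb{R}^+\to D$. For $U\subseteq\mathbb{R}^m$ with $0\in U$, $B_U[0,s]:=\{u\in U:|u|\le s\}$. **System (B).** Let $D\subseteq\mathbb{R}^l$ be nonempty, $U\subseteq\mathbb{R}^m$ with $0\in U$, $\mathcal Y$ a normed linear space with norm $\|\cdot\|_{\mathcal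 Y}$, and $f:\mathbb{R}^+\times C\times U\times D\to\mathbb{R}^n$, $H:\mathbb{R}^+\times C\to\mathcal Y$ with $f(t,0,0,d)=0$, $H(t,0)=0$ for all $(t,d)$. System (B) is $$\dot x(t)=f(t,T_r(t)x,u(t),d(t)),\quad Y(t)=H(t,T_r(t)x),\quad t\ge t_0,\qquad T_r(t_0)x=x_0\in C.$$ **Standing hypotheses.** 1. $(x,u,d)\mapsto f(t,x,u,d)$ is continuous for each fixed $t\ge0$, and for all bounded $I\subseteq\mathbb{R}^+$, $S\subset C\times U$ there is $L\ge0$ with $(x(0)-y(0))'(f(t,x,u,d)-f(t,y,u,d))\le L\|x-y\|_r^2$ for all $t\in I$, $(x,u),(y,u)\in S$, $d\in D$. 2. For every bounded $\Omega\subset\mathbb{R}^+\times C\times U$ the set $f(\Omega\times D)$ is bounded. 3. There is a set $A\subset\mathbb{R}^+$, either finite or $A=\{t_k:k=1,2,\dots\}$ with $t_{k+1}>t_k>0$, $t_k\to+\infty$, such that $f$ is continuous on $(\mathbb{R}^+\setminus A)\times C\times U\times D$; and $\lim_{t\to t_0^+}f(t,x,u,d)=f(t_0,x,u,d)$ for each fixed $(t_0,x,u,d)$. 4. For every $\varepsilon>0$, $t\ge0$ there is $\delta>0$ with $\sup\{|f(\tau,x,u,d)|:\tau\in\mathbb{R}^+,d\in D,u\in U,|\tau-t|+\|x\|_r+|u|<\delta\}<\varepsilon$. 5. For all bounded $I\subseteq\mathbb{R}^+$, $S\subset C\times U$ there is $L_U\ge0$ with $|f(t,x,u,d)-f(t,x,v,d)|\le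 L_U|u-v|$ for all $t\in I$, $(x,u),(x,v)\in S$, $d\in D$. 6. $U$ is a positive cone: $\lambda u\in U$ for all $u\in U$, $\lambda\ge0$. 7. For all bounded $I\subseteq\mathbb{R}^+$, $S\subset C$ there is $L_H\ge0$ with $\|H(t,x)-H(\tau,y)\|_{\mathcal Y}\le L_H(|t-\tau|+\|x-y\|_r)$ for all $t,\tau\in I$, $x,y\in S$. Under these, for every $(t_0,x_0,d,u)\in\mathbb{R}^+\times C\times M_D\times M_U$ there is a unique maximal solution $x:[t_0-r,t_{\max})\to\mathbb{R}^n$ (continuous, locally absolutely continuous on $[t_0,t_{\max})$, satisfying the equation a.e.); write $\phi(t,t_0,x_0;u,d):=T_r(t)x$. **RFC from the input.** (B) is robustly forward complete (RFC) from the input $u\in M_U$ if for all $s,T\ge0$: $\sup\{\|\phi(t_0+\xi,t_0,x_0;u,d)\|_r:u\in M_{B_U[0,s]},\xi\in[0,T],\|x_0\|_r\le s,t_0\in[0,T],d\in M_D\}<+\infty$. **IOS and UIOS.** (B) satisfies the non-uniform in time Input-to-Output Stability (IOS) property from the input $u\in M_U$ with gain $\gamma\in K$ and weight $\delta\in K^+$ if it is RFC from the input $u\in M_U$ and there exist $\sigma\in KL$, $\beta\in K^+$ such that for all $(d,u)\in M_D\times M_U$, $(t_0,x_0)\in\mathbb{R}^+\times C$ the solution with $T_r(t_0)x=x_0$ satisfies, for all $t\ge t_0$, $\|H(t,T_r(t)x)\|_{\mathcal Y}\le\max\{\sigma(\beta(t_0)\|x_0\|_r,t-t_0),\sup_{t_0\le\tau\le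 t}\gamma(\delta(\tau)|u(\tau)|)\}$. It satisfies the Uniform IOS (UIOS) property if this holds for some $\gamma\in K$ with $\beta(t)=\delta(t)\equiv1$. **Derivative.** For locally Lipschitz $V:[-r,+\infty)\times\mathbb{R}^n\to\mathbb{R}$ and $(t,x,v)\in\mathbb{R}^+\times\mathbb{R}^n\times\mathbb{R}^n$, $D^+V(t,x;v):=\limsup_{h\to0^+}h^{-1}\big(V(t+h,x+hv)-V(t,x)\big)$. **Equivalence to a finite-dimensional mapping.** $H$ is equivalent to the finite-dimensional mapping $h$ if $h:[-r,+\infty)\times\mathbb{R}^n\to\mathbb{R}^p$ is continuous with $h(t,0)=0$ for all $t\ge-r$, and there are $b_1,b_2\in K_\infty$ with $b_1(|h(t,x(0))|)\le\|H(t,x)\|_{\mathcal Y}\le b_2(\sup_{\theta\in[-r,0]}|h(t+\theta,x(\theta))|)$ for all $(t,x)\in\mathbb{R}^+\times C$. *)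

theory Defs
  imports "HOL-Analysis.Analysis"
begin

section \<open>Comparison functions\<close>

text \<open>Functions on \<open>[0, \<infinity>)\<close> are functions on \<^typ>\<open>real\<close> whose values at negative
  arguments are irrelevant.\<close>

definition positive_definite :: "(real \<Rightarrow> real) \<Rightarrow> bool" where
  "positive_definite \<rho> \<longleftrightarrow> \<rho> 0 = 0 \<and> (\<forall>s>0. \<rho> s > 0)"

definition class_Kplus :: "(real \<Rightarrow> real) set" where
  "class_Kplus = {\<beta>. continuous_on {0..} \<beta> \<and> (\<forall>t\<ge>0. \<beta> t > 0)}"

definition class_K :: "(real \<Rightarrow> real) set" where
  "class_K = {a. positive_definite a \<and> strict_mono_on {0..} a \<and> continuous_on {0..} a}"

definition class_Kinf :: "(real \<Rightarrow> real) set" where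
  "class_Kinf = {a \<in> class_K. filterlim a at_top at_top}"

definition class_KL :: "(real \<Rightarrow> real \<Rightarrow> real) set" where
  "class_KL = {\<sigma>. continuous_on ({0..} \<times> {0..}) (\<lambda>(s, t). \<sigma> s t)
     \<and> (\<forall>t\<ge>0. (\<lambda>s. \<sigma> s t) \<in> class_K)
     \<and> (\<forall>s\<ge>0. antimono_on {0..} (\<sigma> s) \<and> (\<sigma> s \<longlongrightarrow> 0) at_top)}"


section \<open>The state space and the history operator\<close>

text \<open>The space \<open>C([-r,0]; X)\<close> is represented by the subspace of those bounded continuous functions
  on \<^typ>\<open>real\<close> that are constant on \<open>(-\<infinity>,-r]\<close> and on \<open>[0,\<infinity>)\<close>; restriction to \<open>[-r,0]\<close> is a
  bijection, with inverse \<^term>\<open>\<lambda>g. ext_cont g (-r) 0\<close>, and the norm of the type is the maximum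
  norm over \<open>[-r,0]\<close> (see \<open>norm_state\<close>).\<close>

definition state_space :: "real \<Rightarrow> (real \<Rightarrow>\<^sub>C 'x::euclidean_space) set" where
  "state_space r = {x. ext_cont (apply_bcontfun x) (-r) 0 = apply_bcontfun x}"

text \<open>\<open>history r t x\<close> is \<open>\<theta> \<mapsto> x(t+\<theta>)\<close> on \<open>[-r,0]\<close>; it is meaningful when \<open>x\<close> is continuous on
  \<open>[t-r,t]\<close>.\<close>

definition history :: "real \<Rightarrow> real \<Rightarrow> (real \<Rightarrow> 'x::euclidean_space) \<Rightarrow> (real \<Rightarrow>\<^sub>C 'x)" where
  "history r t x = Bcontfun (ext_cont (\<lambda>\<theta>. x (t + \<theta>)) (-r) 0)"

lemma apply_history:
  fixes x :: "real \<Rightarrow> 'x::euclidean_space"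
  assumes "continuous_on {t - r..t} x"
  shows "apply_bcontfun (history r t x) = ext_cont (\<lambda>\<theta>. x (t + \<theta>)) (-r) 0"
proof -
  have c: "continuous_on (cbox (-r) 0) (\<lambda>\<theta>. x (t + \<theta>))"
    by (rule continuous_on_compose2[OF assms]) (auto intro!: continuous_intros)
  have "bounded ((\<lambda>\<theta>. x (t + \<theta>)) ` cbox (-r) 0)"
    using c compact_cbox compact_continuous_image compact_imp_bounded by blast
  then have "bounded (range (ext_cont (\<lambda>\<theta>. x (t + \<theta>)) (-r) 0))"
    unfolding ext_cont_def by (rule clamp_bounded)
  with c have "ext_cont (\<lambda>\<theta>. x (t + \<theta>)) (-r) 0 \<in> bcontfun"
    unfolding bcontfun_def using continuous_on_ext_cont by blast
  then show ?thesis
    unfolding history_def by (rule Bcontfun_inverse)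
qed

lemma history_in_state_space:
  fixes x :: "real \<Rightarrow> 'x::euclidean_space"
  assumes "r > 0" "continuous_on {t - r..t} x"
  shows "history r t x \<in> state_space r"
    and "\<theta> \<in> {-r..0} \<Longrightarrow> apply_bcontfun (history r t x) \<theta> = x (t + \<theta>)"
  using assms unfolding state_space_def
  by (auto simp: apply_history ext_cont_def fun_eq_iff simp del: clamp_cancel_cbox
           intro!: arg_cong[where f = x] clamp_cancel_cbox clamp_in_interval)

lemma norm_state:
  assumes "r > 0" "x \<in> state_space r"
  shows "norm x = (SUP \<theta>\<in>{-r..0}. norm (x \<theta>))"
proof (rule antisym)
  have bdd: "bdd_above ((\<lambda>\<theta>. norm (x \<theta>)) ` {-r..0})"
    by (auto intro!: bdd_aboveI2 norm_bounded)
  show "norm x \<le> (SUP \<theta>\<in>{-r..0}. norm (x \<theta>))"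
  proof (rule norm_bound)
    fix \<theta>
    have "x \<theta> = x (clamp (-r) 0 \<theta>)"
      using assms(2) by (simp add: state_space_def ext_cont_def fun_eq_iff)
    moreover have "clamp (-r) 0 \<theta> \<in> {-r..0}"
      using clamp_in_interval[of "-r" 0 \<theta>] assms(1) by simp
    ultimately show "norm (x \<theta>) \<le> (SUP \<theta>\<in>{-r..0}. norm (x \<theta>))"
      using bdd by (metis cSUP_upper)
  qed
  show "(SUP \<theta>\<in>{-r..0}. norm (x \<theta>)) \<le> norm x"
    using assms(1) by (auto intro!: cSUP_least norm_bounded)
qed


section \<open>The standing hypotheses\<close>

locale retarded_system =
  fixes r :: real
    and D :: "'d::euclidean_space set"
    and U :: "'u::euclidean_space set"
    and f :: "real \<Rightarrow> (real \<Rightarrow>\<^sub>C 'x::euclidean_space) \<Rightarrow> 'u \<Rightarrow> 'd \<Rightarrow> 'x"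
    and H :: "real \<Rightarrow> (real \<Rightarrow>\<^sub>C 'x) \<Rightarrow> 'y::real_normed_vector"
  assumes r_pos: "r > 0"
    and D_nonempty: "D \<noteq> {}"
    and zero_in_U: "0 \<in> U"
    and f_zero: "\<And>t d. t \<ge> 0 \<Longrightarrow> d \<in> D \<Longrightarrow> f t 0 0 d = 0"
    and H_zero: "\<And>t. t \<ge> 0 \<Longrightarrow> H t 0 = 0"
    and f_cont: "\<And>t. t \<ge> 0 \<Longrightarrow>
      continuous_on (state_space r \<times> U \<times> D) (\<lambda>(x, u, d). f t x u d)"
    and f_one_sided_lipschitz:
      "\<And>I S. bounded I \<Longrightarrow> I \<subseteq> {0..} \<Longrightarrow> bounded S \<Longrightarrow> S \<subseteq> state_space r \<times> U \<Longrightarrow>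
        \<exists>L\<ge>0. \<forall>t\<in>I. \<forall>x y u. \<forall>d\<in>D. (x, u) \<in> S \<longrightarrow> (y, u) \<in> S \<longrightarrow>
          (apply_bcontfun x 0 - apply_bcontfun y 0) \<bullet> (f t x u d - f t y u d) \<le> L * (norm (x - y))\<^sup>2"
    and f_bounded:
      "\<And>\<Omega>. bounded \<Omega> \<Longrightarrow> \<Omega> \<subseteq> {0..} \<times> state_space r \<times> U \<Longrightarrow>
        bounded ((\<lambda>((t, x, u), d). f t x u d) ` (\<Omega> \<times> D))"
    and f_piecewise_cont:
      "\<exists>A\<subseteq>{0..}. (finite A \<or>
            (\<exists>\<tau> :: nat \<Rightarrow> real. (\<forall>k. 0 < \<tau> k \<and> \<tau> k < \<tau> (Suc k)) \<and>
               filterlim \<tau> at_top sequentially \<and> A = range \<tau>)) \<and>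
          continuous_on (({0..} - A) \<times> state_space r \<times> U \<times> D) (\<lambda>(t, x, u, d). f t x u d)"
    and f_right_cont:
      "\<And>t0 x u d. t0 \<ge> 0 \<Longrightarrow> x \<in> state_space r \<Longrightarrow> u \<in> U \<Longrightarrow> d \<in> D \<Longrightarrow>
        ((\<lambda>t. f t x u d) \<longlongrightarrow> f t0 x u d) (at_right t0)"
    and f_small:
      "\<And>\<epsilon> t. \<epsilon> > 0 \<Longrightarrow> t \<ge> 0 \<Longrightarrow>
        \<exists>\<delta>>0. Sup {ereal (norm (f \<tau> x u d)) | \<tau> x u d. \<tau> \<ge> 0 \<and> x \<in> state_space r \<and> u \<in> U \<and> d \<in> D
                    \<and> \<bar>\<tau> - t\<bar> + norm x + norm u < \<delta>} < ereal \<epsilon>"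
    and f_lipschitz_input:
      "\<And>I S. bounded I \<Longrightarrow> I \<subseteq> {0..} \<Longrightarrow> bounded S \<Longrightarrow> S \<subseteq> state_space r \<times> U \<Longrightarrow>
        \<exists>L\<ge>0. \<forall>t\<in>I. \<forall>x u v. \<forall>d\<in>D. (x, u) \<in> S \<longrightarrow> (x, v) \<in> S \<longrightarrow>
          norm (f t x u d - f t x v d) \<le> L * norm (u - v)"
    and U_cone: "\<And>u c. u \<in> U \<Longrightarrow> c \<ge> 0 \<Longrightarrow> c *\<^sub>R u \<in> U"
    and H_lipschitz:
      "\<And>I S. bounded I \<Longrightarrow> I \<subseteq> {0..} \<Longrightarrow> bounded S \<Longrightarrow> S \<subseteq> state_space r \<Longrightarrow>
        \<exists>L\<ge>0. \<forall>t\<in>I. \<forall>\<tau>\<in>I. \<forall>x\<in>S. \<forall>y\<in>S. norm (H t x - H \<tau> y) \<le> L * (\<bar>t - \<tau>\<bar> + norm (x - y))"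


section \<open>Inputs and solutions\<close>

text \<open>The class \<open>M\<^sub>E\<close> of measurable, locally essentially bounded functions from \<open>[0,\<infinity>)\<close> to \<open>E\<close>.\<close>

definition inputs :: "'e::euclidean_space set \<Rightarrow> (real \<Rightarrow> 'e) set" where
  "inputs E = {d. d \<in> borel_measurable (lebesgue_on {0..}) \<and> (\<forall>t\<ge>0. d t \<in> E) \<and>
     (\<forall>T\<ge>0. \<exists>M. AE t in lebesgue_on {0..T}. norm (d t) \<le> M)}"

definition abs_continuous_on_interval ::
  "real \<Rightarrow> real \<Rightarrow> (real \<Rightarrow> 'x::real_normed_vector) \<Rightarrow> bool" where
  "abs_continuous_on_interval a b x \<longleftrightarrow>
     (\<forall>\<epsilon>>0. \<exists>\<delta>>0. \<forall>(n::nat) p q.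
        (\<forall>i<n. a \<le> p i \<and> p i \<le> q i \<and> q i \<le> b) \<and>
        disjoint_family_on (\<lambda>i. {p i<..<q i}) {..<n} \<and> (\<Sum>i<n. q i - p i) < \<delta> \<longrightarrow>
        (\<Sum>i<n. norm (x (q i) - x (p i))) < \<epsilon>)"

text \<open>\<open>x\<close> is a solution on \<open>[t0-r,b)\<close>, where \<open>b = \<infinity>\<close> is allowed.\<close>

definition solution_on ::
  "real \<Rightarrow> (real \<Rightarrow> (real \<Rightarrow>\<^sub>C 'x::euclidean_space) \<Rightarrow> 'u \<Rightarrow> 'd \<Rightarrow> 'x) \<Rightarrow> real \<Rightarrow> (real \<Rightarrow>\<^sub>C 'x) \<Rightarrow>
   (real \<Rightarrow> 'u) \<Rightarrow> (real \<Rightarrow> 'd) \<Rightarrow> ereal \<Rightarrow> (real \<Rightarrow> 'x) \<Rightarrow> bool" where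
  "solution_on r f t0 x0 u d b x \<longleftrightarrow>
     ereal t0 < b \<and>
     continuous_on {t. t0 - r \<le> t \<and> ereal t < b} x \<and>
     history r t0 x = x0 \<and>
     (\<forall>c. t0 \<le> c \<and> ereal c < b \<longrightarrow> abs_continuous_on_interval t0 c x) \<and>
     (AE t in lebesgue. t0 \<le> t \<and> ereal t < b \<longrightarrow>
        (x has_vector_derivative f t (history r t x) (u t) (d t)) (at t))"

definition maximal_solution ::
  "real \<Rightarrow> (real \<Rightarrow> (real \<Rightarrow>\<^sub>C 'x::euclidean_space) \<Rightarrow> 'u \<Rightarrow> 'd \<Rightarrow> 'x) \<Rightarrow> real \<Rightarrow> (real \<Rightarrow>\<^sub>C 'x) \<Rightarrow>
   (real \<Rightarrow> 'u) \<Rightarrow> (real \<Rightarrow> 'd) \<Rightarrow> ereal \<Rightarrow> (real \<Rightarrow> 'x) \<Rightarrow> bool" where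
  "maximal_solution r f t0 x0 u d b x \<longleftrightarrow>
     solution_on r f t0 x0 u d b x \<and>
     (\<forall>b' x'. solution_on r f t0 x0 u d b' x' \<and> b \<le> b' \<and>
        (\<forall>t. t0 - r \<le> t \<and> ereal t < b \<longrightarrow> x' t = x t) \<longrightarrow> b' = b)"


section \<open>Stability notions\<close>

text \<open>Robust forward completeness: finiteness of the supremum includes that the solutions exist
  up to time \<open>t0 + \<xi>\<close>.\<close>

definition RFC ::
  "real \<Rightarrow> 'd::euclidean_space set \<Rightarrow> 'u::euclidean_space set \<Rightarrow>
   (real \<Rightarrow> (real \<Rightarrow>\<^sub>C 'x::euclidean_space) \<Rightarrow> 'u \<Rightarrow> 'd \<Rightarrow> 'x) \<Rightarrow> bool" where
  "RFC r D U f \<longleftrightarrow>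
     (\<forall>s\<ge>0. \<forall>T\<ge>0. \<exists>M. \<forall>u\<in>inputs (U \<inter> cball 0 s). \<forall>\<xi>\<in>{0..T}. \<forall>x0\<in>state_space r. \<forall>t0\<in>{0..T}.
        \<forall>d\<in>inputs D. norm x0 \<le> s \<longrightarrow>
        (\<forall>b x. maximal_solution r f t0 x0 u d b x \<longrightarrow>
           ereal (t0 + \<xi>) < b \<and> norm (history r (t0 + \<xi>) x) \<le> M))"

text \<open>The supremum is taken in \<^typ>\<open>ereal\<close> because a locally essentially bounded input may be
  unbounded on \<open>[t0,t]\<close>, in which case the estimate is void.\<close>

definition IOS_estimate ::
  "real \<Rightarrow> 'd::euclidean_space set \<Rightarrow> 'u::euclidean_space set \<Rightarrow>
   (real \<Rightarrow> (real \<Rightarrow>\<^sub>C 'x::euclidean_space) \<Rightarrow> 'u \<Rightarrow> 'd \<Rightarrow> 'x) \<Rightarrow>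
   (real \<Rightarrow> (real \<Rightarrow>\<^sub>C 'x) \<Rightarrow> 'y::real_normed_vector) \<Rightarrow>
   (real \<Rightarrow> real \<Rightarrow> real) \<Rightarrow> (real \<Rightarrow> real) \<Rightarrow> (real \<Rightarrow> real) \<Rightarrow> (real \<Rightarrow> real) \<Rightarrow> bool" where
  "IOS_estimate r D U f H \<sigma> \<beta> \<gamma> \<delta> \<longleftrightarrow>
     (\<forall>d\<in>inputs D. \<forall>u\<in>inputs U. \<forall>t0\<ge>0. \<forall>x0\<in>state_space r. \<forall>b x.
        maximal_solution r f t0 x0 u d b x \<longrightarrow>
        (\<forall>t\<ge>t0. ereal (norm (H t (history r t x)))
            \<le> max (ereal (\<sigma> (\<beta> t0 * norm x0) (t - t0)))
                  (SUP \<tau>\<in>{t0..t}. ereal (\<gamma> (\<delta> \<tau> * norm (u \<tau>))))))"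

definition IOS ::
  "real \<Rightarrow> 'd::euclidean_space set \<Rightarrow> 'u::euclidean_space set \<Rightarrow>
   (real \<Rightarrow> (real \<Rightarrow>\<^sub>C 'x::euclidean_space) \<Rightarrow> 'u \<Rightarrow> 'd \<Rightarrow> 'x) \<Rightarrow>
   (real \<Rightarrow> (real \<Rightarrow>\<^sub>C 'x) \<Rightarrow> 'y::real_normed_vector) \<Rightarrow>
   (real \<Rightarrow> real) \<Rightarrow> (real \<Rightarrow> real) \<Rightarrow> bool" where
  "IOS r D U f H \<gamma> \<delta> \<longleftrightarrow>
     \<gamma> \<in> class_K \<and> \<delta> \<in> class_Kplus \<and> RFC r D U f \<and>
     (\<exists>\<sigma>\<in>class_KL. \<exists>\<beta>\<in>class_Kplus. IOS_estimate r D U f H \<sigma> \<beta> \<gamma> \<delta>)"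

definition UIOS ::
  "real \<Rightarrow> 'd::euclidean_space set \<Rightarrow> 'u::euclidean_space set \<Rightarrow>
   (real \<Rightarrow> (real \<Rightarrow>\<^sub>C 'x::euclidean_space) \<Rightarrow> 'u \<Rightarrow> 'd \<Rightarrow> 'x) \<Rightarrow>
   (real \<Rightarrow> (real \<Rightarrow>\<^sub>C 'x) \<Rightarrow> 'y::real_normed_vector) \<Rightarrow> bool" where
  "UIOS r D U f H \<longleftrightarrow>
     RFC r D U f \<and>
     (\<exists>\<gamma>\<in>class_K. \<exists>\<sigma>\<in>class_KL. IOS_estimate r D U f H \<sigma> (\<lambda>_. 1) \<gamma> (\<lambda>_. 1))"


section \<open>Lyapunov functions and output maps\<close>

definition locally_lipschitz_on :: "'a::metric_space set \<Rightarrow> ('a \<Rightarrow> 'b::metric_space) \<Rightarrow> bool" where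
  "locally_lipschitz_on S g \<longleftrightarrow> (\<forall>z\<in>S. \<exists>e>0. \<exists>L. L-lipschitz_on (cball z e \<inter> S) g)"

definition upper_right_deriv ::
  "(real \<Rightarrow> 'x::euclidean_space \<Rightarrow> real) \<Rightarrow> real \<Rightarrow> 'x \<Rightarrow> 'x \<Rightarrow> ereal" where
  "upper_right_deriv V t x v =
     Limsup (at_right 0) (\<lambda>h. ereal ((V (t + h) (x + h *\<^sub>R v) - V t x) / h))"

definition equivalent_to_finite_dim ::
  "real \<Rightarrow> (real \<Rightarrow> (real \<Rightarrow>\<^sub>C 'x::euclidean_space) \<Rightarrow> 'y::real_normed_vector) \<Rightarrow>
   (real \<Rightarrow> 'x \<Rightarrow> 'p::euclidean_space) \<Rightarrow> bool" where
  "equivalent_to_finite_dim r H h \<longleftrightarrow>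
     continuous_on ({-r..} \<times> UNIV) (\<lambda>(t, x). h t x) \<and>
     (\<forall>t\<ge>-r. h t 0 = 0) \<and>
     (\<exists>b1\<in>class_Kinf. \<exists>b2\<in>class_Kinf. \<forall>t\<ge>0. \<forall>x\<in>state_space r.
        b1 (norm (h t (apply_bcontfun x 0))) \<le> norm (H t x) \<and>
        norm (H t x) \<le> b2 (SUP \<theta>\<in>{-r..0}. norm (h (t + \<theta>) (apply_bcontfun x \<theta>))))"

end

theory Submission
  imports Defs "HOL-Complex_Analysis.Great_Picard"
begin

text \<open>Along a solution, \<open>w t = V t (x t)\<close> is absolutely continuous, and for almost every \<open>t\<close> its upper
  right Dini derivative is at most \<open>- \<rho> (w t)\<close> whenever \<open>w t\<close> dominates both the input level \<open>q\<close>
  and \<open>a (sup w)\<close>, the supremum being over \<open>[t - r, t]\<close>. If \<open>w\<close> is bounded by \<open>M > q\<close> on a long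
  interval, this forces it below \<open>max (a M) q\<close> (up to any \<open>\<epsilon> > 0\<close>) after a time depending on \<open>M\<close> and
  \<open>\<epsilon>\<close> only; since \<open>a M < M\<close>, finitely many such steps bring \<open>w\<close> below \<open>max \<epsilon> q\<close> uniformly in the
  trajectory, which yields a single bound of class \<open>KL\<close> for all solutions.
  In case (ii) the bound on \<open>w\<close> bounds the state, and a bounded solution that stops at a finite time
  could be continued beyond it, by a Caratheodory existence theorem for the delay equation.
  In both cases forward completeness extends to unbounded inputs by modifying them on a null set and
  beyond the supposed blow-up time.\<close>

section \<open>Absolutely continuous functions and Dini derivatives\<close>

text \<open>Because \<open>V\<close> is merely locally Lipschitz, \<open>w\<close> carries only a
  one-sided Dini bound, and only almost everywhere; the whole decay argument therefore rests on a
  single monotonicity theorem, \<open>abs_continuous_dini_nonincreasing\<close>. The Razumikhin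
  hypothesis looks back over a window of length \<open>r\<close>, so it is not a scalar differential
  inequality to which a comparison principle could be applied. Freezing an upper bound
  \<open>M\<close> on the window makes it one: above \<open>max (a M) q\<close> the condition holds
  automatically, and on \<open>[max (a M) \<epsilon>, M]\<close>, which stays away from
  \<open>0\<close>, \<open>\<rho>\<close> has a positive minimum that serves as decay rate. The
  input enters as a constant \<open>q\<close> on a finite horizon. The waiting times then depend
  only on \<open>r\<close>, \<open>a\<close>, \<open>\<rho>\<close> and the levels, never on the
  trajectory, and \<open>q\<close> can be chosen at the end as a preimage under
  \<open>a3 \<circ> inv_into {0..} a1\<close>, which gives exactly the stated gain. Forward
  completeness has to precede the output estimate, because the estimate speaks of every
  \<open>t \<ge> t0\<close> while a maximal solution might stop earlier.\<close>

definition dini_le :: "(real \<Rightarrow> real) \<Rightarrow> real \<Rightarrow> real \<Rightarrow> bool" where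
  "dini_le w t c \<longleftrightarrow> (\<forall>e>0. \<forall>\<^sub>F h in at_right 0. w (t + h) - w t \<le> (c + e) * h)"

lemma abs_continuous_on_interval_subset:
  assumes "abs_continuous_on_interval a b x" "a \<le> a'" "b' \<le> b"
  shows "abs_continuous_on_interval a' b' x"
  unfolding abs_continuous_on_interval_def
proof (intro allI impI)
  fix \<epsilon> :: real assume "\<epsilon> > 0"
  then obtain \<delta> where "\<delta> > 0" and \<delta>: "\<And>(n::nat) p q. (\<forall>i<n. a \<le> p i \<and> p i \<le> q i \<and> q i \<le> b) \<and>
        disjoint_family_on (\<lambda>i. {p i<..<q i}) {..<n} \<and> (\<Sum>i<n. q i - p i) < \<delta> \<Longrightarrow>
        (\<Sum>i<n. norm (x (q i) - x (p i))) < \<epsilon>"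
    using assms(1) unfolding abs_continuous_on_interval_def by meson
  have "\<forall>(n::nat) p q. (\<forall>i<n. a' \<le> p i \<and> p i \<le> q i \<and> q i \<le> b') \<and>
        disjoint_family_on (\<lambda>i. {p i<..<q i}) {..<n} \<and> (\<Sum>i<n. q i - p i) < \<delta> \<longrightarrow>
        (\<Sum>i<n. norm (x (q i) - x (p i))) < \<epsilon>"
    using assms(2,3) by (intro allI impI \<delta>) fastforce
  with \<open>\<delta> > 0\<close> show "\<exists>\<delta>>0. \<forall>(n::nat) p q. (\<forall>i<n. a' \<le> p i \<and> p i \<le> q i \<and> q i \<le> b') \<and>
        disjoint_family_on (\<lambda>i. {p i<..<q i}) {..<n} \<and> (\<Sum>i<n. q i - p i) < \<delta> \<longrightarrow>
        (\<Sum>i<n. norm (x (q i) - x (p i))) < \<epsilon>" by blast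
qed

lemma abs_continuous_on_interval_uniform:
  assumes "abs_continuous_on_interval a b x" "\<epsilon> > 0"
  shows "\<exists>\<delta>>0. \<forall>s\<in>{a..b}. \<forall>t\<in>{a..b}. \<bar>s - t\<bar> < \<delta> \<longrightarrow> norm (x s - x t) < \<epsilon>"
proof -
  obtain \<delta> where "\<delta> > 0" and \<delta>: "\<And>(n::nat) p q. (\<forall>i<n. a \<le> p i \<and> p i \<le> q i \<and> q i \<le> b) \<and>
        disjoint_family_on (\<lambda>i. {p i<..<q i}) {..<n} \<and> (\<Sum>i<n. q i - p i) < \<delta> \<Longrightarrow>
        (\<Sum>i<n. norm (x (q i) - x (p i))) < \<epsilon>"
    using assms unfolding abs_continuous_on_interval_def by meson
  have *: "norm (x t - x s) < \<epsilon>" if "a \<le> s" "s \<le> t" "t \<le> b" "t - s < \<delta>" for s t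
    using \<delta>[of 1 "\<lambda>_. s" "\<lambda>_. t"] that by (simp add: disjoint_family_on_def)
  show ?thesis
  proof (intro exI conjI ballI impI)
    fix s t assume "s \<in> {a..b}" "t \<in> {a..b}" "\<bar>s - t\<bar> < \<delta>"
    then show "norm (x s - x t) < \<epsilon>"
      using *[of s t] *[of t s] by (cases "s \<le> t") (auto simp: norm_minus_commute)
  qed fact
qed

lemma abs_continuous_on_interval_imp_continuous_on:
  assumes "abs_continuous_on_interval a b x"
  shows "continuous_on {a..b} x"
  unfolding continuous_on_iff
proof (intro ballI allI impI)
  fix t and e :: real assume "t \<in> {a..b}" "0 < e"
  with abs_continuous_on_interval_uniform[OF assms \<open>0 < e\<close>]
  show "\<exists>d>0. \<forall>t'\<in>{a..b}. dist t' t < d \<longrightarrow> dist (x t') (x t) < e"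
    by (auto simp: dist_norm)
qed

text \<open>Intervals of total length below \<open>\<eta>\<close> are each shorter than
  \<open>\<eta>\<close>, so a Lipschitz-type bound for nearby arguments suffices. That local form is
  what a compactness argument gives for a locally Lipschitz \<open>V\<close>.\<close>

lemma abs_continuous_on_interval_dominated:
  fixes x :: "real \<Rightarrow> 'x::real_normed_vector" and g :: "real \<Rightarrow> 'y::real_normed_vector"
  assumes x: "abs_continuous_on_interval a b x" and "\<eta> > 0" "L \<ge> 0"
    and g: "\<And>s t. s \<in> {a..b} \<Longrightarrow> t \<in> {a..b} \<Longrightarrow> \<bar>s - t\<bar> < \<eta> \<Longrightarrow>
      norm (g s - g t) \<le> L * (norm (x s - x t) + \<bar>s - t\<bar>)"
  shows "abs_continuous_on_interval a b g"
  unfolding abs_continuous_on_interval_def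
proof (intro allI impI)
  fix \<epsilon> :: real assume "\<epsilon> > 0"
  define e where "e = \<epsilon> / (2 * (L + 1))"
  have e: "e > 0" "2 * L * e < \<epsilon>"
    using \<open>\<epsilon> > 0\<close> \<open>L \<ge> 0\<close> by (auto simp: e_def field_simps)
  obtain \<delta> where "\<delta> > 0" and \<delta>: "\<And>(n::nat) p q. (\<forall>i<n. a \<le> p i \<and> p i \<le> q i \<and> q i \<le> b) \<and>
        disjoint_family_on (\<lambda>i. {p i<..<q i}) {..<n} \<and> (\<Sum>i<n. q i - p i) < \<delta> \<Longrightarrow>
        (\<Sum>i<n. norm (x (q i) - x (p i))) < e"
    using x \<open>e > 0\<close> unfolding abs_continuous_on_interval_def by meson
  have "(\<Sum>i<n. norm (g (q i) - g (p i))) < \<epsilon>"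
    if *: "\<forall>i<n. a \<le> p i \<and> p i \<le> q i \<and> q i \<le> b" "disjoint_family_on (\<lambda>i. {p i<..<q i}) {..<n}"
      "(\<Sum>i<n. q i - p i) < min \<delta> (min \<eta> e)" for n :: nat and p q
  proof -
    have len: "q i - p i < \<eta>" if "i < n" for i
      using member_le_sum[of i "{..<n}" "\<lambda>i. q i - p i"] * that by auto
    have "(\<Sum>i<n. norm (g (q i) - g (p i))) \<le> (\<Sum>i<n. L * (norm (x (q i) - x (p i)) + (q i - p i)))"
    proof (rule sum_mono)
      fix i assume "i \<in> {..<n}"
      then have "a \<le> p i" "p i \<le> q i" "q i \<le> b" "q i - p i < \<eta>" using * len by auto
      then show "norm (g (q i) - g (p i)) \<le> L * (norm (x (q i) - x (p i)) + (q i - p i))"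
        using g[of "q i" "p i"] by auto
    qed
    also have "\<dots> = L * ((\<Sum>i<n. norm (x (q i) - x (p i))) + (\<Sum>i<n. q i - p i))"
      by (simp add: sum_distrib_left sum.distrib[symmetric])
    also have "\<dots> \<le> L * (e + e)"
      using \<delta>[of n p q] * \<open>L \<ge> 0\<close> by (intro mult_left_mono add_mono) auto
    also have "\<dots> < \<epsilon>" using e by simp
    finally show ?thesis .
  qed
  moreover have "min \<delta> (min \<eta> e) > 0" using \<open>\<delta> > 0\<close> \<open>\<eta> > 0\<close> e by simp
  ultimately show "\<exists>\<delta>>0. \<forall>(n::nat) p q. (\<forall>i<n. a \<le> p i \<and> p i \<le> q i \<and> q i \<le> b) \<and>
        disjoint_family_on (\<lambda>i. {p i<..<q i}) {..<n} \<and> (\<Sum>i<n. q i - p i) < \<delta> \<longrightarrow>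
        (\<Sum>i<n. norm (g (q i) - g (p i))) < \<epsilon>" by blast
qed

lemma abs_continuous_on_interval_id: "abs_continuous_on_interval a b (\<lambda>t::real. t)"
  unfolding abs_continuous_on_interval_def
proof (intro allI impI)
  fix \<epsilon> :: real assume "\<epsilon> > 0"
  then show "\<exists>\<delta>>0. \<forall>(n::nat) p q. (\<forall>i<n. a \<le> p i \<and> p i \<le> q i \<and> q i \<le> b) \<and>
        disjoint_family_on (\<lambda>i. {p i<..<q i}) {..<n} \<and> (\<Sum>i<n. q i - p i) < \<delta> \<longrightarrow>
        (\<Sum>i<n. norm (q i - p i)) < \<epsilon>"
    by (intro exI[of _ \<epsilon>]) auto
qed

lemma lipschitz_imp_abs_continuous:
  assumes "L-lipschitz_on {a..b} x"
  shows "abs_continuous_on_interval a b x"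
proof (rule abs_continuous_on_interval_dominated[OF abs_continuous_on_interval_id, where \<eta> = 1 and L = L])
  show "0 \<le> L" using assms by (rule lipschitz_on_nonneg)
  fix s t assume "s \<in> {a..b}" "t \<in> {a..b}"
  then have "norm (x s - x t) \<le> L * \<bar>s - t\<bar>"
    using lipschitz_onD[OF assms, of s t] by (auto simp: dist_norm)
  also have "\<dots> \<le> L * (norm (s - t) + \<bar>s - t\<bar>)"
    using \<open>0 \<le> L\<close> by (intro mult_left_mono) auto
  finally show "norm (x s - x t) \<le> L * (norm (s - t) + \<bar>s - t\<bar>)" .
qed simp

lemma sum_length_disjoint_intervals_le:
  fixes p q :: "nat \<Rightarrow> real"
  assumes "\<And>i. i < n \<Longrightarrow> p i \<le> q i \<and> {p i<..<q i} \<subseteq> G"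
    and "disjoint_family_on (\<lambda>i. {p i<..<q i}) {..<n}" and "G \<in> lmeasurable"
  shows "(\<Sum>i<n. q i - p i) \<le> measure lebesgue G"
proof -
  have "(\<Sum>i<n. q i - p i) = (\<Sum>i<n. measure lebesgue {p i<..<q i})"
    using assms(1) by (intro sum.cong) auto
  also have "\<dots> = measure lebesgue (\<Union>i<n. {p i<..<q i})"
    by (rule measure_finite_Union[symmetric])
       (use assms(1,2) in \<open>auto simp: emeasure_lborel_Ioo\<close>)
  also have "\<dots> \<le> measure lebesgue G"
    using assms by (intro measure_mono_fmeasurable) auto
  finally show ?thesis .
qed

text \<open>The exceptional null set is covered by an open \<open>G\<close> of measure below the
  \<open>\<delta>\<close> of absolute continuity, so the variation \<open>\<Phi> t\<close> of
  \<open>w\<close> inside \<open>G\<close> up to time \<open>t\<close> never exceeds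
  \<open>\<epsilon>\<close>. The inequality
  \<open>w t - w a \<le> \<epsilon> * (t - a) + \<Phi> t\<close> is then pushed from
  \<open>a\<close> to \<open>b\<close>: at good points by the Dini bound, at exceptional points by
  the growth of \<open>\<Phi>\<close>.\<close>

lemma abs_continuous_dini_nonincreasing:
  fixes w :: "real \<Rightarrow> real"
  assumes "a \<le> b" and ac: "abs_continuous_on_interval a b w"
    and ae: "AE t in lebesgue. a < t \<and> t < b \<longrightarrow> dini_le w t 0"
  shows "w b \<le> w a"
proof -
  have "w b - w a \<le> \<epsilon> * (b - a) + \<epsilon>" if "\<epsilon> > 0" for \<epsilon>
  proof -
    obtain \<delta> where "\<delta> > 0" and \<delta>: "\<And>(n::nat) p q. (\<forall>i<n. a \<le> p i \<and> p i \<le> q i \<and> q i \<le> b) \<and>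
        disjoint_family_on (\<lambda>i. {p i<..<q i}) {..<n} \<and> (\<Sum>i<n. q i - p i) < \<delta> \<Longrightarrow>
        (\<Sum>i<n. norm (w (q i) - w (p i))) < \<epsilon>"
      using ac \<open>\<epsilon> > 0\<close> unfolding abs_continuous_on_interval_def by meson
    obtain N0 where N0: "N0 \<in> null_sets lebesgue" "\<And>t. t \<notin> N0 \<Longrightarrow> a < t \<and> t < b \<longrightarrow> dini_le w t 0"
      using ae by (auto elim!: AE_E3)
    \<comment> \<open>Nothing is assumed about the Dini derivative at \<open>a\<close>, where the
      propagation starts, so \<open>a\<close> is treated as exceptional.\<close>
    define N where "N = insert a N0"
    have N: "N \<in> null_sets lebesgue"
      using N0(1) unfolding N_def negligible_iff_null_sets[symmetric] by simp
    then obtain G where G: "open G" "N \<subseteq> G" "G - N \<in> lmeasurable" "emeasure lebesgue (G - N) < ennreal \<delta>"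
      using sets_lebesgue_outer_open[of N \<delta>] \<open>\<delta> > 0\<close> by auto
    have Gs: "G \<in> sets lebesgue" using \<open>open G\<close> by auto
    have "emeasure lebesgue G = emeasure lebesgue (G - N)"
      using emeasure_Diff_null_set[OF N Gs] by simp
    with G Gs have Gm: "G \<in> lmeasurable" "measure lebesgue G < \<delta>"
      using \<open>\<delta> > 0\<close> by (auto simp: fmeasurable_def measure_def enn2real_less_iff intro: order.strict_trans)
    \<comment> \<open>The values \<open>v\<close> with \<open>F t v\<close> are the variation sums
      of \<open>w\<close> over nonoverlapping intervals inside both \<open>G\<close> and
      \<open>[a,t]\<close>. Containment of the closed intervals in \<open>G\<close> lets
      \<open>\<Phi>_step\<close> append \<open>{s..t}\<close> as a further piece.\<close>
    define F where "F t v \<longleftrightarrow> (\<exists>(n::nat) p q. (\<forall>i<n. a \<le> p i \<and> p i \<le> q i \<and> q i \<le> t \<and> {p i..q i} \<subseteq> G) \<and>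
        disjoint_family_on (\<lambda>i. {p i<..<q i}) {..<n} \<and> v = (\<Sum>i<n. norm (w (q i) - w (p i))))" for t v
    define \<Phi> where "\<Phi> t = Sup (Collect (F t))" for t
    have F_le: "v \<le> \<epsilon>" if "F t v" "t \<le> b" for t v
    proof -
      obtain n :: nat and p q where *: "\<forall>i<n. a \<le> p i \<and> p i \<le> q i \<and> q i \<le> t \<and> {p i..q i} \<subseteq> G"
        "disjoint_family_on (\<lambda>i. {p i<..<q i}) {..<n}" "v = (\<Sum>i<n. norm (w (q i) - w (p i)))"
        using \<open>F t v\<close> unfolding F_def by blast
      have "(\<Sum>i<n. q i - p i) \<le> measure lebesgue G"
        using * Gm(1) by (intro sum_length_disjoint_intervals_le) fastforce+
      with Gm have "(\<Sum>i<n. q i - p i) < \<delta>" by simp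
      with \<delta>[of n p q] * \<open>t \<le> b\<close> show ?thesis by fastforce
    qed
    have F0: "F t 0" for t
      unfolding F_def by (rule exI[of _ 0]) (simp add: disjoint_family_on_def)
    have bdd: "bdd_above (Collect (F t))" if "t \<le> b" for t
      using F_le that by (auto intro!: bdd_aboveI)
    have \<Phi>0: "0 \<le> \<Phi> t" if "t \<le> b" for t
      unfolding \<Phi>_def using bdd[OF that] F0 by (auto intro: cSup_upper)
    have \<Phi>_le: "\<Phi> t \<le> \<epsilon>" if "t \<le> b" for t
      unfolding \<Phi>_def using F_le that F0[of t] by (intro cSup_least) auto
    have \<Phi>_mono: "\<Phi> s \<le> \<Phi> t" if "s \<le> t" "t \<le> b" for s t
      unfolding \<Phi>_def
    proof (rule cSup_subset_mono)
      show "Collect (F s) \<noteq> {}" using F0 by auto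
      show "Collect (F s) \<subseteq> Collect (F t)"
      proof
        fix v assume "v \<in> Collect (F s)"
        then obtain n :: nat and p q where *: "\<forall>i<n. a \<le> p i \<and> p i \<le> q i \<and> q i \<le> s \<and> {p i..q i} \<subseteq> G"
          "disjoint_family_on (\<lambda>i. {p i<..<q i}) {..<n}" "v = (\<Sum>i<n. norm (w (q i) - w (p i)))"
          unfolding F_def by blast
        then show "v \<in> Collect (F t)"
          unfolding F_def mem_Collect_eq using that by (intro exI[of _ n] exI[of _ p] exI[of _ q]) auto
      qed
    qed (use bdd that in auto)
    have \<Phi>_step: "\<Phi> s + norm (w t - w s) \<le> \<Phi> t" if "a \<le> s" "s \<le> t" "t \<le> b" "{s..t} \<subseteq> G" for s t
    proof -
      have "v + norm (w t - w s) \<le> \<Phi> t" if v: "F s v" for v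
      proof -
        obtain n :: nat and p q where *: "\<forall>i<n. a \<le> p i \<and> p i \<le> q i \<and> q i \<le> s \<and> {p i..q i} \<subseteq> G"
          "disjoint_family_on (\<lambda>i. {p i<..<q i}) {..<n}" "v = (\<Sum>i<n. norm (w (q i) - w (p i)))"
          using v unfolding F_def by blast
        have "F t (v + norm (w t - w s))"
          unfolding F_def
        proof (intro exI conjI)
          let ?p = "p(n := s)" and ?q = "q(n := t)"
          show "\<forall>i<Suc n. a \<le> ?p i \<and> ?p i \<le> ?q i \<and> ?q i \<le> t \<and> {?p i..?q i} \<subseteq> G"
            using * \<open>a \<le> s\<close> \<open>s \<le> t\<close> \<open>{s..t} \<subseteq> G\<close> by (auto simp: less_Suc_eq)
          show "disjoint_family_on (\<lambda>i. {?p i<..<?q i}) {..<Suc n}"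
            unfolding lessThan_Suc
          proof (subst disjoint_family_on_insert)
            have "{s<..<t} \<inter> (\<Union>i<n. {?p i<..<?q i}) = {}" using * by fastforce
            moreover have "disjoint_family_on (\<lambda>i. {?p i<..<?q i}) {..<n}"
              using *(2) by (auto simp: disjoint_family_on_def)
            ultimately show "{?p n<..<?q n} \<inter> (\<Union>i<n. {?p i<..<?q i}) = {} \<and>
              disjoint_family_on (\<lambda>i. {?p i<..<?q i}) {..<n}" by simp
          qed simp
          show "v + norm (w t - w s) = (\<Sum>i<Suc n. norm (w (?q i) - w (?p i)))"
            using * by simp
        qed
        then show ?thesis unfolding \<Phi>_def using bdd[OF \<open>t \<le> b\<close>] by (auto intro: cSup_upper)
      qed
      then have "\<Phi> s \<le> \<Phi> t - norm (w t - w s)"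
        unfolding \<Phi>_def[of s] using F0[of s] by (intro cSup_least) (auto simp: algebra_simps)
      then show ?thesis by simp
    qed
    define S where "S = {t \<in> {a..b}. w t - w a \<le> \<epsilon> * (t - a) + \<Phi> t}"
    have "a \<in> S" unfolding S_def using \<open>a \<le> b\<close> \<Phi>0[of a] by auto
    have bS: "bdd_above S" unfolding S_def by (auto intro!: bdd_aboveI)
    define s where "s = Sup S"
    have up: "t \<le> s" if "t \<in> S" for t unfolding s_def using that bS by (rule cSup_upper)
    have s: "a \<le> s" "s \<le> b"
      using up[OF \<open>a \<in> S\<close>] \<open>a \<in> S\<close> unfolding s_def by (auto intro!: cSup_least simp: S_def)
    have "s \<in> S"
    proof -
      have cont: "continuous_on {a..b} (\<lambda>t. w t - \<epsilon> * t)"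
        using abs_continuous_on_interval_imp_continuous_on[OF ac] by (intro continuous_intros)
      have "closed {t \<in> {a..b}. w t - \<epsilon> * t \<le> w a - \<epsilon> * a + \<Phi> s}"
        using cont by (intro continuous_closed_preimage_constant continuous_on_closed_Collect_le) (auto intro: continuous_intros)
      moreover have "S \<subseteq> {t \<in> {a..b}. w t - \<epsilon> * t \<le> w a - \<epsilon> * a + \<Phi> s}"
      proof
        fix t assume t: "t \<in> S"
        then have "\<Phi> t \<le> \<Phi> s" using up s by (intro \<Phi>_mono) auto
        with t show "t \<in> {t \<in> {a..b}. w t - \<epsilon> * t \<le> w a - \<epsilon> * a + \<Phi> s}"
          by (auto simp: S_def algebra_simps)
      qed
      ultimately have "s \<in> {t \<in> {a..b}. w t - \<epsilon> * t \<le> w a - \<epsilon> * a + \<Phi> s}"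
        unfolding s_def using \<open>a \<in> S\<close> bS by (intro closed_subset_contains_Sup) auto
      then show ?thesis by (auto simp: S_def algebra_simps)
    qed
    have "s = b"
    proof (rule ccontr)
      assume "s \<noteq> b"
      with s have "s < b" by simp
      \<comment> \<open>If \<open>s\<close> is exceptional, a small interval to its right lies in
        \<open>G\<close> and the increment of \<open>w\<close> is paid for by \<open>\<Phi>\<close>;
        otherwise the Dini bound pays for it with slope \<open>\<epsilon>\<close>.\<close>
      have "\<exists>t>s. t \<in> S"
      proof (cases "s \<in> N")
        case True
        then have "s \<in> G" using G by auto
        then obtain e where e: "e > 0" "ball s e \<subseteq> G" using \<open>open G\<close> openE by blast
        define t where "t = min b (s + e / 2)"
        have t: "s < t" "t \<le> b" using \<open>s < b\<close> e by (auto simp: t_def)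
        have "{s..t} \<subseteq> ball s e" using e by (auto simp: t_def dist_real_def)
        with e have "\<Phi> s + norm (w t - w s) \<le> \<Phi> t" using t s by (intro \<Phi>_step) auto
        moreover have "\<epsilon> * (s - a) \<le> \<epsilon> * (t - a)" using t \<open>\<epsilon> > 0\<close> by simp
        ultimately have "t \<in> S" using \<open>s \<in> S\<close> t s unfolding S_def by auto
        with t show ?thesis by blast
      next
        case False
        then have "dini_le w s 0" using N0(2)[of s] s \<open>s < b\<close> by (auto simp: N_def)
        then have ev: "\<forall>\<^sub>F h in at_right 0. w (s + h) - w s \<le> \<epsilon> * h"
          using \<open>\<epsilon> > 0\<close> unfolding dini_le_def by fastforce
        have ev2: "\<forall>\<^sub>F h in at_right 0. h < b - s \<and> h > 0"
          using \<open>s < b\<close> eventually_at_right_less[of 0] by (auto simp: eventually_at_right_field intro!: exI[of _ "b - s"])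
        obtain h where h: "w (s + h) - w s \<le> \<epsilon> * h" "h < b - s" "h > 0"
          using eventually_happens'[OF _ eventually_conj[OF ev ev2]] by auto
        have "\<Phi> s \<le> \<Phi> (s + h)" using h by (intro \<Phi>_mono) auto
        with h \<open>s \<in> S\<close> s have "s + h \<in> S" by (auto simp: S_def algebra_simps)
        with h show ?thesis by (intro exI[of _ "s + h"]) auto
      qed
      with up show False by force
    qed
    with \<open>s \<in> S\<close> \<Phi>_le[of b] show ?thesis by (auto simp: S_def)
  qed
  note * = this
  have "((\<lambda>\<epsilon>. \<epsilon> * (b - a) + \<epsilon>) \<longlongrightarrow> 0 * (b - a) + 0) (at_right 0)"
    by (intro tendsto_intros)
  moreover have "\<forall>\<^sub>F \<epsilon> in at_right 0. w b - w a \<le> \<epsilon> * (b - a) + \<epsilon>"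
    using * eventually_at_right_less[of "0::real"] by (auto elim: eventually_mono)
  ultimately have "w b - w a \<le> 0 * (b - a) + 0"
    by (intro tendsto_lowerbound) auto
  then show ?thesis by simp
qed

section \<open>Comparison functions\<close>

lemma class_KD:
  assumes "a \<in> class_K"
  shows "a 0 = 0" "\<And>s. s > 0 \<Longrightarrow> a s > 0" "\<And>s. s \<ge> 0 \<Longrightarrow> a s \<ge> 0"
    "\<And>s t. 0 \<le> s \<Longrightarrow> s < t \<Longrightarrow> a s < a t" "\<And>s t. 0 \<le> s \<Longrightarrow> s \<le> t \<Longrightarrow> a s \<le> a t"
    "\<And>s t. 0 \<le> s \<Longrightarrow> 0 \<le> t \<Longrightarrow> a s \<le> a t \<longleftrightarrow> s \<le> t"
    "continuous_on {0..} a"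
proof -
  show 0: "a 0 = 0" and 1: "\<And>s. s > 0 \<Longrightarrow> a s > 0" and c: "continuous_on {0..} a"
    using assms by (auto simp: class_K_def positive_definite_def)
  then show "\<And>s. s \<ge> 0 \<Longrightarrow> a s \<ge> 0" by (metis order_le_less)
  show 2: "\<And>s t. 0 \<le> s \<Longrightarrow> s < t \<Longrightarrow> a s < a t"
    using assms by (auto simp: class_K_def strict_mono_on_def)
  then show 3: "\<And>s t. 0 \<le> s \<Longrightarrow> s \<le> t \<Longrightarrow> a s \<le> a t" by (metis order_le_less)
  show "\<And>s t. 0 \<le> s \<Longrightarrow> 0 \<le> t \<Longrightarrow> a s \<le> a t \<longleftrightarrow> s \<le> t"
    using 2 3 by (meson linorder_not_less)
qed

lemma class_Kinf_imp_K: "a \<in> class_Kinf \<Longrightarrow> a \<in> class_K"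
  by (simp add: class_Kinf_def)

lemma class_KI:
  assumes "a 0 = 0" "\<And>s t. 0 \<le> s \<Longrightarrow> s < t \<Longrightarrow> a s < a t" "continuous_on {0..} a"
  shows "a \<in> class_K"
  using assms by (fastforce simp: class_K_def positive_definite_def strict_mono_on_def)

lemma class_Kinf_ge_ex:
  assumes "a \<in> class_Kinf"
  obtains s where "s \<ge> 0" "a s \<ge> y"
proof -
  have "filterlim a at_top at_top" using assms by (simp add: class_Kinf_def)
  then have "\<forall>\<^sub>F s in at_top. y \<le> a s" by (simp add: filterlim_at_top)
  moreover have "\<forall>\<^sub>F s::real in at_top. 0 \<le> s" by (rule eventually_ge_at_top)
  ultimately have "\<forall>\<^sub>F s::real in at_top. y \<le> a s \<and> 0 \<le> s" by (rule eventually_conj)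
  then show ?thesis using that eventually_happens'[OF trivial_limit_at_top_linorder] by auto
qed

lemma class_Kinf_inverse:
  assumes a: "a \<in> class_Kinf"
  defines "g \<equiv> inv_into {0..} a"
  shows "\<And>s. s \<ge> 0 \<Longrightarrow> g s \<ge> 0" "\<And>s. s \<ge> 0 \<Longrightarrow> a (g s) = s" "\<And>s. s \<ge> 0 \<Longrightarrow> g (a s) = s"
    "g \<in> class_Kinf"
proof -
  note aD = class_KD[OF class_Kinf_imp_K[OF a]]
  have inj: "inj_on a {0..}"
    using aD(4) by (intro linorder_inj_onI) (auto simp: order_less_le)
  have surj: "y \<in> a ` {0..}" if y: "y \<ge> 0" for y
  proof -
    obtain s where s: "s \<ge> 0" "a s \<ge> y" using class_Kinf_ge_ex[OF a] .
    have "continuous_on {0..s} a" using aD(7) by (rule continuous_on_subset) auto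
    with s obtain x where "0 \<le> x" "x \<le> s" "a x = y"
      using IVT'[of a 0 y s] aD(1) y by auto
    then show ?thesis by auto
  qed
  show g0: "g s \<ge> 0" if "s \<ge> 0" for s
    using inv_into_into[OF surj[OF that]] by (simp add: g_def)
  show ag: "a (g s) = s" if "s \<ge> 0" for s
    unfolding g_def using surj[OF that] by (rule f_inv_into_f)
  show ga: "g (a s) = s" if "s \<ge> 0" for s
    unfolding g_def using inj that by (simp add: inv_into_f_f)
  have g_strict: "g s < g t" if "0 \<le> s" "s < t" for s t
    using aD(6)[of "g t" "g s"] ag[of s] ag[of t] g0[of s] g0[of t] that by (simp add: not_le[symmetric])
  have g_zero: "g 0 = 0" using ga[of 0] aD(1) by simp
  \<comment> \<open>Extending the inverse by the identity on the negative axis gives a monotone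
    function with range all of the reals, and a monotone function with open range is
    continuous.\<close>
  have "continuous_on UNIV (\<lambda>s. if s < 0 then s else g s)"
  proof (rule continuous_onI_mono)
    have "y \<in> range (\<lambda>s. if s < 0 then s else g s)" for y
    proof (cases "y < 0")
      case True
      then show ?thesis by (intro range_eqI[of _ _ y]) simp
    next
      case False
      then show ?thesis using ga[of y] aD(3)[of y] by (intro range_eqI[of _ _ "a y"]) simp
    qed
    then have "range (\<lambda>s. if s < 0 then s else g s) = UNIV" by blast
    then show "open (range (\<lambda>s. if s < 0 then s else g s))" by simp
  next
    fix s t :: real assume "s \<le> t"
    then show "(if s < 0 then s else g s) \<le> (if t < 0 then t else g t)"
      using g_strict[of s t] g0[of t] by (cases "s = t") auto
  qed
  then have "continuous_on {0..} (\<lambda>s. if s < 0 then s else g s)"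
    by (rule continuous_on_subset) simp
  then have "continuous_on {0..} g"
    by (rule continuous_on_eq) auto
  then have "g \<in> class_K" using g_strict g_zero by (intro class_KI[of g]) auto
  moreover have "filterlim g at_top at_top"
    unfolding filterlim_at_top_ge[where c = 0]
  proof (intro allI impI)
    fix Z :: real assume "0 \<le> Z"
    have "Z \<le> g s" if "s \<ge> a Z" for s
      using class_KD(5)[OF \<open>g \<in> class_K\<close> aD(3)[OF \<open>0 \<le> Z\<close>] that] ga[OF \<open>0 \<le> Z\<close>] by simp
    then show "\<forall>\<^sub>F s in at_top. Z \<le> g s" by (rule eventually_at_top_linorderI)
  qed
  ultimately show "g \<in> class_Kinf" by (simp add: class_Kinf_def)
qed

lemma class_K_comp:
  assumes a: "a \<in> class_K" and b: "b \<in> class_K"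
  shows "(\<lambda>s. a (b s)) \<in> class_K"
proof (rule class_KI)
  show "a (b 0) = 0" using class_KD(1)[OF a] class_KD(1)[OF b] by simp
  show "a (b s) < a (b t)" if "0 \<le> s" "s < t" for s t
    using that by (intro class_KD(4)[OF a] class_KD(4)[OF b] class_KD(3)[OF b])
  show "continuous_on {0..} (\<lambda>s. a (b s))"
    by (rule continuous_on_compose2[OF class_KD(7)[OF a] class_KD(7)[OF b]])
       (auto intro: class_KD(3)[OF b])
qed

lemma class_Kinf_comp:
  assumes "a \<in> class_Kinf" "b \<in> class_Kinf"
  shows "(\<lambda>s. a (b s)) \<in> class_Kinf"
  using assms class_K_comp[of a b] filterlim_compose[of a at_top at_top b at_top]
  by (simp add: class_Kinf_def)

lemma class_Kinf_scale:
  assumes "c > 0"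
  shows "(\<lambda>s. c * s) \<in> class_Kinf"
  unfolding class_Kinf_def
proof (intro CollectI conjI)
  show "(\<lambda>s. c * s) \<in> class_K" using assms by (intro class_KI) (simp_all add: continuous_intros)
  show "filterlim (\<lambda>s. c * s) at_top at_top"
    using assms by (intro filterlim_tendsto_pos_mult_at_top[OF tendsto_const]) (simp_all add: filterlim_ident)
qed

lemma class_KLD:
  assumes "\<sigma> \<in> class_KL"
  shows "\<And>t. t \<ge> 0 \<Longrightarrow> (\<lambda>s. \<sigma> s t) \<in> class_K"
    "\<And>s. s \<ge> 0 \<Longrightarrow> antimono_on {0..} (\<sigma> s)" "\<And>s. s \<ge> 0 \<Longrightarrow> (\<sigma> s \<longlongrightarrow> 0) at_top"
    "continuous_on ({0..} \<times> {0..}) (\<lambda>(s, t). \<sigma> s t)"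
  using assms unfolding class_KL_def by blast+

lemma class_KL_comp:
  assumes a: "a \<in> class_K" and b: "b \<in> class_K" and \<sigma>: "\<sigma> \<in> class_KL"
  shows "(\<lambda>s t. a (\<sigma> (b s) t)) \<in> class_KL"
proof -
  note \<sigma>D = class_KLD[OF \<sigma>]
  have \<sigma>0: "\<sigma> s t \<ge> 0" if "s \<ge> 0" "t \<ge> 0" for s t
    using class_KD(3)[OF \<sigma>D(1)] that by simp
  have "continuous_on ({0..} \<times> {0..}) (\<lambda>z. \<sigma> (b (fst z)) (snd z))"
  proof -
    have "continuous_on ({0..} \<times> {0..}) (\<lambda>z::real \<times> real. b (fst z))"
      by (rule continuous_on_compose2[OF class_KD(7)[OF b]]) (auto intro: continuous_intros)
    then have "continuous_on ({0..} \<times> {0..}) (\<lambda>z::real \<times> real. (b (fst z), snd z))"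
      by (intro continuous_intros)
    from continuous_on_compose2[OF \<sigma>D(4) this] class_KD(3)[OF b] show ?thesis
      by (simp add: image_subset_iff case_prod_beta')
  qed
  then have "continuous_on ({0..} \<times> {0..}) (\<lambda>z. a (\<sigma> (b (fst z)) (snd z)))"
    by (rule continuous_on_compose2[OF class_KD(7)[OF a]]) (use \<sigma>0 class_KD(3)[OF b] in auto)
  then have "continuous_on ({0..} \<times> {0..}) (\<lambda>(s, t). a (\<sigma> (b s) t))"
    by (simp add: case_prod_beta')
  moreover have "(\<lambda>s. a (\<sigma> (b s) t)) \<in> class_K" if "t \<ge> 0" for t
    using class_K_comp[OF a class_K_comp[OF \<sigma>D(1)[OF that] b]] .
  moreover have "antimono_on {0..} (\<lambda>t. a (\<sigma> (b s) t))" if "s \<ge> 0" for s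
    using \<sigma>D(2)[OF class_KD(3)[OF b that]] \<sigma>0 class_KD(3)[OF b that]
    by (auto simp: monotone_on_def intro!: class_KD(5)[OF a])
  moreover have "((\<lambda>t. a (\<sigma> (b s) t)) \<longlongrightarrow> 0) at_top" if "s \<ge> 0" for s
  proof -
    have "((\<lambda>t. a (\<sigma> (b s) t)) \<longlongrightarrow> a 0) at_top"
    proof (rule continuous_on_tendsto_compose[OF class_KD(7)[OF a] \<sigma>D(3)])
      show "\<forall>\<^sub>F t in at_top. \<sigma> (b s) t \<in> {0..}"
        using class_KD(3)[OF b that] \<sigma>0 by (intro eventually_at_top_linorderI[of 0]) simp
    qed (use class_KD(3)[OF b that] in auto)
    then show ?thesis by (simp add: class_KD(1)[OF a])
  qed
  ultimately show ?thesis unfolding class_KL_def by blast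
qed

text \<open>The bound is the least function dominating the reachable values which decreases at unit speed
  in \<open>t\<close> and grows at speed \<open>2\<close> in \<open>s\<close>. Since \<open>y \<le> s\<close>, speed \<open>2\<close> makes the reachable values
  from \<open>s' > 2 s\<close> irrelevant at \<open>s\<close>.\<close>

lemma class_KL_bound_exists:
  fixes P :: "real \<Rightarrow> real \<Rightarrow> real \<Rightarrow> bool"
  assumes nonneg: "\<And>s t y. P s t y \<Longrightarrow> s \<ge> 0 \<and> t \<ge> 0 \<and> y \<le> s"
    and decay: "\<And>s \<epsilon>. s > 0 \<Longrightarrow> \<epsilon> > 0 \<Longrightarrow> \<exists>T. \<forall>s' t y. s' \<le> s \<longrightarrow> t \<ge> T \<longrightarrow> P s' t y \<longrightarrow> y \<le> \<epsilon>"
  shows "\<exists>\<sigma>\<in>class_KL. \<forall>s t y. P s t y \<longrightarrow> y \<le> \<sigma> s t"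
proof -
  \<comment> \<open>Inserting \<open>0\<close> makes the set nonempty and its supremum
    nonnegative.\<close>
  define E where "E s t = insert 0 {y - 2 * max 0 (s' - s) - max 0 (t - t') | s' t' y. P s' t' y}" for s t
  \<comment> \<open>The supremum is only weakly increasing in \<open>s\<close>; the term
    \<open>s * exp (- t)\<close> in the next definition makes it strictly increasing without harming
    the decay in \<open>t\<close>.\<close>
  define \<sigma>1 where "\<sigma>1 s t = Sup (E s t)" for s t
  define \<sigma> where "\<sigma> s t = \<sigma>1 s t + s * exp (- t)" for s t :: real
  have E_le: "v \<le> s" if v: "v \<in> E s t" and "s \<ge> 0" for v s t
  proof -
    consider "v = 0" | s' t' y where "P s' t' y" "v = y - 2 * max 0 (s' - s) - max 0 (t - t')"
      using v unfolding E_def by auto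
    then show ?thesis
    proof cases
      case 2
      then show ?thesis using nonneg[OF 2(1)] \<open>s \<ge> 0\<close> by (simp add: max_def split: if_splits)
    qed (use \<open>s \<ge> 0\<close> in simp)
  qed
  have bdd: "bdd_above (E s t)" if "s \<ge> 0" for s t
    by (rule bdd_aboveI[of _ s]) (rule E_le[OF _ that])
  have up: "v \<le> \<sigma>1 s t" if "v \<in> E s t" "s \<ge> 0" for v s t
    unfolding \<sigma>1_def using that bdd by (intro cSup_upper)
  have least: "\<sigma>1 s t \<le> c" if "\<And>v. v \<in> E s t \<Longrightarrow> v \<le> c" for s t c
    unfolding \<sigma>1_def using that by (intro cSup_least) (auto simp: E_def)
  have \<sigma>1_nonneg: "0 \<le> \<sigma>1 s t" if "s \<ge> 0" for s t
    using up[OF _ that] by (simp add: E_def)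
  have compare: "\<sigma>1 s t \<le> \<sigma>1 s2 t2 + c"
    if "s \<ge> 0" "s2 \<ge> 0" "c \<ge> 0" "2 * max 0 (s - s2) + max 0 (t2 - t) \<le> c" for s t s2 t2 c
  proof (rule least)
    fix v assume "v \<in> E s t"
    then consider "v = 0" | s' t' y where "P s' t' y" "v = y - 2 * max 0 (s' - s) - max 0 (t - t')"
      unfolding E_def by auto
    then show "v \<le> \<sigma>1 s2 t2 + c"
    proof cases
      case 1
      then show ?thesis using \<sigma>1_nonneg[OF \<open>s2 \<ge> 0\<close>, of t2] \<open>c \<ge> 0\<close> by simp
    next
      case 2
      then have "y - 2 * max 0 (s' - s2) - max 0 (t2 - t') \<in> E s2 t2" unfolding E_def by blast
      from up[OF this \<open>s2 \<ge> 0\<close>] 2 that(4) show ?thesis by (simp add: max_def split: if_splits)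
    qed
  qed
  have lip: "\<bar>\<sigma>1 s t - \<sigma>1 s2 t2\<bar> \<le> 2 * \<bar>s - s2\<bar> + \<bar>t - t2\<bar>" if "s \<ge> 0" "s2 \<ge> 0" for s t s2 t2
  proof -
    have "2 * max 0 (s - s2) + max 0 (t2 - t) \<le> 2 * \<bar>s - s2\<bar> + \<bar>t - t2\<bar>"
      "2 * max 0 (s2 - s) + max 0 (t - t2) \<le> 2 * \<bar>s - s2\<bar> + \<bar>t - t2\<bar>" by (simp_all add: max_def)
    from compare[OF that _ this(1)] compare[OF that(2,1) _ this(2)] show ?thesis by (simp add: abs_le_iff)
  qed
  have "continuous_on ({0..} \<times> UNIV) (\<lambda>z. \<sigma>1 (fst z) (snd z))"
  proof (rule lipschitz_on_continuous_on[where L = 3], rule lipschitz_onI)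
    fix z z' :: "real \<times> real" assume "z \<in> {0..} \<times> UNIV" "z' \<in> {0..} \<times> UNIV"
    then have "\<bar>\<sigma>1 (fst z) (snd z) - \<sigma>1 (fst z') (snd z')\<bar> \<le> 2 * \<bar>fst z - fst z'\<bar> + \<bar>snd z - snd z'\<bar>"
      by (intro lip) auto
    also have "\<dots> \<le> 2 * dist z z' + dist z z'"
      using dist_fst_le[of z z'] dist_snd_le[of z z'] by (intro add_mono) (auto simp: dist_real_def)
    finally show "dist (\<sigma>1 (fst z) (snd z)) (\<sigma>1 (fst z') (snd z')) \<le> 3 * dist z z'"
      by (simp add: dist_real_def)
  qed simp
  then have "continuous_on ({0..} \<times> {0..}) (\<lambda>z. \<sigma> (fst z) (snd z))"
    unfolding \<sigma>_def by (intro continuous_intros) (auto elim: continuous_on_subset)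
  then have cont: "continuous_on ({0..} \<times> {0..}) (\<lambda>(s, t). \<sigma> s t)" by (simp add: case_prod_beta')
  have K: "(\<lambda>s. \<sigma> s t) \<in> class_K" if "t \<ge> 0" for t
  proof (rule class_KI)
    have "\<sigma>1 0 t = 0" 
    proof (rule antisym)
      show "\<sigma>1 0 t \<le> 0" using E_le[of _ 0 t] by (intro least) simp
    qed (use \<sigma>1_nonneg in simp)
    then show "\<sigma> 0 t = 0" by (simp add: \<sigma>_def)
    show "\<sigma> s t < \<sigma> s2 t" if "0 \<le> s" "s < s2" for s s2
    proof -
      have "\<sigma>1 s t \<le> \<sigma>1 s2 t" using compare[of s s2 0 t t] that by simp
      with \<open>s < s2\<close> show ?thesis by (simp add: \<sigma>_def add_le_less_mono)
    qed
    show "continuous_on {0..} (\<lambda>s. \<sigma> s t)"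
    proof -
      have "continuous_on {0..} (\<lambda>s. (s, t))" by (intro continuous_intros)
      from continuous_on_compose2[OF cont this] that show ?thesis by (simp add: image_subset_iff)
    qed
  qed
  have anti: "antimono_on {0..} (\<sigma> s)" if "s \<ge> 0" for s
  proof (rule monotone_onI)
    fix t t2 :: real assume "t \<le> t2"
    have "\<sigma>1 s t2 \<le> \<sigma>1 s t" using compare[of s s 0 t t2] that \<open>t \<le> t2\<close> by simp
    moreover have "s * exp (- t2) \<le> s * exp (- t)" using that \<open>t \<le> t2\<close> by (intro mult_left_mono) auto
    ultimately show "\<sigma> s t2 \<le> \<sigma> s t" by (simp add: \<sigma>_def)
  qed
  have lim: "(\<sigma> s \<longlongrightarrow> 0) at_top" if "s \<ge> 0" for s
  proof -
    have "(\<sigma>1 s \<longlongrightarrow> 0) at_top"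
    proof (rule tendstoI)
      fix \<epsilon> :: real assume "\<epsilon> > 0"
      \<comment> \<open>Reachable values from \<open>s' > 2 * s + 1\<close> are penalized below
        \<open>0\<close>. Those from \<open>t' < T\<close> are too once
        \<open>t \<ge> T + 2 * s + 1\<close>, because after the penalty in \<open>s'\<close> they
        are at most \<open>s\<close>. The \<open>+ 1\<close> keeps the level positive when
        \<open>s = 0\<close>, as \<open>decay\<close> requires.\<close>
      obtain T where T: "\<And>s' t y. s' \<le> 2 * s + 1 \<Longrightarrow> t \<ge> T \<Longrightarrow> P s' t y \<Longrightarrow> y \<le> \<epsilon> / 2"
        using decay[of "2 * s + 1" "\<epsilon> / 2"] \<open>\<epsilon> > 0\<close> \<open>s \<ge> 0\<close> by auto
      have "\<sigma>1 s t \<le> \<epsilon> / 2" if t: "t \<ge> T + 2 * s + 1" for t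
      proof (rule least)
        fix v assume "v \<in> E s t"
        then consider "v = 0" | s' t' y where "P s' t' y" "v = y - 2 * max 0 (s' - s) - max 0 (t - t')"
          unfolding E_def by auto
        then show "v \<le> \<epsilon> / 2"
        proof cases
          case 2
          show ?thesis
          proof (cases "s' \<le> 2 * s + 1 \<and> t' \<ge> T")
            case True
            then have "y \<le> \<epsilon> / 2" using T[of s' t' y] 2 by auto
            moreover have "v \<le> y" using 2(2) by (simp add: max_def)
            ultimately show ?thesis by simp
          next
            case False
            then have "v \<le> 0" using nonneg[OF 2(1)] 2(2) t \<open>s \<ge> 0\<close> by (auto simp: max_def)
            then show ?thesis using \<open>\<epsilon> > 0\<close> by simp
          qed
        qed (use \<open>\<epsilon> > 0\<close> in simp)
      qed
      then have "dist (\<sigma>1 s t) 0 < \<epsilon>" if "t \<ge> T + 2 * s + 1" for t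
        using \<sigma>1_nonneg[OF \<open>s \<ge> 0\<close>, of t] that \<open>\<epsilon> > 0\<close> by (fastforce simp: dist_real_def)
      then show "\<forall>\<^sub>F t in at_top. dist (\<sigma>1 s t) 0 < \<epsilon>" by (rule eventually_at_top_linorderI)
    qed
    moreover have "((\<lambda>t. s * exp (- t)) \<longlongrightarrow> s * 0) at_top"
      by (intro tendsto_intros filterlim_compose[OF exp_at_bot] filterlim_uminus_at_bot_at_top)
    ultimately show ?thesis unfolding \<sigma>_def using tendsto_add by fastforce
  qed
  have "\<sigma> \<in> class_KL" unfolding class_KL_def using cont K anti lim by blast
  moreover have "y \<le> \<sigma> s t" if "P s t y" for s t y
  proof -
    have "y - 2 * max 0 (s - s) - max 0 (t - t) \<in> E s t" unfolding E_def using that by blast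
    then have "y \<le> \<sigma>1 s t" using up[of y s t] nonneg[OF that] by simp
    then show ?thesis using nonneg[OF that] by (simp add: \<sigma>_def add_increasing2)
  qed
  ultimately show ?thesis by blast
qed

section \<open>Scalar Razumikhin estimates\<close>

lemma dini_le_add_linear:
  assumes "dini_le w t c"
  shows "dini_le (\<lambda>t. w t + k * t) t (c + k)"
  unfolding dini_le_def
proof (intro allI impI)
  fix e :: real assume "e > 0"
  then have "\<forall>\<^sub>F h in at_right 0. w (t + h) - w t \<le> (c + e) * h"
    using assms by (simp add: dini_le_def)
  then show "\<forall>\<^sub>F h in at_right 0. w (t + h) + k * (t + h) - (w t + k * t) \<le> (c + k + e) * h"
    by eventually_elim (simp add: algebra_simps)
qed

lemma dini_le_mono:
  assumes "dini_le w t c" "c \<le> c'"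
  shows "dini_le w t c'"
  unfolding dini_le_def
proof (intro allI impI)
  fix e :: real assume "e > 0"
  then have "\<forall>\<^sub>F h in at_right 0. w (t + h) - w t \<le> (c + e) * h"
    using assms by (simp add: dini_le_def)
  moreover have "\<forall>\<^sub>F h::real in at_right 0. h > 0" by (rule eventually_at_right_less)
  ultimately show "\<forall>\<^sub>F h in at_right 0. w (t + h) - w t \<le> (c' + e) * h"
  proof eventually_elim
    case (elim h)
    then have "(c + e) * h \<le> (c' + e) * h" using assms(2) by (intro mult_right_mono) auto
    with elim show ?case by linarith
  qed
qed

text \<open>Adding \<open>c * t\<close> reduces this to the monotonicity theorem. The sign of
  \<open>c\<close> is free: a negative \<open>c\<close> turns the statement into a bound on
  growth.\<close>

lemma abs_continuous_dini_decrease: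
  fixes w :: "real \<Rightarrow> real"
  assumes "a \<le> b" and ac: "abs_continuous_on_interval a b w"
    and ae: "AE t in lebesgue. a < t \<and> t < b \<longrightarrow> dini_le w t (- c)"
  shows "w b \<le> w a - c * (b - a)"
proof -
  have "w b + c * b \<le> w a + c * a"
  proof (rule abs_continuous_dini_nonincreasing[OF \<open>a \<le> b\<close>])
    show "abs_continuous_on_interval a b (\<lambda>t. w t + c * t)"
    proof (rule abs_continuous_on_interval_dominated[OF ac, where \<eta> = 1 and L = "1 + \<bar>c\<bar>"])
      fix s t :: real
      have "norm (w s + c * s - (w t + c * t)) \<le> norm (w s - w t) + \<bar>c\<bar> * \<bar>s - t\<bar>"
        using norm_triangle_ineq[of "w s - w t" "c * (s - t)"] by (simp add: algebra_simps abs_mult[symmetric])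
      also have "\<dots> \<le> (1 + \<bar>c\<bar>) * (norm (w s - w t) + \<bar>s - t\<bar>)"
        by (simp add: algebra_simps)
      finally show "norm (w s + c * s - (w t + c * t)) \<le> (1 + \<bar>c\<bar>) * (norm (w s - w t) + \<bar>s - t\<bar>)" .
    qed auto
    show "AE t in lebesgue. a < t \<and> t < b \<longrightarrow> dini_le (\<lambda>t. w t + c * t) t 0"
      using ae by eventually_elim (use dini_le_add_linear[of w _ "- c" c] in auto)
  qed
  then show ?thesis by (simp add: algebra_simps)
qed

text \<open>After the last time at which \<open>w \<le> m\<close>, the function stays above
  \<open>m\<close>, where the Dini bound applies, so it cannot climb back over \<open>m\<close>. If
  there is no such time, the decrease acts on the whole interval.\<close>

lemma abs_continuous_level_decay:
  fixes w :: "real \<Rightarrow> real"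
  assumes "a \<le> b" "c \<ge> 0" and ac: "abs_continuous_on_interval a b w"
    and ae: "AE t in lebesgue. a < t \<and> t < b \<and> m \<le> w t \<longrightarrow> dini_le w t (- c)"
  shows "w b \<le> max m (w a - c * (b - a))"
proof (cases "\<exists>s\<in>{a..b}. w s \<le> m")
  case False
  then have gt: "m \<le> w t" if "t \<in> {a..b}" for t using that by (meson linear)
  have "w b \<le> w a - c * (b - a)"
  proof (rule abs_continuous_dini_decrease[OF \<open>a \<le> b\<close> ac])
    show "AE t in lebesgue. a < t \<and> t < b \<longrightarrow> dini_le w t (- c)"
      using ae by eventually_elim (use gt in auto)
  qed
  then show ?thesis by simp
next
  case True
  define S where "S = {s \<in> {a..b}. w s \<le> m}"
  define s where "s = Sup S"
  have "closed S"
    unfolding S_def using abs_continuous_on_interval_imp_continuous_on[OF ac]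
    by (intro continuous_on_closed_Collect_le) (auto intro: continuous_intros)
  moreover have S: "S \<noteq> {}" "bdd_above S" using True by (auto simp: S_def)
  ultimately have "s \<in> S" unfolding s_def by (intro closed_contains_Sup) auto
  then have s: "a \<le> s" "s \<le> b" "w s \<le> m" by (auto simp: S_def)
  have gt: "m < w t" if "s < t" "t \<le> b" for t
  proof (rule ccontr)
    assume "\<not> m < w t"
    with that s have "t \<in> S" by (auto simp: S_def)
    then have "t \<le> s" unfolding s_def using S by (intro cSup_upper)
    with that show False by simp
  qed
  have "w b \<le> w s - c * (b - s)"
  proof (rule abs_continuous_dini_decrease[OF \<open>s \<le> b\<close>])
    show "abs_continuous_on_interval s b w"
      using ac s by (auto intro: abs_continuous_on_interval_subset)
    show "AE t in lebesgue. s < t \<and> t < b \<longrightarrow> dini_le w t (- c)"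
      using ae by eventually_elim (use gt s in \<open>auto simp: less_imp_le\<close>)
  qed
  also have "\<dots> \<le> m" using s mult_nonneg_nonneg[of c "b - s"] \<open>c \<ge> 0\<close> by linarith
  finally show ?thesis by simp
qed

text \<open>All that the decay argument retains of a trajectory. The horizon \<open>T\<close> is
  finite so that the input can be replaced by one constant \<open>q\<close>, and absolute continuity
  starts at \<open>t0\<close> because the initial history is merely continuous.\<close>

definition razumikhin :: "real \<Rightarrow> (real \<Rightarrow> real) \<Rightarrow> (real \<Rightarrow> real) \<Rightarrow> real \<Rightarrow> real \<Rightarrow> real \<Rightarrow> (real \<Rightarrow> real) \<Rightarrow> bool" where
  "razumikhin r a \<rho> t0 T q w \<longleftrightarrow> 0 \<le> q \<and> t0 \<le> T \<and> continuous_on {t0 - r..T} w \<and> (\<forall>t\<in>{t0 - r..T}. 0 \<le> w t) \<and>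
     abs_continuous_on_interval t0 T w \<and>
     (AE t in lebesgue. t0 < t \<and> t < T \<and> q \<le> w t \<and> a (SUP \<theta>\<in>{-r..0}. w (t + \<theta>)) \<le> w t \<longrightarrow>
        dini_le w t (- \<rho> (w t)))"

context
  fixes r :: real and a \<rho> :: "real \<Rightarrow> real"
  assumes r: "r > 0" and a: "a \<in> class_K" and a_less: "\<And>s. s > 0 \<Longrightarrow> a s < s"
    and \<rho>_cont: "continuous_on {0..} \<rho>" and \<rho>_pos: "positive_definite \<rho>"
begin

text \<open>A bound \<open>M\<close> from \<open>t1 - r\<close> onwards controls every window after
  \<open>t1\<close>, hence \<open>a (sup w) \<le> a M \<le> m\<close>. Above the fixed level
  \<open>m\<close> the delay thus disappears from the hypothesis, and a lower bound of
  \<open>\<rho>\<close> on \<open>[m,M]\<close> replaces the varying rate.\<close>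

lemma razumikhin_AE_bounded:
  assumes w: "razumikhin r a \<rho> t0 T q w" and t1: "t0 \<le> t1"
    and M: "\<And>t. t1 - r \<le> t \<Longrightarrow> t \<le> T \<Longrightarrow> w t \<le> M"
    and m: "q \<le> m" "a M \<le> m"
    and c: "\<And>y. m \<le> y \<Longrightarrow> y \<le> M \<Longrightarrow> c \<le> \<rho> y"
  shows "AE t in lebesgue. t1 < t \<and> t < T \<and> m \<le> w t \<longrightarrow> dini_le w t (- c)"
proof -
  have "AE t in lebesgue. t0 < t \<and> t < T \<and> q \<le> w t \<and> a (SUP \<theta>\<in>{-r..0}. w (t + \<theta>)) \<le> w t \<longrightarrow>
        dini_le w t (- \<rho> (w t))"
    using w by (simp add: razumikhin_def)
  then show ?thesis
  proof eventually_elim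
    case (elim t)
    show ?case
    proof
      assume t: "t1 < t \<and> t < T \<and> m \<le> w t"
      have w0: "0 \<le> w (t + \<theta>)" if "\<theta> \<in> {-r..0}" for \<theta>
        using w that t t1 by (auto simp: razumikhin_def)
      have wM: "w (t + \<theta>) \<le> M" if "\<theta> \<in> {-r..0}" for \<theta>
        using M[of "t + \<theta>"] that t by auto
      have "bdd_above ((\<lambda>\<theta>. w (t + \<theta>)) ` {-r..0})" using wM by (intro bdd_aboveI[of _ M]) auto
      then have "w (t + 0) \<le> (SUP \<theta>\<in>{-r..0}. w (t + \<theta>))" using r by (intro cSUP_upper) auto
      then have "0 \<le> (SUP \<theta>\<in>{-r..0}. w (t + \<theta>))" using w0[of 0] r by auto
      moreover have "(SUP \<theta>\<in>{-r..0}. w (t + \<theta>)) \<le> M" using wM r by (intro cSUP_least) auto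
      ultimately have "a (SUP \<theta>\<in>{-r..0}. w (t + \<theta>)) \<le> a M" by (rule class_KD(5)[OF a])
      then have "dini_le w t (- \<rho> (w t))" using elim t t1 m by auto
      then show "dini_le w t (- c)"
        using c[of "w t"] t wM[of 0] r by (auto elim!: dini_le_mono)
    qed
  qed
qed

lemma rho_nonneg: "y \<ge> 0 \<Longrightarrow> \<rho> y \<ge> 0"
  using \<rho>_pos by (metis order_le_less positive_definite_def)

text \<open>Suppose the maximum \<open>M\<close> of \<open>w\<close> exceeds \<open>max s q\<close>.
  With \<open>M\<close> as window bound, \<open>w\<close> does not increase above a level strictly
  below \<open>M\<close>, so it can never have reached \<open>M\<close>.\<close>

lemma razumikhin_bounded:
  assumes w: "razumikhin r a \<rho> t0 T q w"
    and init: "\<And>t. t0 - r \<le> t \<Longrightarrow> t \<le> t0 \<Longrightarrow> w t \<le> s" and t: "t0 - r \<le> t" "t \<le> T"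
  shows "w t \<le> max s q"
proof (rule ccontr)
  assume less: "\<not> w t \<le> max s q"
  have W: "0 \<le> q" "t0 \<le> T" "continuous_on {t0 - r..T} w" "\<And>t. t \<in> {t0 - r..T} \<Longrightarrow> 0 \<le> w t"
    "abs_continuous_on_interval t0 T w" using w by (auto simp: razumikhin_def)
  have "compact {t0 - r..T}" "{t0 - r..T} \<noteq> {}" using W r by auto
  from continuous_attains_sup[OF this W(3)] obtain t' where t': "t' \<in> {t0 - r..T}" 
    "\<And>\<tau>. \<tau> \<in> {t0 - r..T} \<Longrightarrow> w \<tau> \<le> w t'" by blast
  define M where "M = w t'"
  have M: "M > max s q" "M > 0" using less t'(2)[of t] t W(1) by (auto simp: M_def)
  define m where "m = max (max s q) (a M)"
  have "m < M" using M a_less[of M] by (auto simp: m_def)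
  have "t0 < t'" using init[of t'] t'(1) M by (auto simp: M_def not_le[symmetric])
  have s0: "0 \<le> m" using W(1) by (auto simp: m_def)
  have "w t' \<le> max m (w t0 - 0 * (t' - t0))"
  proof (rule abs_continuous_level_decay)
    show "abs_continuous_on_interval t0 t' w"
      using W(5) t' by (auto intro: abs_continuous_on_interval_subset)
    have "AE \<tau> in lebesgue. t0 < \<tau> \<and> \<tau> < T \<and> m \<le> w \<tau> \<longrightarrow> dini_le w \<tau> (- 0)"
      using s0 by (intro razumikhin_AE_bounded[OF w, where M = M] rho_nonneg) (auto simp: t'(2) M_def m_def)
    then show "AE \<tau> in lebesgue. t0 < \<tau> \<and> \<tau> < t' \<and> m \<le> w \<tau> \<longrightarrow> dini_le w \<tau> (- 0)"
      by eventually_elim (use t' in auto)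
  qed (use \<open>t0 < t'\<close> in auto)
  also have "\<dots> \<le> m" using init[of t0] r by (auto simp: m_def)
  finally show False using \<open>m < M\<close> by (simp add: M_def)
qed

text \<open>The floor \<open>\<epsilon>\<close> keeps the levels to be crossed in a compact interval
  away from \<open>0\<close>, where \<open>\<rho>\<close> has a positive minimum \<open>c\<close>;
  descending from \<open>M\<close> then takes time at most \<open>(M - m0) / c\<close>, whatever the
  trajectory. If \<open>M \<le> q\<close> the given bound already suffices.\<close>

lemma razumikhin_decay_step:
  assumes "0 < \<epsilon>"
  shows "\<exists>\<Theta>\<ge>0. \<forall>t0 T q w t1 t. razumikhin r a \<rho> t0 T q w \<longrightarrow> t0 \<le> t1 \<longrightarrow>
     (\<forall>\<tau>\<in>{t1 - r..T}. w \<tau> \<le> max M q) \<longrightarrow> t1 + \<Theta> - r \<le> t \<longrightarrow> t \<le> T \<longrightarrow> w t \<le> max (max (a M) \<epsilon>) q"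
proof -
  define m0 where "m0 = max (a M) \<epsilon>"
  show ?thesis
  proof (cases "m0 \<le> M")
    case False
    have "\<forall>t0 T q w t1 t. razumikhin r a \<rho> t0 T q w \<longrightarrow> t0 \<le> t1 \<longrightarrow>
     (\<forall>\<tau>\<in>{t1 - r..T}. w \<tau> \<le> max M q) \<longrightarrow> t1 + 0 - r \<le> t \<longrightarrow> t \<le> T \<longrightarrow> w t \<le> max (max (a M) \<epsilon>) q"
      using False unfolding m0_def by force
    then show ?thesis by blast
  next
    case True
    have m0: "m0 > 0" using assms by (simp add: m0_def)
    have "continuous_on {m0..M} \<rho>" using \<rho>_cont m0 by (auto elim: continuous_on_subset)
    from continuous_attains_inf[OF _ _ this] True obtain y0 where y0: "y0 \<in> {m0..M}"
      "\<And>y. y \<in> {m0..M} \<Longrightarrow> \<rho> y0 \<le> \<rho> y" by auto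
    define c where "c = \<rho> y0"
    have "c > 0" using y0 m0 \<rho>_pos by (auto simp: c_def positive_definite_def)
    \<comment> \<open>The descent is complete at \<open>t1 + \<Theta> - r\<close>. Counting
      \<open>r\<close> in \<open>\<Theta>\<close> means that at \<open>t1 + \<Theta>\<close> the new
      bound covers a whole past window, which is the form in which the next step needs it.\<close>
    define \<Theta> where "\<Theta> = r + (M - m0) / c"
    have time_nonneg: "0 \<le> (M - m0) / c" using True \<open>c > 0\<close> by simp
    have "\<Theta> \<ge> 0" using r True \<open>c > 0\<close> by (simp add: \<Theta>_def)
    have "w t \<le> max m0 q" if w: "razumikhin r a \<rho> t0 T q w" and t1: "t0 \<le> t1"
      and bd: "\<forall>\<tau>\<in>{t1 - r..T}. w \<tau> \<le> max M q" and t: "t1 + \<Theta> - r \<le> t" "t \<le> T" for t0 T q w t1 t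
    proof (cases "M \<le> q")
      case True
      have "t1 \<le> t" using t(1) time_nonneg unfolding \<Theta>_def by linarith
      then have "w t \<le> max M q" using bd t r by auto
      then show ?thesis using True by auto
    next
      case False
      define m where "m = max m0 q"
      have t1t: "t1 \<le> t" using t(1) time_nonneg unfolding \<Theta>_def by linarith
      have wM: "w \<tau> \<le> M" if "t1 - r \<le> \<tau>" "\<tau> \<le> T" for \<tau> using bd that False by fastforce
      have "AE \<tau> in lebesgue. t1 < \<tau> \<and> \<tau> < T \<and> m \<le> w \<tau> \<longrightarrow> dini_le w \<tau> (- c)"
        using wM y0(2) by (intro razumikhin_AE_bounded[OF w t1, where M = M]) (auto simp: m_def m0_def c_def)
      then have ae: "AE \<tau> in lebesgue. t1 < \<tau> \<and> \<tau> < t \<and> m \<le> w \<tau> \<longrightarrow> dini_le w \<tau> (- c)"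
        by eventually_elim (use t in auto)
      have "abs_continuous_on_interval t1 t w"
        using w t1 t by (auto simp: razumikhin_def intro: abs_continuous_on_interval_subset)
      from abs_continuous_level_decay[OF t1t less_imp_le[OF \<open>c > 0\<close>] this ae]
      have "w t \<le> max m (w t1 - c * (t - t1))" .
      moreover have "w t1 - c * (t - t1) \<le> m0"
      proof -
        have "c * ((M - m0) / c) \<le> c * (t - t1)"
          using t \<open>c > 0\<close> by (intro mult_left_mono) (auto simp: \<Theta>_def)
        then show ?thesis using wM[of t1] t1t t r \<open>c > 0\<close> by simp
      qed
      ultimately show ?thesis by (auto simp: m_def)
    qed
    with \<open>\<Theta> \<ge> 0\<close> show ?thesis unfolding m0_def by blast
  qed
qed

text \<open>The levels follow the iteration of \<open>M \<mapsto> max (a M) \<epsilon>\<close>. The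
  gap \<open>y - a y\<close> has a positive minimum on \<open>[\<epsilon>,s]\<close>, so the number
  of steps, and with it the total waiting time, depends on \<open>\<epsilon>\<close> and
  \<open>s\<close> alone.\<close>

lemma razumikhin_decay:
  assumes "0 < \<epsilon>" "0 < s"
  shows "\<exists>\<Theta>\<ge>0. \<forall>t0 T q w t. razumikhin r a \<rho> t0 T q w \<longrightarrow> (\<forall>\<tau>\<in>{t0 - r..t0}. w \<tau> \<le> s) \<longrightarrow>
     t0 + \<Theta> - r \<le> t \<longrightarrow> t \<le> T \<longrightarrow> w t \<le> max \<epsilon> q"
proof -
  define C where "C M \<longleftrightarrow> (\<exists>\<Theta>\<ge>0. \<forall>t0 T q w t. razumikhin r a \<rho> t0 T q w \<longrightarrow> (\<forall>\<tau>\<in>{t0 - r..t0}. w \<tau> \<le> s) \<longrightarrow>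
     t0 + \<Theta> - r \<le> t \<longrightarrow> t \<le> T \<longrightarrow> w t \<le> max M q)" for M
  have "C s"
    unfolding C_def
  proof (intro exI[of _ 0] conjI allI impI)
    fix t0 T q w t assume w: "razumikhin r a \<rho> t0 T q w" and "\<forall>\<tau>\<in>{t0 - r..t0}. w \<tau> \<le> s"
      and "t0 + 0 - r \<le> t" "t \<le> T"
    then show "w t \<le> max s q" by (intro razumikhin_bounded[OF w]) auto
  qed simp
  have C_mono: "C M'" if "C M" "M \<le> M'" for M M'
  proof -
    from \<open>C M\<close> obtain \<Theta> where "\<Theta> \<ge> 0" and \<Theta>: "\<And>t0 T q w t. razumikhin r a \<rho> t0 T q w \<Longrightarrow> \<forall>\<tau>\<in>{t0 - r..t0}. w \<tau> \<le> s \<Longrightarrow>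
     t0 + \<Theta> - r \<le> t \<Longrightarrow> t \<le> T \<Longrightarrow> w t \<le> max M q" unfolding C_def by meson
    show ?thesis unfolding C_def
    proof (intro exI[of _ \<Theta>] conjI allI impI)
      fix t0 T q w t assume "razumikhin r a \<rho> t0 T q w" "\<forall>\<tau>\<in>{t0 - r..t0}. w \<tau> \<le> s"
        "t0 + \<Theta> - r \<le> t" "t \<le> T"
      from \<Theta>[OF this] \<open>M \<le> M'\<close> show "w t \<le> max M' q" by auto
    qed fact
  qed
  have C_step: "C (max (a M) \<epsilon>)" if "C M" for M
  proof -
    from \<open>C M\<close> obtain \<Theta> where "\<Theta> \<ge> 0" and \<Theta>: "\<And>t0 T q w t. razumikhin r a \<rho> t0 T q w \<Longrightarrow> \<forall>\<tau>\<in>{t0 - r..t0}. w \<tau> \<le> s \<Longrightarrow>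
     t0 + \<Theta> - r \<le> t \<Longrightarrow> t \<le> T \<Longrightarrow> w t \<le> max M q" unfolding C_def by meson
    from razumikhin_decay_step[OF \<open>0 < \<epsilon>\<close>, of M] obtain \<Theta>' where "\<Theta>' \<ge> 0" and
      \<Theta>': "\<And>t0 T q w t1 t. razumikhin r a \<rho> t0 T q w \<Longrightarrow> t0 \<le> t1 \<Longrightarrow>
     \<forall>\<tau>\<in>{t1 - r..T}. w \<tau> \<le> max M q \<Longrightarrow> t1 + \<Theta>' - r \<le> t \<Longrightarrow> t \<le> T \<Longrightarrow> w t \<le> max (max (a M) \<epsilon>) q" by meson
    show ?thesis unfolding C_def
    proof (intro exI[of _ "\<Theta> + \<Theta>'"] conjI allI impI)
      fix t0 T q w t assume w: "razumikhin r a \<rho> t0 T q w" "\<forall>\<tau>\<in>{t0 - r..t0}. w \<tau> \<le> s"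
        "t0 + (\<Theta> + \<Theta>') - r \<le> t" "t \<le> T"
      show "w t \<le> max (max (a M) \<epsilon>) q"
      proof (rule \<Theta>'[OF w(1), of "t0 + \<Theta>"])
        show "\<forall>\<tau>\<in>{t0 + \<Theta> - r..T}. w \<tau> \<le> max M q" using \<Theta>[OF w(1,2)] by auto
      qed (use w \<open>\<Theta> \<ge> 0\<close> in auto)
    qed (use \<open>\<Theta> \<ge> 0\<close> \<open>\<Theta>' \<ge> 0\<close> in auto)
  qed
  have "C \<epsilon>"
  proof (cases "\<epsilon> \<le> s")
    case False
    then show ?thesis using C_mono[OF \<open>C s\<close>] by simp
  next
    case True
    have "continuous_on {\<epsilon>..s} (\<lambda>y. y - a y)"
      using assms by (intro continuous_intros continuous_on_subset[OF class_KD(7)[OF a]]) auto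
    from continuous_attains_inf[OF _ _ this] True obtain y0 where y0: "y0 \<in> {\<epsilon>..s}"
      "\<And>y. y \<in> {\<epsilon>..s} \<Longrightarrow> y0 - a y0 \<le> y - a y" by auto
    \<comment> \<open>The least amount by which one step lowers a level in
      \<open>[\<epsilon>,s]\<close>; after \<open>k\<close> steps the bound is
      \<open>max \<epsilon> (s - real k * \<eta>)\<close>.\<close>
    define \<eta> where "\<eta> = y0 - a y0"
    have "\<eta> > 0" using a_less[of y0] y0 assms by (auto simp: \<eta>_def)
    have "C (max \<epsilon> (s - real k * \<eta>))" for k
    proof (induction k)
      case 0
      show ?case using C_mono[OF \<open>C s\<close>] by simp
    next
      case (Suc k)
      define M where "M = max \<epsilon> (s - real k * \<eta>)"
      have "M \<in> {\<epsilon>..s}" using True \<open>\<eta> > 0\<close> by (auto simp: M_def)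
      then have "a M \<le> M - \<eta>" using y0(2)[of M] by (simp add: \<eta>_def)
      then have "max (a M) \<epsilon> \<le> max \<epsilon> (s - real (Suc k) * \<eta>)"
        using \<open>\<eta> > 0\<close> by (auto simp: M_def algebra_simps)
      with C_step[OF Suc.IH] C_mono show ?case unfolding M_def by blast
    qed
    moreover obtain k :: nat where "s < real k * \<eta>"
      using \<open>\<eta> > 0\<close> reals_Archimedean3 by blast
    ultimately show ?thesis using assms by (metis max.absorb1 diff_less_0_iff_less less_imp_le less_trans)
  qed
  then show ?thesis unfolding C_def .
qed

text \<open>Uniform boundedness and uniform decay are the two inputs of the \<open>KL\<close>
  construction, applied to all trajectories at once, so a single \<open>\<sigma>\<close> serves
  every input level and initial time. The estimate at \<open>t\<close> is stated for the whole
  window \<open>[t - r, t]\<close> because the output reads the history.\<close>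

lemma razumikhin_KL_bound:
  shows "\<exists>\<sigma>\<in>class_KL. \<forall>t0 T q w s t \<tau>. razumikhin r a \<rho> t0 T q w \<longrightarrow> (\<forall>\<tau>\<in>{t0 - r..t0}. w \<tau> \<le> s) \<longrightarrow>
     t0 \<le> t \<longrightarrow> t - r \<le> \<tau> \<longrightarrow> \<tau> \<le> t \<longrightarrow> \<tau> \<le> T \<longrightarrow> w \<tau> \<le> max (\<sigma> s (t - t0)) q"
proof -
  \<comment> \<open>Only values above \<open>q\<close> are recorded: for them the bounds
    \<open>max s q\<close> and \<open>max \<epsilon> q\<close> become \<open>s\<close> and
    \<open>\<epsilon>\<close>, as \<open>class_KL_bound_exists\<close> demands. Values up to
    \<open>q\<close> satisfy the claim trivially.\<close>
  define P where "P s d y \<longleftrightarrow> (\<exists>t0 T q w \<tau>. razumikhin r a \<rho> t0 T q w \<and> (\<forall>\<tau>\<in>{t0 - r..t0}. w \<tau> \<le> s) \<and>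
     0 \<le> d \<and> t0 + d - r \<le> \<tau> \<and> \<tau> \<le> t0 + d \<and> \<tau> \<le> T \<and> y = w \<tau> \<and> y > q)" for s d y
  have "\<exists>\<sigma>\<in>class_KL. \<forall>s t y. P s t y \<longrightarrow> y \<le> \<sigma> s t"
  proof (rule class_KL_bound_exists)
    fix s d y assume "P s d y"
    then obtain t0 T q w \<tau> where w: "razumikhin r a \<rho> t0 T q w" "\<forall>\<tau>\<in>{t0 - r..t0}. w \<tau> \<le> s"
     "0 \<le> d" "t0 + d - r \<le> \<tau>" "\<tau> \<le> t0 + d" "\<tau> \<le> T" "y = w \<tau>" "y > q" unfolding P_def by blast
    have "w \<tau> \<le> max s q" using w by (intro razumikhin_bounded[OF w(1)]) auto
    moreover have "0 \<le> w t0" using w(1) r by (auto simp: razumikhin_def)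
    then have "0 \<le> s" using w(2) r by (intro order_trans[OF _ bspec[OF w(2), of t0]]) auto
    ultimately show "s \<ge> 0 \<and> d \<ge> 0 \<and> y \<le> s" using w by auto
  next
    fix s \<epsilon> :: real assume "s > 0" "\<epsilon> > 0"
    from razumikhin_decay[OF \<open>\<epsilon> > 0\<close> \<open>s > 0\<close>] obtain \<Theta> where
      \<Theta>: "\<And>t0 T q w t. razumikhin r a \<rho> t0 T q w \<Longrightarrow> \<forall>\<tau>\<in>{t0 - r..t0}. w \<tau> \<le> s \<Longrightarrow>
        t0 + \<Theta> - r \<le> t \<Longrightarrow> t \<le> T \<Longrightarrow> w t \<le> max \<epsilon> q" by meson
    show "\<exists>T. \<forall>s' t y. s' \<le> s \<longrightarrow> t \<ge> T \<longrightarrow> P s' t y \<longrightarrow> y \<le> \<epsilon>"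
    proof (intro exI[of _ \<Theta>] allI impI)
      fix s' d y assume "s' \<le> s" "d \<ge> \<Theta>" "P s' d y"
      then obtain t0 T q w \<tau> where w: "razumikhin r a \<rho> t0 T q w" "\<forall>\<tau>\<in>{t0 - r..t0}. w \<tau> \<le> s'"
        "0 \<le> d" "t0 + d - r \<le> \<tau>" "\<tau> \<le> t0 + d" "\<tau> \<le> T" "y = w \<tau>" "y > q" unfolding P_def by blast
      have "w \<tau> \<le> max \<epsilon> q" using w \<open>s' \<le> s\<close> \<open>d \<ge> \<Theta>\<close> by (intro \<Theta>[OF w(1)]) force+
      with w show "y \<le> \<epsilon>" by auto
    qed
  qed
  then obtain \<sigma> where "\<sigma> \<in> class_KL" and \<sigma>: "\<And>s t y. P s t y \<Longrightarrow> y \<le> \<sigma> s t" by blast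
  have "w \<tau> \<le> max (\<sigma> s (t - t0)) q"
    if "razumikhin r a \<rho> t0 T q w" "\<forall>\<tau>\<in>{t0 - r..t0}. w \<tau> \<le> s"
     "t0 \<le> t" "t - r \<le> \<tau>" "\<tau> \<le> t" "\<tau> \<le> T" for t0 T q w s t \<tau>
  proof (cases "w \<tau> > q")
    case True
    then have "P s (t - t0) (w \<tau>)"
      unfolding P_def using that by (intro exI[of _ t0] exI[of _ T] exI[of _ q] exI[of _ w] exI[of _ \<tau>]) auto
    from \<sigma>[OF this] show ?thesis by simp
  qed simp
  with \<open>\<sigma> \<in> class_KL\<close> show ?thesis by blast
qed

end

section \<open>Almost everywhere differentiability of integrals\<close>

text \<open>The points where the difference quotients stay \<open>\<epsilon>\<close> away from the integrand are Vitali
  covered by intervals that are fine for the gauge of Henstock's lemma, so their total length is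
  small.\<close>

lemma negligible_integral_deviation:
  fixes g :: "real \<Rightarrow> 'x::euclidean_space"
  assumes g: "g integrable_on {a..b}" and "\<epsilon> > 0"
  shows "negligible {x \<in> {a..b}. \<forall>d>0. \<exists>u v. a \<le> u \<and> u < v \<and> v \<le> b \<and> v - u < d \<and> (x = u \<or> x = v) \<and>
    \<epsilon> * (v - u) < norm ((v - u) *\<^sub>R g x - integral {u..v} g)}" (is "negligible ?S")
  unfolding negligible_outer_le
proof (intro allI impI)
  fix e :: real assume "e > 0"
  then have "\<epsilon> * e > 0" using \<open>\<epsilon> > 0\<close> by simp
  \<comment> \<open>The tolerance is \<open>\<epsilon> * e\<close> because each bad interval
    contributes more than \<open>\<epsilon>\<close> times its length to the Henstock sum, which
    leaves a total length of at most \<open>e\<close>.\<close>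
  then obtain \<gamma> where "gauge \<gamma>" and \<gamma>: "\<And>p. p tagged_partial_division_of {a..b} \<Longrightarrow> \<gamma> fine p \<Longrightarrow>
      (\<Sum>(x, k)\<in>p. norm (measure lborel k *\<^sub>R g x - integral k g)) < \<epsilon> * e"
    using Henstock_lemma[of g a b "\<epsilon> * e"] g by auto
  define K where "K = {(x, u, v). x \<in> {a..b} \<and> a \<le> u \<and> u < v \<and> v \<le> b \<and> (x = u \<or> x = v) \<and> {u..v} \<subseteq> \<gamma> x \<and>
    \<epsilon> * (v - u) < norm ((v - u) *\<^sub>R g x - integral {u..v} g)}"
  \<comment> \<open>Midpoint and half-length present the intervals as closed balls, the shape in
    which the Vitali covering theorem takes its family. The tag remains part of the index.\<close>
  define c where "c = (\<lambda>(x::real, u, v). (u + v) / 2 :: real)"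
  define l where "l = (\<lambda>(x::real, u, v). (v - u) / 2 :: real)"
  have cball: "cball (c (x, u, v)) (l (x, u, v)) = {u..v}" for x u v
    by (simp add: c_def l_def cball_eq_atLeastAtMost field_simps)
  obtain C where C: "countable C" "C \<subseteq> K"
     "pairwise (\<lambda>i j. disjnt (cball (c i) (l i)) (cball (c j) (l j))) C"
     "negligible (?S - (\<Union>i\<in>C. cball (c i) (l i)))"
  proof (rule Vitali_covering_theorem_cballs[of K l ?S c])
    show "0 < l i" if "i \<in> K" for i using that by (auto simp: K_def l_def)
    fix x d :: real assume x: "x \<in> ?S" and "0 < d"
    have "open (\<gamma> x)" "x \<in> \<gamma> x" using \<open>gauge \<gamma>\<close> by (auto simp: gauge_def)
    then obtain d0 where d0: "d0 > 0" "ball x d0 \<subseteq> \<gamma> x" using openE by blast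
    obtain u v where uv: "a \<le> u" "u < v" "v \<le> b" "v - u < min d d0" "x = u \<or> x = v"
      "\<epsilon> * (v - u) < norm ((v - u) *\<^sub>R g x - integral {u..v} g)"
    proof -
      have "0 < min d d0" using d0 \<open>0 < d\<close> by simp
      with x that show thesis unfolding mem_Collect_eq by blast
    qed
    have "{u..v} \<subseteq> ball x d0" using uv by (auto simp: dist_real_def)
    then have "(x, u, v) \<in> K" using uv d0 x by (auto simp: K_def)
    moreover have "x \<in> cball (c (x, u, v)) (l (x, u, v))" using uv unfolding cball by auto
    moreover have "l (x, u, v) < d" using uv by (auto simp: l_def)
    ultimately show "\<exists>i. i \<in> K \<and> x \<in> cball (c i) (l i) \<and> l i < d" by blast
  qed
  \<comment> \<open>Henstock's lemma speaks of finite divisions, so the length bound is proved for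
    finite subfamilies, which disjointness makes into tagged partial divisions; countable additivity
    then carries it over to \<open>C\<close>.\<close>
  have bound: "measure lebesgue (\<Union>i\<in>C'. cball (c i) (l i)) \<le> e" if C': "C' \<subseteq> C" "finite C'" for C'
  proof -
    define h where "h = (\<lambda>(x::real, u, v::real). (x, {u..v}))"
    have in_K: "i \<in> K" if "i \<in> C'" for i using that C' C by auto
    have uv: "u \<le> v" "\<epsilon> * (v - u) \<le> norm ((v - u) *\<^sub>R g x - integral {u..v} g)"
      if "(x, u, v) \<in> C'" for x u v
      using in_K[OF that] by (auto simp: K_def)
    have disj: "{u..v} \<inter> {u'..v'} = {}"
      if "(x, u, v) \<in> C'" "(x', u', v') \<in> C'" "(x, u, v) \<noteq> (x', u', v')" for x u v x' u' v'
    proof -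
      have "disjnt (cball (c (x, u, v)) (l (x, u, v))) (cball (c (x', u', v')) (l (x', u', v')))"
        using C(3) C' that by (meson pairwiseD subsetD)
      then show ?thesis unfolding cball disjnt_def .
    qed
    have inj: "inj_on h C'"
      using in_K by (fastforce simp: inj_on_def h_def K_def)
    have "h ` C' tagged_partial_division_of {a..b}"
      unfolding tagged_partial_division_of_def
    proof (intro conjI allI impI)
      fix x k assume "(x, k) \<in> h ` C'"
      then obtain u v where "(x, u, v) \<in> C'" and k: "k = {u..v}" unfolding h_def by fast
      from this(1) have "(x, u, v) \<in> K" by (rule in_K)
      with k show "x \<in> k" "k \<subseteq> {a..b}" "\<exists>a b. k = cbox a b" by (auto simp: K_def)
    next
      fix x1 k1 x2 k2 assume "(x1, k1) \<in> h ` C' \<and> (x2, k2) \<in> h ` C' \<and> (x1, k1) \<noteq> (x2, k2)"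
      then obtain u1 v1 u2 v2 where "(x1, u1, v1) \<in> C'" "(x2, u2, v2) \<in> C'" "k1 = {u1..v1}" "k2 = {u2..v2}"
        "(x1, u1, v1) \<noteq> (x2, u2, v2)" by (auto simp: h_def)
      with disj have "k1 \<inter> k2 = {}" by metis
      then show "interior k1 \<inter> interior k2 = {}" using interior_subset by blast
    qed (use C' in simp)
    moreover have "\<gamma> fine h ` C'"
      using in_K by (fastforce simp: fine_def h_def K_def)
    ultimately have "(\<Sum>(x, k)\<in>h ` C'. norm (measure lborel k *\<^sub>R g x - integral k g)) < \<epsilon> * e" by (rule \<gamma>)
    also have "(\<Sum>(x, k)\<in>h ` C'. norm (measure lborel k *\<^sub>R g x - integral k g)) =
        (\<Sum>(x, u, v)\<in>C'. norm ((v - u) *\<^sub>R g x - integral {u..v} g))"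
      unfolding sum.reindex[OF inj] by (intro sum.cong) (auto simp: h_def dest: uv(1))
    finally have "(\<Sum>(x, u, v)\<in>C'. norm ((v - u) *\<^sub>R g x - integral {u..v} g)) < \<epsilon> * e" .
    moreover have "(\<Sum>(x, u, v)\<in>C'. \<epsilon> * (v - u)) \<le> (\<Sum>(x, u, v)\<in>C'. norm ((v - u) *\<^sub>R g x - integral {u..v} g))"
      by (intro sum_mono) (auto intro: uv(2))
    moreover have "(\<Sum>(x, u, v)\<in>C'. \<epsilon> * (v - u)) = \<epsilon> * (\<Sum>(x, u, v)\<in>C'. v - u)"
      by (simp add: sum_distrib_left case_prod_beta')
    ultimately have "\<epsilon> * (\<Sum>(x, u, v)\<in>C'. v - u) \<le> \<epsilon> * e" by linarith
    then have *: "(\<Sum>(x, u, v)\<in>C'. v - u) \<le> e" using \<open>\<epsilon> > 0\<close> by simp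
    have "measure lebesgue (\<Union>i\<in>C'. cball (c i) (l i)) \<le> (\<Sum>i\<in>C'. measure lebesgue (cball (c i) (l i)))"
      using \<open>finite C'\<close> by (intro measure_UNION_le) auto
    also have "\<dots> = (\<Sum>(x, u, v)\<in>C'. v - u)"
      by (intro sum.cong refl) (auto simp: cball dest: uv(1))
    finally show ?thesis using * by simp
  qed
  note UN = fmeasurable_UN_bound[OF C(1) _ bound] measure_UN_bound[OF C(1) _ bound]
  show "\<exists>T. ?S \<subseteq> T \<and> T \<in> lmeasurable \<and> measure lebesgue T \<le> e"
  proof (intro exI conjI)
    let ?U = "\<Union>i\<in>C. cball (c i) (l i)" and ?N = "?S - (\<Union>i\<in>C. cball (c i) (l i))"
    have N: "?N \<in> lmeasurable" "measure lebesgue ?N = 0"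
      using C(4) by (auto simp: negligible_imp_measurable negligible_imp_measure0)
    show "?S \<subseteq> ?U \<union> ?N" by blast
    show "?U \<union> ?N \<in> lmeasurable" using UN(1) N by (intro fmeasurable.Un) auto
    have "measure lebesgue (?U \<union> ?N) \<le> measure lebesgue ?U + measure lebesgue ?N"
      using UN(1) N by (intro measure_Un_le) auto
    also have "\<dots> \<le> e" using UN(2) N by simp
    finally show "measure lebesgue (?U \<union> ?N) \<le> e" .
  qed
qed

text \<open>Off the countable union of the bad sets with thresholds \<open>1 / real (Suc n)\<close>,
  all intervals having \<open>t\<close> as an endpoint have small deviation. The left and right
  endpoint cases give the two one-sided difference quotients.\<close>

lemma AE_has_vector_derivative_integral:
  fixes g :: "real \<Rightarrow> 'x::euclidean_space"
  assumes g: "g integrable_on {a..b}"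
  shows "AE t in lebesgue. a < t \<and> t < b \<longrightarrow> ((\<lambda>t. integral {a..t} g) has_vector_derivative g t) (at t)"
proof -
  define S where "S \<epsilon> = {x \<in> {a..b}. \<forall>d>0. \<exists>u v. a \<le> u \<and> u < v \<and> v \<le> b \<and> v - u < d \<and> (x = u \<or> x = v) \<and>
    \<epsilon> * (v - u) < norm ((v - u) *\<^sub>R g x - integral {u..v} g)}" for \<epsilon> :: real
  define N where "N = (\<Union>n. S (1 / real (Suc n)))"
  have "negligible (S \<epsilon>)" if "\<epsilon> > 0" for \<epsilon>
    unfolding S_def by (rule negligible_integral_deviation[OF g that])
  then have "negligible N"
    unfolding N_def by (intro negligible_countable_Union) auto
  have "((\<lambda>t. integral {a..t} g) has_vector_derivative g t) (at t)" if t: "t \<notin> N" "a < t" "t < b" for t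
    unfolding has_vector_derivative_def has_derivative_at_alt
  proof (intro conjI allI impI)
    fix e :: real assume "e > 0"
    then obtain n where n: "1 / real (Suc n) < e" using nat_approx_posE by blast
    have "t \<notin> S (1 / real (Suc n))" using t by (auto simp: N_def)
    then obtain d where "d > 0" and d0: "\<And>u v. \<not> (a \<le> u \<and> u < v \<and> v \<le> b \<and> v - u < d \<and> (t = u \<or> t = v) \<and>
       1 / real (Suc n) * (v - u) < norm ((v - u) *\<^sub>R g t - integral {u..v} g))"
      using t unfolding S_def mem_Collect_eq by (meson atLeastAtMost_iff less_imp_le)
    have d: "norm ((v - u) *\<^sub>R g t - integral {u..v} g) \<le> 1 / real (Suc n) * (v - u)"
      if "a \<le> u" "u < v" "v \<le> b" "v - u < d" "t = u \<or> t = v" for u v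
      by (rule ccontr) (use d0[of u v] that in \<open>simp add: not_le\<close>)
    have d': "norm ((v - u) *\<^sub>R g t - integral {u..v} g) \<le> e * (v - u)"
      if "a \<le> u" "u < v" "v \<le> b" "v - u < d" "t = u \<or> t = v" for u v
    proof -
      have "1 / real (Suc n) * (v - u) \<le> e * (v - u)" using that n by (intro mult_right_mono) auto
      with d[OF that] show ?thesis by linarith
    qed
    have int: "integral {a..u} g + integral {u..v} g = integral {a..v} g" if "a \<le> u" "u \<le> v" "v \<le> b" for u v
      using that g by (intro Henstock_Kurzweil_Integration.integral_combine) (auto elim: integrable_on_subinterval)
    have "norm (integral {a..y} g - integral {a..t} g - (y - t) *\<^sub>R g t) \<le> e * norm (y - t)"
      if y: "norm (y - t) < min d (min (t - a) (b - t))" for y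
    proof -
      consider "y = t" | "t < y" | "y < t" by linarith
      then show ?thesis
      proof cases
        case 2
        have "integral {a..y} g - integral {a..t} g - (y - t) *\<^sub>R g t = - ((y - t) *\<^sub>R g t - integral {t..y} g)"
          using int[of t y] y t 2 by (simp add: algebra_simps)
        then show ?thesis using d'[of t y] y t 2 by (simp only: norm_minus_cancel) simp
      next
        case 3
        have "integral {a..y} g - integral {a..t} g - (y - t) *\<^sub>R g t = (t - y) *\<^sub>R g t - integral {y..t} g"
          using int[of y t] y t 3 by (simp add: algebra_simps)
        then show ?thesis using d'[of y t] y t 3 by simp
      qed simp
    qed
    moreover have "min d (min (t - a) (b - t)) > 0" using \<open>d > 0\<close> t by simp
    ultimately show "\<exists>d>0. \<forall>y. norm (y - t) < d \<longrightarrow>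
      norm (integral {a..y} g - integral {a..t} g - (y - t) *\<^sub>R g t) \<le> e * norm (y - t)" by blast
  qed (rule bounded_linear_scaleR_left)
  moreover have "AE t in lebesgue. t \<notin> N"
    using \<open>negligible N\<close> by (auto simp: negligible_iff_null_sets intro: AE_not_in)
  ultimately show ?thesis by (auto elim: eventually_mono)
qed

section \<open>The history operator\<close>

lemma norm_history_diff_le:
  fixes x y :: "real \<Rightarrow> 'x::euclidean_space"
  assumes "r > 0" and x: "continuous_on {s - r..s} x" and y: "continuous_on {t - r..t} y"
    and le: "\<And>\<theta>. \<theta> \<in> {-r..0} \<Longrightarrow> norm (x (s + \<theta>) - y (t + \<theta>)) \<le> c"
  shows "norm (history r s x - history r t y) \<le> c"
proof (rule norm_bound)
  fix \<theta>
  have "clamp (-r) 0 \<theta> \<in> {-r..0}" using clamp_in_interval[of "-r" 0 \<theta>] \<open>r > 0\<close> by simp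
  then show "norm (apply_bcontfun (history r s x - history r t y) \<theta>) \<le> c"
    unfolding minus_bcontfun.rep_eq apply_history[OF x] apply_history[OF y] ext_cont_def by (rule le)
qed

lemma norm_history_le:
  fixes x :: "real \<Rightarrow> 'x::euclidean_space"
  assumes "r > 0" and x: "continuous_on {t - r..t} x"
    and le: "\<And>s. s \<in> {t - r..t} \<Longrightarrow> norm (x s) \<le> c"
  shows "norm (history r t x) \<le> c"
proof (rule norm_bound)
  fix \<theta>
  have "clamp (-r) 0 \<theta> \<in> {-r..0}" using clamp_in_interval[of "-r" 0 \<theta>] \<open>r > 0\<close> by simp
  then show "norm (apply_bcontfun (history r t x) \<theta>) \<le> c"
    unfolding apply_history[OF x] ext_cont_def by (intro le) auto
qed

lemma norm_le_norm_history:
  fixes x :: "real \<Rightarrow> 'x::euclidean_space"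
  assumes "r > 0" "continuous_on {t - r..t} x" "s \<in> {t - r..t}"
  shows "norm (x s) \<le> norm (history r t x)"
  using norm_bounded[of "history r t x" "s - t"] history_in_state_space(2)[OF assms(1,2), of "s - t"] assms
  by simp

lemma history_cong:
  fixes x y :: "real \<Rightarrow> 'x::euclidean_space"
  assumes "r > 0" and eq: "\<And>s. s \<in> {t - r..t} \<Longrightarrow> x s = y s"
  shows "history r t x = history r t y"
proof -
  have "x (t + clamp (-r) 0 \<theta>) = y (t + clamp (-r) 0 \<theta>)" for \<theta>
    using clamp_in_interval[of "-r" 0 \<theta>] \<open>r > 0\<close> by (intro eq) auto
  then show ?thesis by (simp add: history_def ext_cont_def)
qed

text \<open>Uniform continuity of \<open>x\<close> on the compact interval makes its translates
  close in the maximum norm.\<close>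

lemma continuous_on_history:
  fixes x :: "real \<Rightarrow> 'x::euclidean_space"
  assumes "r > 0" and x: "continuous_on {a - r..b} x"
  shows "continuous_on {a..b} (\<lambda>t. history r t x)"
  unfolding continuous_on_iff
proof (intro ballI allI impI)
  fix t and e :: real assume t: "t \<in> {a..b}" and "e > 0"
  have "uniformly_continuous_on {a - r..b} x"
    using x by (intro compact_uniformly_continuous) auto
  then obtain d where "d > 0" and d: "\<And>s s'. s \<in> {a - r..b} \<Longrightarrow> s' \<in> {a - r..b} \<Longrightarrow> dist s' s < d \<Longrightarrow>
     dist (x s') (x s) < e / 2"
    using \<open>e > 0\<close> unfolding uniformly_continuous_on_def by (meson half_gt_zero)
  have "dist (history r t' x) (history r t x) < e" if t': "t' \<in> {a..b}" "dist t' t < d" for t'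
  proof -
    have "norm (history r t' x - history r t x) \<le> e / 2"
    proof (rule norm_history_diff_le[OF \<open>r > 0\<close>])
      fix \<theta> assume "\<theta> \<in> {-r..0}"
      then show "norm (x (t' + \<theta>) - x (t + \<theta>)) \<le> e / 2"
        using d[of "t + \<theta>" "t' + \<theta>"] t t' by (auto simp: dist_norm)
    qed (use t t' x in \<open>auto elim: continuous_on_subset\<close>)
    then show ?thesis using \<open>e > 0\<close> by (simp add: dist_norm)
  qed
  with \<open>d > 0\<close> show "\<exists>d>0. \<forall>t'\<in>{a..b}. dist t' t < d \<longrightarrow> dist (history r t' x) (history r t x) < e" by blast
qed

section \<open>Local existence of solutions\<close>

lemma inputsD:
  assumes "d \<in> inputs E"
  shows "\<And>t. t \<ge> 0 \<Longrightarrow> d t \<in> E" "\<And>S. S \<subseteq> {0..} \<Longrightarrow> d \<in> borel_measurable (lebesgue_on S)"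
  using assms by (auto simp: inputs_def intro: measurable_restrict_mono)

context retarded_system
begin

lemma f_norm_bound:
  "\<exists>M\<ge>0. \<forall>t\<in>{0..T}. \<forall>z\<in>state_space r. \<forall>v\<in>U. \<forall>e\<in>D. norm z \<le> B \<longrightarrow> norm v \<le> s \<longrightarrow> norm (f t z v e) \<le> M"
proof -
  define \<Omega> :: "(real \<times> (real \<Rightarrow>\<^sub>C 'x) \<times> 'u) set" where "\<Omega> = {0..T} \<times> (state_space r \<inter> cball 0 B) \<times> (U \<inter> cball 0 s)"
  have "bounded \<Omega>"
    unfolding \<Omega>_def by (intro bounded_Times bounded_Int) auto
  moreover have "\<Omega> \<subseteq> {0..} \<times> state_space r \<times> U" by (auto simp: \<Omega>_def)
  ultimately have "bounded ((\<lambda>((t, x, u), d). f t x u d) ` (\<Omega> \<times> D))" by (rule f_bounded)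
  then obtain M where M: "\<And>p. p \<in> (\<lambda>((t, x, u), d). f t x u d) ` (\<Omega> \<times> D) \<Longrightarrow> norm p \<le> M"
    unfolding bounded_iff by blast
  have "norm (f t z v e) \<le> max 0 M"
    if "t \<in> {0..T}" "z \<in> state_space r" "v \<in> U" "e \<in> D" "norm z \<le> B" "norm v \<le> s" for t z v e
  proof -
    have "((t, z, v), e) \<in> \<Omega> \<times> D" using that by (auto simp: \<Omega>_def)
    then have "f t z v e \<in> (\<lambda>((t, x, u), d). f t x u d) ` (\<Omega> \<times> D)" by (rule rev_image_eqI) simp
    from M[OF this] show ?thesis by simp
  qed
  then show ?thesis by (intro exI[of _ "max 0 M"]) auto
qed

text \<open>With the continuous curve of histories inserted, \<open>f\<close> is jointly continuous
  in time, input and disturbance off the countable set \<open>A\<close>, so composing with the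
  measurable \<open>t \<mapsto> (t, u t, d t)\<close> stays measurable; a bounded measurable
  function on a bounded set is integrable. Adding \<open>A\<close> back changes only a null set. The
  shift \<open>k\<close> is there for the delayed approximations.\<close>

lemma integrable_along_history:
  fixes y :: "real \<Rightarrow> 'x"
  assumes y: "continuous_on UNIV y" and "b \<ge> 0"
    and u: "u \<in> inputs (U \<inter> cball 0 s)" and d: "d \<in> inputs D"
    and M: "\<And>t. t \<in> {b..c} \<Longrightarrow> norm (f t (history r (t - k) y) (u t) (d t)) \<le> M"
  shows "(\<lambda>t. f t (history r (t - k) y) (u t) (d t)) integrable_on {b..c}"
proof -
  obtain A where A: "countable A"
    and fc: "continuous_on (({0..} - A) \<times> state_space r \<times> U \<times> D) (\<lambda>(t, x, u, d). f t x u d)"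
  proof -
    obtain A where "finite A \<or> (\<exists>\<tau> :: nat \<Rightarrow> real. A = range \<tau>)"
      "continuous_on (({0..} - A) \<times> state_space r \<times> U \<times> D) (\<lambda>(t, x, u, d). f t x u d)"
      using f_piecewise_cont by blast
    moreover from this(1) have "countable A" by (auto intro: countable_finite)
    ultimately show thesis using that by blast
  qed
  define I where "I = {b..c} - A"
  have "negligible A"
    unfolding negligible_iff_null_sets by (intro null_sets_completionI countable_imp_null_set_lborel A)
  then have "A \<in> sets lebesgue" by (rule negligible_imp_sets)
  then have I: "I \<in> sets lebesgue" "I \<subseteq> {0..}"
    using \<open>b \<ge> 0\<close> unfolding I_def by auto
  have "I \<in> lmeasurable"
    by (rule fmeasurableI2[OF lmeasurable_cbox[of b c] _ I(1)]) (auto simp: I_def)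
  let ?h = "\<lambda>t. f t (history r (t - k) y) (u t) (d t)"
  have "continuous_on (I \<times> U \<times> D) (\<lambda>z. history r (fst z - k) y)"
  proof -
    have "continuous_on {b - k..c - k} (\<lambda>t. history r t y)"
      by (rule continuous_on_history[OF r_pos]) (rule continuous_on_subset[OF y subset_UNIV])
    then show ?thesis
      by (rule continuous_on_compose2) (auto simp: I_def intro!: continuous_intros)
  qed
  then have "continuous_on (I \<times> U \<times> D) (\<lambda>z. (fst z, history r (fst z - k) y, fst (snd z), snd (snd z)))"
    by (intro continuous_intros)
  then have "continuous_on (I \<times> U \<times> D) (\<lambda>z. f (fst z) (history r (fst z - k) y) (fst (snd z)) (snd (snd z)))"
  proof -
    have "(\<lambda>z. (fst z, history r (fst z - k) y, fst (snd z), snd (snd z))) ` (I \<times> U \<times> D)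
      \<subseteq> ({0..} - A) \<times> state_space r \<times> U \<times> D"
      using I(2) history_in_state_space(1)[OF r_pos continuous_on_subset[OF y subset_UNIV]] by (auto simp: I_def)
    from continuous_on_compose2[OF fc \<open>continuous_on _ (\<lambda>z. (fst z, history r (fst z - k) y, fst (snd z), snd (snd z)))\<close> this]
    show ?thesis by (simp add: case_prod_beta')
  qed
  then have g: "(\<lambda>z. f (fst z) (history r (fst z - k) y) (fst (snd z)) (snd (snd z)))
      \<in> borel_measurable (restrict_space borel (I \<times> U \<times> D))"
    by (rule borel_measurable_continuous_on_restrict)
  \<comment> \<open>\<open>U\<close> and \<open>D\<close> are arbitrary sets, possibly not Borel,
    hence the trace of the Borel algebra on the product.\<close>
  have "(\<lambda>t. (t, u t, d t)) \<in> measurable (lebesgue_on I) (restrict_space borel (I \<times> U \<times> D))"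
  proof (rule measurable_restrict_space2)
    show "(\<lambda>t. (t, u t, d t)) \<in> space (lebesgue_on I) \<rightarrow> I \<times> U \<times> D"
      using I(2) inputsD(1)[OF u] inputsD(1)[OF d] by (auto simp: I_def)
    have "(\<lambda>t. t) \<in> borel_measurable (lebesgue_on I)"
      by (rule continuous_imp_measurable_on_sets_lebesgue[OF continuous_on_id I(1)])
    then show "(\<lambda>t. (t, u t, d t)) \<in> borel_measurable (lebesgue_on I)"
      using inputsD(2)[OF u I(2)] inputsD(2)[OF d I(2)] by (intro borel_measurable_Pair)
  qed
  from measurable_compose[OF this g] have "?h \<in> borel_measurable (lebesgue_on I)" by simp
  then have "?h integrable_on I"
  proof (rule measurable_bounded_by_integrable_imp_integrable)
    show "(\<lambda>_. M) integrable_on I" using \<open>I \<in> lmeasurable\<close> by (rule integrable_on_const)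
    show "norm (?h t) \<le> M" if "t \<in> I" for t using that by (intro M) (auto simp: I_def)
  qed (rule I)
  then show ?thesis
  proof (rule integrable_spike_set)
    show "negligible {x \<in> I - {b..c}. ?h x \<noteq> 0}"
      by (rule negligible_subset[OF negligible_empty]) (auto simp: I_def)
    show "negligible {x \<in> {b..c} - I. ?h x \<noteq> 0}"
      by (rule negligible_subset[OF \<open>negligible A\<close>]) (auto simp: I_def)
  qed
qed

text \<open>The space on which the delayed scheme acts. Its members live on the whole line,
  continuing \<open>\<xi>\<close> from \<open>b\<close> and frozen from \<open>c\<close>, so that
  every history, delayed or not, is well defined; the common Lipschitz constant supplies
  equicontinuity.\<close>

definition delay_class :: "real \<Rightarrow> real \<Rightarrow> real \<Rightarrow> (real \<Rightarrow> 'x) \<Rightarrow> (real \<Rightarrow> 'x) set" where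
  "delay_class b c M \<xi> = {y. continuous_on UNIV y \<and> (\<forall>t\<le>b. y t = \<xi> t) \<and> (\<forall>t\<ge>c. y t = y c) \<and>
     (\<forall>s t. b \<le> s \<longrightarrow> s \<le> t \<longrightarrow> norm (y t - y s) \<le> M * (t - s))}"

text \<open>A slope \<open>M\<close> over a length with \<open>M * (c - b) \<le> 1\<close> adds at
  most \<open>1\<close> to the norm. The bound on \<open>\<xi>\<close> reaches back to
  \<open>b - r - 1\<close> because the delay shifts the window by up to \<open>1\<close>.\<close>

lemma norm_history_delay_class:
  assumes y: "y \<in> delay_class b c M \<xi>" and B: "\<And>t. t \<in> {b - r - 1..b} \<Longrightarrow> norm (\<xi> t) \<le> B"
    and M: "M \<ge> 0" "M * (c - b) \<le> 1" and t: "t \<in> {b..c}" and k: "0 \<le> k" "k \<le> 1"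
  shows "norm (history r (t - k) y) \<le> B + 1"
proof (rule norm_history_le[OF r_pos])
  show "continuous_on {t - k - r..t - k} y"
    using y by (auto simp: delay_class_def elim: continuous_on_subset)
  fix s assume s: "s \<in> {t - k - r..t - k}"
  show "norm (y s) \<le> B + 1"
  proof (cases "s \<le> b")
    case True
    then have "y s = \<xi> s" using y by (simp add: delay_class_def)
    moreover have "norm (\<xi> s) \<le> B" using s t k True by (intro B) auto
    ultimately show ?thesis by simp
  next
    case False
    have "norm (y s - y b) \<le> M * (s - b)" using y False by (auto simp: delay_class_def)
    also have "\<dots> \<le> M * (c - b)" using s t k M by (intro mult_left_mono) auto
    finally have "norm (y s - y b) \<le> 1" using M by simp
    moreover have "norm (y b) \<le> B" using y B[of b] r_pos by (auto simp: delay_class_def)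
    ultimately show ?thesis using norm_triangle_sub[of "y s" "y b"] by linarith
  qed
qed

text \<open>Tonelli's scheme: delaying the history by \<open>k\<close> makes the integral equation explicit on
  successive intervals of length \<open>k\<close>.\<close>

lemma delayed_solution_exists:
  fixes \<xi> :: "real \<Rightarrow> 'x"
  assumes \<xi>: "continuous_on UNIV \<xi>" and b: "0 \<le> b" "b < c"
    and u: "u \<in> inputs (U \<inter> cball 0 s)" and d: "d \<in> inputs D"
    and B: "\<And>t. t \<in> {b - r - 1..b} \<Longrightarrow> norm (\<xi> t) \<le> B"
    and M: "M \<ge> 0" "M * (c - b) \<le> 1"
    and fM: "\<And>t z v e. t \<in> {0..c} \<Longrightarrow> z \<in> state_space r \<Longrightarrow> v \<in> U \<Longrightarrow> e \<in> D \<Longrightarrow> norm z \<le> B + 1 \<Longrightarrow>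
      norm v \<le> s \<Longrightarrow> norm (f t z v e) \<le> M"
    and k: "0 < k" "k \<le> 1"
  shows "\<exists>y\<in>delay_class b c M \<xi>. \<forall>t\<in>{b..c}.
    y t = \<xi> b + integral {b..t} (\<lambda>\<tau>. f \<tau> (history r (\<tau> - k) y) (u \<tau>) (d \<tau>))"
proof -
  define J where "J y = (\<lambda>\<tau>. f \<tau> (history r (\<tau> - k) y) (u \<tau>) (d \<tau>))" for y
  \<comment> \<open>The truncations \<open>min t b\<close> and \<open>min t c\<close> make the
    integral operator a self-map of \<open>delay_class\<close>: it returns \<open>\<xi>\<close> up
    to \<open>b\<close> and is constant from \<open>c\<close> on.\<close>
  define \<Phi> where "\<Phi> y t = \<xi> (min t b) + integral {b..min t c} (J y)" for y t
  have J_le: "norm (J y \<tau>) \<le> M" if "y \<in> delay_class b c M \<xi>" "\<tau> \<in> {b..c}" for y \<tau>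
    unfolding J_def
  proof (rule fM)
    have "continuous_on UNIV y" using that(1) by (simp add: delay_class_def)
    then show "history r (\<tau> - k) y \<in> state_space r"
      using history_in_state_space(1)[OF r_pos] continuous_on_subset by blast
    show "norm (history r (\<tau> - k) y) \<le> B + 1"
      using norm_history_delay_class[OF that(1) B M that(2)] k by auto
  qed (use that b inputsD(1)[OF u, of \<tau>] inputsD(1)[OF d, of \<tau>] in auto)
  have J_int: "J y integrable_on {b'..c'}" if "y \<in> delay_class b c M \<xi>" "{b'..c'} \<subseteq> {b..c}" for y b' c'
  proof -
    have "J y integrable_on {b..c}"
      using J_le[OF that(1)] that(1) b unfolding J_def
      by (intro integrable_along_history[OF _ _ u d]) (auto simp: delay_class_def)
    then show ?thesis using that(2) by (rule integrable_on_subinterval)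
  qed
  have \<Phi>_diff: "norm (\<Phi> y t - \<Phi> y s') \<le> M * (t - s')"
    if y: "y \<in> delay_class b c M \<xi>" and "b \<le> s'" "s' \<le> t" for y s' t
  proof (cases "s' \<le> c")
    case False
    then have "\<Phi> y t = \<Phi> y s'" using that b by (simp add: \<Phi>_def)
    then show ?thesis using that M by simp
  next
    case True
    have "integral {b..s'} (J y) + integral {s'..min t c} (J y) = integral {b..min t c} (J y)"
      using that True by (intro Henstock_Kurzweil_Integration.integral_combine J_int[OF y]) auto
    then have "\<Phi> y t - \<Phi> y s' = integral {s'..min t c} (J y)"
      using that True by (simp add: \<Phi>_def min_absorb1 min_absorb2 algebra_simps)
    moreover have "norm (integral {s'..min t c} (J y)) \<le> M * measure lborel {s'..min t c}"
    proof (rule has_integral_bound_real[OF M(1), of "{}"])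
      show "(J y has_integral integral {s'..min t c} (J y)) {s'..min t c}"
        using that by (intro integrable_integral J_int[OF y]) auto
    qed (use J_le[OF y] that in auto)
    moreover have "M * measure lborel {s'..min t c} \<le> M * (t - s')"
      using True that M(1) by (intro mult_left_mono) auto
    ultimately show ?thesis by simp
  qed
  have \<Phi>_le: "\<Phi> y t = \<xi> t" if "t \<le> b" for y t
  proof -
    have "integral {b..min t c} (J y) = 0" using that b by (cases "t = b") auto
    then show ?thesis using that by (simp add: \<Phi>_def min_def)
  qed
  have \<Phi>_in: "\<Phi> y \<in> delay_class b c M \<xi>" if y: "y \<in> delay_class b c M \<xi>" for y
    unfolding delay_class_def mem_Collect_eq
  proof (intro conjI allI impI)
    have "continuous_on {..b} (\<Phi> y)"
      using continuous_on_subset[OF \<xi> subset_UNIV] by (rule continuous_on_eq) (simp add: \<Phi>_le)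
    moreover have "M-lipschitz_on {b..} (\<Phi> y)"
    proof (rule lipschitz_onI)
      fix s t assume "s \<in> {b..}" "t \<in> {b..}"
      then show "dist (\<Phi> y s) (\<Phi> y t) \<le> M * dist s t"
        using \<Phi>_diff[OF y, of s t] \<Phi>_diff[OF y, of t s] by (cases "s \<le> t") (auto simp: dist_norm norm_minus_commute)
    qed (rule M)
    then have "continuous_on {b..} (\<Phi> y)" by (rule lipschitz_on_continuous_on)
    ultimately have "continuous_on ({..b} \<union> {b..}) (\<Phi> y)" by (intro continuous_on_closed_Un) auto
    moreover have "{..b} \<union> {b..} = UNIV" by auto
    ultimately show "continuous_on UNIV (\<Phi> y)" by simp
    show "\<Phi> y t = \<Phi> y c" if "t \<ge> c" for t using that b by (simp add: \<Phi>_def min_def)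
  qed (use \<Phi>_le \<Phi>_diff[OF y] in auto)
  define Y where "Y j = (\<Phi> ^^ j) (\<lambda>t. \<xi> (min t b))" for j
  have Y_in: "Y j \<in> delay_class b c M \<xi>" for j
  proof (induction j)
    case 0
    have "continuous_on UNIV (\<lambda>t. \<xi> (min t b))"
      by (rule continuous_on_compose2[OF \<xi>]) (auto intro!: continuous_intros)
    then show ?case using M b by (auto simp: Y_def delay_class_def min_def)
  next
    case (Suc j)
    then show ?case using \<Phi>_in by (simp add: Y_def)
  qed
  have Y_cont: "continuous_on S (Y j)" for S j
    using Y_in[of j] by (auto simp: delay_class_def elim: continuous_on_subset)
  \<comment> \<open>The integrand at \<open>\<tau>\<close> reads its argument only up to
    \<open>\<tau> - k\<close>, so each application of \<open>\<Phi>\<close> extends the interval of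
    agreement of consecutive iterates by \<open>k\<close>.\<close>
  have agree: "\<forall>t \<le> b + real j * k. Y (Suc j) t = Y j t" for j
  proof (induction j)
    case 0
    then show ?case using \<Phi>_le by (auto simp: Y_def min_def)
  next
    case (Suc j)
    show ?case
    proof (intro allI impI)
      fix t assume t: "t \<le> b + real (Suc j) * k"
      have "J (Y (Suc j)) \<tau> = J (Y j) \<tau>" if "\<tau> \<in> {b..min t c}" for \<tau>
      proof -
        have "history r (\<tau> - k) (Y (Suc j)) = history r (\<tau> - k) (Y j)"
          using Suc.IH that t by (intro history_cong[OF r_pos]) (auto simp: algebra_simps)
        then show ?thesis by (simp add: J_def)
      qed
      then have "integral {b..min t c} (J (Y (Suc j))) = integral {b..min t c} (J (Y j))"
        by (rule Henstock_Kurzweil_Integration.integral_cong)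
      then show "Y (Suc (Suc j)) t = Y (Suc j) t" by (simp add: Y_def \<Phi>_def)
    qed
  qed
  \<comment> \<open>Once the agreement covers \<open>[b,c]\<close>, the iterate is a fixed point
    there, that is, a solution of the delayed integral equation.\<close>
  obtain N :: nat where "c - b < real N * k" using reals_Archimedean3[OF k(1)] by blast
  then have "\<Phi> (Y N) t = Y N t" if "t \<in> {b..c}" for t
    using agree[of N] that by (simp add: Y_def)
  then have "Y N t = \<xi> b + integral {b..t} (J (Y N))" if "t \<in> {b..c}" for t
    using that by (metis \<Phi>_def atLeastAtMost_iff min.absorb1 min.absorb2)
  with Y_in[of N] show ?thesis unfolding J_def by blast
qed

end

context retarded_system
begin

text \<open>Solutions of the delayed equations with delays tending to \<open>0\<close> are
  equi-Lipschitz, so a subsequence converges uniformly. For fixed \<open>t\<close> the map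
  \<open>f\<close> is continuous in the state, hence the integrands converge pointwise under the
  bound \<open>M\<close>, and dominated convergence yields the integral equation of the
  limit.\<close>

lemma local_solution_exists:
  fixes \<xi> :: "real \<Rightarrow> 'x"
  assumes \<xi>: "continuous_on UNIV \<xi>" and b: "0 \<le> b"
    and u: "u \<in> inputs (U \<inter> cball 0 s)" and d: "d \<in> inputs D"
  shows "\<exists>c>b. \<exists>M y. continuous_on UNIV y \<and> (\<forall>t\<le>b. y t = \<xi> t) \<and> M-lipschitz_on {b..c} y \<and>
    (AE t in lebesgue. b < t \<and> t < c \<longrightarrow> (y has_vector_derivative f t (history r t y) (u t) (d t)) (at t))"
proof -
  have "compact (\<xi> ` {b - r - 1..b})"
    by (intro compact_continuous_image continuous_on_subset[OF \<xi>]) auto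
  then have "bounded (\<xi> ` {b - r - 1..b})" by (rule compact_imp_bounded)
  then obtain B where "\<forall>t\<in>{b - r - 1..b}. norm (\<xi> t) \<le> B" by (auto simp: bounded_iff)
  then have B: "\<And>t. t \<in> {b - r - 1..b} \<Longrightarrow> norm (\<xi> t) \<le> B" by blast
  obtain M where "M \<ge> 0" and fM0: "\<forall>t\<in>{0..b + 1}. \<forall>z\<in>state_space r. \<forall>v\<in>U. \<forall>e\<in>D.
      norm z \<le> B + 1 \<longrightarrow> norm v \<le> s \<longrightarrow> norm (f t z v e) \<le> M"
    using f_norm_bound by blast
  \<comment> \<open>\<open>M\<close> bounds \<open>f\<close> up to time \<open>b + 1\<close> and
    radius \<open>B + 1\<close>. This length keeps the solution inside both:
    \<open>c \<le> b + 1\<close> and \<open>M * (c - b) \<le> 1\<close>.\<close>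
  define c where "c = b + 1 / (M + 1)"
  have c: "b < c" "c \<le> b + 1" "M * (c - b) \<le> 1" using \<open>M \<ge> 0\<close> by (auto simp: c_def field_simps)
  have fM: "norm (f t z v e) \<le> M" if "t \<in> {0..c}" "z \<in> state_space r" "v \<in> U" "e \<in> D" "norm z \<le> B + 1" "norm v \<le> s"
    for t z v e using fM0 that c by auto
  define k where "k n = 1 / real (Suc n)" for n
  have k: "0 < k n" "k n \<le> 1" for n by (auto simp: k_def)
  have k_lim: "k \<longlonglongrightarrow> 0"
    unfolding k_def by (rule LIMSEQ_Suc) (rule lim_1_over_n)
  have "\<exists>y\<in>delay_class b c M \<xi>. \<forall>t\<in>{b..c}.
    y t = \<xi> b + integral {b..t} (\<lambda>\<tau>. f \<tau> (history r (\<tau> - k n) y) (u \<tau>) (d \<tau>))" for n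
    by (rule delayed_solution_exists[OF \<xi> b c(1) u d B \<open>M \<ge> 0\<close> c(3) fM k])
  then obtain Y where Y: "\<And>n. Y n \<in> delay_class b c M \<xi>"
    and Y_eq: "\<And>n t. t \<in> {b..c} \<Longrightarrow> Y n t = \<xi> b + integral {b..t} (\<lambda>\<tau>. f \<tau> (history r (\<tau> - k n) (Y n)) (u \<tau>) (d \<tau>))"
    by metis
  have YD: "continuous_on UNIV (Y n)" "\<And>t. t \<le> b \<Longrightarrow> Y n t = \<xi> t" "\<And>t. t \<ge> c \<Longrightarrow> Y n t = Y n c"
    "\<And>s t. b \<le> s \<Longrightarrow> s \<le> t \<Longrightarrow> norm (Y n t - Y n s) \<le> M * (t - s)" for n
    using Y[of n] unfolding delay_class_def mem_Collect_eq by blast+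
  have Y_lip: "norm (Y n t - Y n t') \<le> M * \<bar>t - t'\<bar>" if "b \<le> t" "b \<le> t'" for n t t'
    using YD(4)[of t t' n] YD(4)[of t' t n] that by (cases "t \<le> t'") (auto simp: norm_minus_commute)
  obtain g and \<kappa> :: "nat \<Rightarrow> nat" where g: "continuous_on {b..c} g" "strict_mono \<kappa>"
    "\<And>e. 0 < e \<Longrightarrow> \<exists>N. \<forall>n t. n \<ge> N \<and> t \<in> {b..c} \<longrightarrow> norm (Y (\<kappa> n) t - g t) < e"
  proof (rule Arzela_Ascoli[of "{b..c}" Y "norm (\<xi> b) + M * (c - b)"])
    fix n t assume t: "t \<in> {b..c}"
    have "norm (Y n t - \<xi> b) \<le> M * (t - b)" using YD(4)[of b t n] YD(2)[of b n] t by simp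
    also have "\<dots> \<le> M * (c - b)" using t \<open>M \<ge> 0\<close> by (intro mult_left_mono) auto
    finally show "norm (Y n t) \<le> norm (\<xi> b) + M * (c - b)"
      using norm_triangle_sub[of "Y n t" "\<xi> b"] by linarith
  next
    fix t e :: real assume t: "t \<in> {b..c}" and "0 < e"
    have "norm (Y n t - Y n t') < e" if "t' \<in> {b..c}" "norm (t - t') < e / (M + 1)" for n t'
    proof -
      have "norm (Y n t - Y n t') \<le> M * \<bar>t - t'\<bar>" using t that by (intro Y_lip) auto
      also have "\<dots> \<le> (M + 1) * \<bar>t - t'\<bar>" by (intro mult_right_mono) auto
      also have "\<dots> < e" using that \<open>M \<ge> 0\<close> by (simp add: field_simps)
      finally show ?thesis .
    qed
    moreover have "e / (M + 1) > 0" using \<open>0 < e\<close> \<open>M \<ge> 0\<close> by simp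
    ultimately show "\<exists>d>0. \<forall>n y. y \<in> {b..c} \<and> norm (t - y) < d \<longrightarrow> norm (Y n t - Y n y) < e" by blast
  next
    fix g and \<kappa> :: "nat \<Rightarrow> nat"
    assume 1: "continuous_on {b..c} g" "strict_mono \<kappa>"
      and 2: "\<And>e. 0 < e \<Longrightarrow> \<exists>N. \<forall>n t. n \<ge> N \<and> t \<in> {b..c} \<longrightarrow> norm (Y (\<kappa> n) t - g t) < e"
    show thesis by (rule that[OF 1 2])
  qed simp
  \<comment> \<open>Continued past \<open>c\<close> by a constant, as the approximations are, so
    that the convergence is uniform on the whole line and not only on \<open>[b,c]\<close>.\<close>
  define y where "y t = (if t \<le> b then \<xi> t else g (min t c))" for t
  have Y_dist: "norm (Y (\<kappa> n) t - y t) < e"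
    if "0 < e" "\<forall>t\<in>{b..c}. norm (Y (\<kappa> n) t - g t) < e" for n t e
  proof (cases "t \<le> b")
    case True
    then show ?thesis using YD(2) \<open>0 < e\<close> by (simp add: y_def)
  next
    case False
    have "Y (\<kappa> n) t = Y (\<kappa> n) (min t c)" using YD(3)[of t] by (auto simp: min_def)
    then show ?thesis using False that(2) c by (auto simp: y_def)
  qed
  have Y_unif: "\<exists>N. \<forall>n\<ge>N. \<forall>t. norm (Y (\<kappa> n) t - y t) < e" if "0 < e" for e
    using g(3)[OF that] Y_dist[OF that] by metis
  have Y_lim: "(\<lambda>n. Y (\<kappa> n) t) \<longlonglongrightarrow> y t" for t
    unfolding LIMSEQ_iff using Y_unif by meson
  have y_le: "y t = \<xi> t" if "t \<le> b" for t using that by (simp add: y_def)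
  have y_lip: "M-lipschitz_on {b..} y"
  proof (rule lipschitz_onI)
    fix t t' assume "t \<in> {b..}" "t' \<in> {b..}"
    then have "norm (y t - y t') \<le> M * \<bar>t - t'\<bar>"
      using Y_lip by (intro tendsto_upperbound[OF tendsto_norm[OF tendsto_diff[OF Y_lim Y_lim]]]) auto
    then show "dist (y t) (y t') \<le> M * dist t t'" by (simp add: dist_norm)
  qed fact
  have y_cont: "continuous_on UNIV y"
  proof -
    have "continuous_on {..b} y"
      using continuous_on_subset[OF \<xi> subset_UNIV] by (rule continuous_on_eq) (simp add: y_le)
    moreover have "continuous_on {b..} y" using y_lip by (rule lipschitz_on_continuous_on)
    ultimately have "continuous_on ({..b} \<union> {b..}) y" by (intro continuous_on_closed_Un) auto
    moreover have "{..b} \<union> {b..} = UNIV" by auto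
    ultimately show ?thesis by simp
  qed
  define J where "J n t = f t (history r (t - k (\<kappa> n)) (Y (\<kappa> n))) (u t) (d t)" for n t
  define G where "G t = f t (history r t y) (u t) (d t)" for t
  have hist_in: "history r t z \<in> state_space r" if "continuous_on UNIV z" for z :: "real \<Rightarrow> 'x" and t
    using history_in_state_space(1)[OF r_pos] continuous_on_subset[OF that] by blast
  have u_in: "u t \<in> U" "norm (u t) \<le> s" "d t \<in> D" if "t \<in> {b..c}" for t
    using inputsD(1)[OF u, of t] inputsD(1)[OF d, of t] that b by auto
  have J_le: "norm (J n t) \<le> M" if "t \<in> {b..c}" for n t
    unfolding J_def
  proof (rule fM)
    show "norm (history r (t - k (\<kappa> n)) (Y (\<kappa> n))) \<le> B + 1"
      using norm_history_delay_class[OF Y B \<open>M \<ge> 0\<close> c(3) that] k[of "\<kappa> n"] by auto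
  qed (use that b u_in hist_in[OF YD(1)] in auto)
  have J_int: "J n integrable_on {b..t}" if "t \<in> {b..c}" for n t
    unfolding J_def using that J_le[unfolded J_def] by (intro integrable_along_history[OF YD(1) b u d, where M = M]) auto
  have J_lim: "(\<lambda>n. J n t) \<longlonglongrightarrow> G t" if t: "t \<in> {b..c}" for t
  proof -
    \<comment> \<open>Two errors are involved: the distance of the approximation from
      \<open>y\<close>, and the shift by the vanishing delay, which uniform continuity of
      \<open>y\<close> controls.\<close>
    have hist_lim: "(\<lambda>n. history r (t - k (\<kappa> n)) (Y (\<kappa> n))) \<longlonglongrightarrow> history r t y"
      unfolding LIMSEQ_iff
    proof (intro allI impI)
      fix e :: real assume "e > 0"
      have "uniformly_continuous_on {b - r - 1..c} y"
        using continuous_on_subset[OF y_cont subset_UNIV] by (intro compact_uniformly_continuous) auto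
      then obtain \<delta> where "\<delta> > 0" and \<delta>: "\<And>s s'. s \<in> {b - r - 1..c} \<Longrightarrow> s' \<in> {b - r - 1..c} \<Longrightarrow> dist s' s < \<delta> \<Longrightarrow>
         dist (y s') (y s) < e / 3"
        using \<open>e > 0\<close> unfolding uniformly_continuous_on_def by (metis zero_less_divide_iff zero_less_numeral)
      obtain N1 where N1: "\<And>n t. n \<ge> N1 \<Longrightarrow> norm (Y (\<kappa> n) t - y t) < e / 3"
        using Y_unif[of "e / 3"] \<open>e > 0\<close> by auto
      have "(\<lambda>n. k (\<kappa> n)) \<longlonglongrightarrow> 0" using LIMSEQ_subseq_LIMSEQ[OF k_lim g(2)] by (simp add: o_def)
      then obtain N2 where N2: "\<And>n. n \<ge> N2 \<Longrightarrow> k (\<kappa> n) < \<delta>"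
        using \<open>\<delta> > 0\<close> unfolding LIMSEQ_iff by (metis abs_less_iff diff_zero real_norm_def)
      have "norm (history r (t - k (\<kappa> n)) (Y (\<kappa> n)) - history r t y) < e" if n: "n \<ge> max N1 N2" for n
      proof -
        have "norm (history r (t - k (\<kappa> n)) (Y (\<kappa> n)) - history r t y) \<le> 2 * e / 3"
        proof (rule norm_history_diff_le[OF r_pos])
          fix \<theta> assume \<theta>: "\<theta> \<in> {-r..0}"
          have "norm (Y (\<kappa> n) (t - k (\<kappa> n) + \<theta>) - y (t - k (\<kappa> n) + \<theta>)) < e / 3" using N1 n by simp
          moreover have "norm (y (t - k (\<kappa> n) + \<theta>) - y (t + \<theta>)) < e / 3"
            using \<delta>[of "t + \<theta>" "t - k (\<kappa> n) + \<theta>"] N2[of n] k[of "\<kappa> n"] n \<theta> t by (auto simp: dist_norm)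
          ultimately show "norm (Y (\<kappa> n) (t - k (\<kappa> n) + \<theta>) - y (t + \<theta>)) \<le> 2 * e / 3"
            using norm_triangle_ineq[of "Y (\<kappa> n) (t - k (\<kappa> n) + \<theta>) - y (t - k (\<kappa> n) + \<theta>)"
                "y (t - k (\<kappa> n) + \<theta>) - y (t + \<theta>)"] by simp
        qed (auto intro: continuous_on_subset[OF y_cont] continuous_on_subset[OF YD(1)])
        then show ?thesis using \<open>e > 0\<close> by simp
      qed
      then show "\<exists>N. \<forall>n\<ge>N. norm (history r (t - k (\<kappa> n)) (Y (\<kappa> n)) - history r t y) < e" by blast
    qed
    have "continuous_on (state_space r) (\<lambda>z. f t z (u t) (d t))"
    proof -
      have "continuous_on (state_space r) (\<lambda>z::real \<Rightarrow>\<^sub>C 'x. (z, u t, d t))" by (intro continuous_intros)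
      from continuous_on_compose2[OF f_cont[of t] this] t b u_in[OF t] show ?thesis
        by (simp add: image_subset_iff)
    qed
    from continuous_on_tendsto_compose[OF this hist_lim] show ?thesis
      unfolding J_def G_def using hist_in y_cont YD(1) by (auto simp: o_def)
  qed
  have G_int: "G integrable_on {b..t}" and y_eq: "y t = \<xi> b + integral {b..t} G" if t: "t \<in> {b..c}" for t
  proof -
    have *: "G integrable_on {b..t}" "(\<lambda>n. integral {b..t} (J n)) \<longlonglongrightarrow> integral {b..t} G"
      using dominated_convergence[of J "{b..t}" "\<lambda>_. M" G] J_int J_le J_lim t by auto
    show "G integrable_on {b..t}" by (rule *)
    have "(\<lambda>n. Y (\<kappa> n) t) \<longlonglongrightarrow> \<xi> b + integral {b..t} G"
      using tendsto_add[OF tendsto_const *(2), of "\<xi> b"] Y_eq[OF t] by (simp add: J_def[abs_def])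
    with Y_lim[of t] show "y t = \<xi> b + integral {b..t} G" by (rule LIMSEQ_unique)
  qed
  have "AE t in lebesgue. b < t \<and> t < c \<longrightarrow> (y has_vector_derivative G t) (at t)"
  proof -
    have "G integrable_on {b..c}" using G_int[of c] c by simp
    from AE_has_vector_derivative_integral[OF this] show ?thesis
    proof eventually_elim
      case (elim t)
      show ?case
      proof
        assume t: "b < t \<and> t < c"
        with elim have "((\<lambda>t. \<xi> b + integral {b..t} G) has_vector_derivative 0 + G t) (at t)"
          by (intro has_vector_derivative_add has_vector_derivative_const) auto
        then show "(y has_vector_derivative G t) (at t)"
          unfolding add_0
          by (rule has_vector_derivative_transform_within_open[of _ _ _ "{b<..<c}"]) (use t y_eq in auto)
      qed
    qed
  qed
  moreover have "M-lipschitz_on {b..c} y" using y_lip by (rule lipschitz_on_subset) auto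
  ultimately show ?thesis using c(1) y_cont y_le unfolding G_def by blast
qed

end

section \<open>Solutions and Lyapunov functions\<close>

lemma has_vector_derivative_eventually_right:
  assumes "(x has_vector_derivative v) (at t)" "e > 0"
  shows "\<forall>\<^sub>F h in at_right 0. norm (x (t + h) - x t - h *\<^sub>R v) \<le> e * h"
proof -
  obtain d where "d > 0" and d: "\<And>y. norm (y - t) < d \<Longrightarrow> norm (x y - x t - (y - t) *\<^sub>R v) \<le> e * norm (y - t)"
    using assms unfolding has_vector_derivative_def has_derivative_at_alt by blast
  have "norm (x (t + h) - x t - h *\<^sub>R v) \<le> e * h" if "0 < h" "h < d" for h
    using d[of "t + h"] that by simp
  with \<open>d > 0\<close> show ?thesis unfolding eventually_at_right_field by blast
qed

lemma dini_le_norm: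
  assumes "(x has_vector_derivative v) (at t)"
  shows "dini_le (\<lambda>s. norm (x s - p)) t (norm v)"
  unfolding dini_le_def
proof (intro allI impI)
  fix e :: real assume "e > 0"
  have "\<forall>\<^sub>F h::real in at_right 0. h > 0" by (rule eventually_at_right_less)
  with has_vector_derivative_eventually_right[OF assms \<open>e > 0\<close>]
  show "\<forall>\<^sub>F h in at_right 0. norm (x (t + h) - p) - norm (x t - p) \<le> (norm v + e) * h"
  proof eventually_elim
    case (elim h)
    have "norm (x (t + h) - p) - norm (x t - p) \<le> norm ((x (t + h) - p) - (x t - p))"
      by (rule norm_triangle_ineq2)
    also have "\<dots> = norm ((x (t + h) - x t - h *\<^sub>R v) + h *\<^sub>R v)" by simp
    also have "\<dots> \<le> norm (x (t + h) - x t - h *\<^sub>R v) + norm (h *\<^sub>R v)" by (rule norm_triangle_ineq)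
    also have "\<dots> \<le> e * h + norm v * h" using elim by simp
    finally show ?case by (simp add: algebra_simps)
  qed
qed

text \<open>Replacing \<open>x (t + h)\<close> by \<open>x t + h *\<^sub>R v\<close> costs
  \<open>V\<close> at most its local Lipschitz constant times \<open>o(h)\<close>, so no chain rule
  is involved. \<open>dini_le\<close> states the bound with a slack \<open>e\<close> in the reals,
  which avoids arithmetic with extended-real upper limits.\<close>

lemma dini_le_along_derivative:
  fixes x :: "real \<Rightarrow> 'x::euclidean_space"
  assumes V: "locally_lipschitz_on ({-r..} \<times> UNIV) (\<lambda>(t, x). V t x)" and "- r < t"
    and x: "(x has_vector_derivative v) (at t)" and D: "upper_right_deriv V t (x t) v \<le> ereal c"
  shows "dini_le (\<lambda>s. V s (x s)) t c"
  unfolding dini_le_def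
proof (intro allI impI)
  fix e :: real assume "e > 0"
  obtain e0 L where "e0 > 0" and L: "L-lipschitz_on (cball (t, x t) e0 \<inter> ({-r..} \<times> UNIV)) (\<lambda>(t, x). V t x)"
  proof -
    have "(t, x t) \<in> {-r..} \<times> UNIV" using \<open>- r < t\<close> by simp
    with V that show thesis unfolding locally_lipschitz_on_def by blast
  qed
  have "L \<ge> 0" using L by (rule lipschitz_on_nonneg)
  \<comment> \<open>Half of \<open>e\<close> is spent on the replacement, the other half on the
    upper limit in \<open>upper_right_deriv\<close>.\<close>
  define \<eta> where "\<eta> = e / (2 * (L + 1))"
  have \<eta>: "\<eta> > 0" "L * \<eta> \<le> e / 2"
    using \<open>e > 0\<close> \<open>L \<ge> 0\<close> by (auto simp: \<eta>_def field_simps)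
  have x_cont: "(x \<longlongrightarrow> x t) (at t)"
    using has_vector_derivative_continuous[OF x] by (simp add: continuous_at)
  have add_lim: "((\<lambda>h. t + h) \<longlongrightarrow> t) (at_right 0)"
    using tendsto_add[OF tendsto_const[of t] tendsto_ident_at[of 0 "{0<..}"]] by simp
  have ev0: "\<forall>\<^sub>F h::real in at_right 0. h > 0" by (rule eventually_at_right_less)
  have "filterlim (\<lambda>h. t + h) (at t) (at_right 0)"
    unfolding filterlim_at using add_lim ev0 by (auto elim: eventually_mono)
  from filterlim_compose[OF x_cont this] have "((\<lambda>h. (t + h, x (t + h))) \<longlongrightarrow> (t, x t)) (at_right 0)"
    using add_lim by (intro tendsto_Pair)
  then have ev1: "\<forall>\<^sub>F h in at_right 0. dist (t + h, x (t + h)) (t, x t) < e0"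
    using \<open>e0 > 0\<close> by (rule tendstoD)
  have "((\<lambda>h. (t + h, x t + h *\<^sub>R v)) \<longlongrightarrow> (t, x t + 0 *\<^sub>R v)) (at_right 0)"
    using add_lim by (intro tendsto_intros)
  then have ev2: "\<forall>\<^sub>F h in at_right 0. dist (t + h, x t + h *\<^sub>R v) (t, x t) < e0"
    using \<open>e0 > 0\<close> by (auto dest: tendstoD)
  have "upper_right_deriv V t (x t) v < ereal (c + e / 2)"
    using D \<open>e > 0\<close> by (elim order.strict_trans1) simp
  then have ev3: "\<forall>\<^sub>F h in at_right 0. ereal ((V (t + h) (x t + h *\<^sub>R v) - V t (x t)) / h) < ereal (c + e / 2)"
    unfolding upper_right_deriv_def by (rule Limsup_lessD)
  from ev0 ev1 ev2 ev3 has_vector_derivative_eventually_right[OF x \<eta>(1)]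
  show "\<forall>\<^sub>F h in at_right 0. V (t + h) (x (t + h)) - V t (x t) \<le> (c + e) * h"
  proof eventually_elim
    case (elim h)
    have "dist (V (t + h) (x (t + h))) (V (t + h) (x t + h *\<^sub>R v)) \<le>
        L * dist (t + h, x (t + h)) (t + h, x t + h *\<^sub>R v)"
      using lipschitz_onD[OF L, of "(t + h, x (t + h))" "(t + h, x t + h *\<^sub>R v)"] elim \<open>- r < t\<close>
      by (simp add: dist_commute)
    also have "\<dots> = L * norm (x (t + h) - x t - h *\<^sub>R v)"
      by (simp add: dist_Pair_Pair dist_norm algebra_simps)
    also have "\<dots> \<le> L * (\<eta> * h)" using elim \<open>L \<ge> 0\<close> by (intro mult_left_mono)
    also have "\<dots> \<le> (e / 2) * h"
      using \<eta>(2) elim(1) by (simp only: mult.assoc[symmetric]) (intro mult_right_mono, auto)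
    finally have 1: "V (t + h) (x (t + h)) - V (t + h) (x t + h *\<^sub>R v) \<le> (e / 2) * h"
      unfolding dist_real_def by linarith
    have "V (t + h) (x t + h *\<^sub>R v) - V t (x t) \<le> (c + e / 2) * h"
      using elim by (simp add: field_simps)
    with 1 show ?case by (simp add: algebra_simps)
  qed
qed

text \<open>The graph of \<open>x\<close> over \<open>[a,b]\<close> is compact, so finitely many
  Lipschitz balls cover it and a Lebesgue number \<open>\<eta>\<close> puts the graph points of
  nearby times into a common ball. The sum of the finitely many constants dominates each of
  them.\<close>

lemma abs_continuous_locally_lipschitz:
  fixes x :: "real \<Rightarrow> 'x::euclidean_space" and V :: "real \<Rightarrow> 'x \<Rightarrow> real"
  assumes x: "abs_continuous_on_interval a b x"
    and V: "locally_lipschitz_on S (\<lambda>(t, x). V t x)" and S: "\<And>t. t \<in> {a..b} \<Longrightarrow> (t, x t) \<in> S"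
  shows "abs_continuous_on_interval a b (\<lambda>t. V t (x t))"
proof -
  define K where "K = (\<lambda>t. (t, x t)) ` {a..b}"
  have "compact K" unfolding K_def
    using abs_continuous_on_interval_imp_continuous_on[OF x]
    by (intro compact_continuous_image continuous_intros) auto
  have "\<forall>z\<in>K. \<exists>e L. e > 0 \<and> L-lipschitz_on (cball z e \<inter> S) (\<lambda>(t, x). V t x)"
    using V S unfolding K_def locally_lipschitz_on_def by blast
  then obtain e L where e: "\<And>z. z \<in> K \<Longrightarrow> e z > 0"
    and L: "\<And>z. z \<in> K \<Longrightarrow> (L z)-lipschitz_on (cball z (e z) \<inter> S) (\<lambda>(t, x). V t x)"
    by metis
  have cover: "K \<subseteq> (\<Union>z\<in>K. ball z (e z))" using e by auto
  obtain C where C: "C \<subseteq> K" "finite C" "K \<subseteq> (\<Union>z\<in>C. ball z (e z))"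
    by (rule compactE_image[OF \<open>compact K\<close> _ cover]) auto
  obtain \<eta> where "\<eta> > 0" and \<eta>: "\<And>w. w \<in> K \<Longrightarrow> \<exists>G\<in>(\<lambda>z. ball z (e z)) ` C. ball w \<eta> \<subseteq> G"
    using Heine_Borel_lemma[OF \<open>compact K\<close>, of "(\<lambda>z. ball z (e z)) ` C"] C(3) by auto
  have L0: "L z \<ge> 0" if "z \<in> C" for z using lipschitz_on_nonneg[OF L] C(1) that by blast
  obtain \<eta>' where "\<eta>' > 0" and \<eta>': "\<And>s t. s \<in> {a..b} \<Longrightarrow> t \<in> {a..b} \<Longrightarrow> \<bar>s - t\<bar> < \<eta>' \<Longrightarrow> norm (x s - x t) < \<eta> / 2"
    using abs_continuous_on_interval_uniform[OF x, of "\<eta> / 2"] \<open>\<eta> > 0\<close> by auto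
  show ?thesis
  proof (rule abs_continuous_on_interval_dominated[OF x, where \<eta> = "min \<eta>' (\<eta> / 2)" and L = "\<Sum>z\<in>C. L z"])
    fix s t assume st: "s \<in> {a..b}" "t \<in> {a..b}" "\<bar>s - t\<bar> < min \<eta>' (\<eta> / 2)"
    have d: "dist (s, x s) (t, x t) \<le> norm (x s - x t) + \<bar>s - t\<bar>"
      unfolding dist_Pair_Pair using sqrt_sum_squares_le_sum_abs[of "dist s t" "dist (x s) (x t)"]
      by (simp add: dist_norm)
    have "(s, x s) \<in> K" using st by (simp add: K_def)
    then obtain z where z: "z \<in> C" "ball (s, x s) \<eta> \<subseteq> ball z (e z)" using \<eta> by blast
    have "dist (s, x s) (t, x t) < \<eta>" using d \<eta>'[of s t] st by simp
    then have "(t, x t) \<in> ball (s, x s) \<eta>" "(s, x s) \<in> ball (s, x s) \<eta>"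
      using \<open>\<eta> > 0\<close> by (simp_all only: mem_ball dist_self)
    then have "(t, x t) \<in> ball z (e z)" "(s, x s) \<in> ball z (e z)" using z(2) by blast+
    then have "dist (V s (x s)) (V t (x t)) \<le> L z * dist (s, x s) (t, x t)"
      using lipschitz_onD[OF L[of z], of "(s, x s)" "(t, x t)"] z(1) C(1) S st by auto
    also have "\<dots> \<le> (\<Sum>z\<in>C. L z) * (norm (x s - x t) + \<bar>s - t\<bar>)"
      using d L0 z(1) C(2) by (intro mult_mono member_le_sum sum_nonneg) auto
    finally show "norm (V s (x s) - V t (x t)) \<le> (\<Sum>z\<in>C. L z) * (norm (x s - x t) + \<bar>s - t\<bar>)"
      by (simp add: dist_norm)
  qed (use \<open>\<eta> > 0\<close> \<open>\<eta>' > 0\<close> L0 in \<open>auto intro: sum_nonneg\<close>)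
qed

text \<open>A mean value inequality for absolutely continuous curves: the scalar function
  \<open>norm (x t - x a)\<close> has Dini derivative at most \<open>M\<close> almost everywhere and
  starts at \<open>0\<close>.\<close>

lemma abs_continuous_norm_bound:
  fixes x :: "real \<Rightarrow> 'x::real_normed_vector"
  assumes "a \<le> b" and ac: "abs_continuous_on_interval a b x"
    and ae: "AE t in lebesgue. a < t \<and> t < b \<longrightarrow> (\<exists>v. (x has_vector_derivative v) (at t) \<and> norm v \<le> M)"
  shows "norm (x b - x a) \<le> M * (b - a)"
proof -
  have "norm (x b - x a) \<le> norm (x a - x a) - (- M) * (b - a)"
  proof (rule abs_continuous_dini_decrease[OF \<open>a \<le> b\<close>])
    show "abs_continuous_on_interval a b (\<lambda>t. norm (x t - x a))"
    proof (rule abs_continuous_on_interval_dominated[OF ac, where \<eta> = 1 and L = 1])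
      fix s t
      have "norm (norm (x s - x a) - norm (x t - x a)) \<le> norm ((x s - x a) - (x t - x a))"
        unfolding real_norm_def by (rule norm_triangle_ineq3)
      then show "norm (norm (x s - x a) - norm (x t - x a)) \<le> 1 * (norm (x s - x t) + \<bar>s - t\<bar>)" by simp
    qed auto
    show "AE t in lebesgue. a < t \<and> t < b \<longrightarrow> dini_le (\<lambda>t. norm (x t - x a)) t (- (- M))"
      using ae by eventually_elim (auto intro: dini_le_mono[OF dini_le_norm])
  qed
  then show ?thesis by simp
qed

lemma solution_onD:
  assumes "solution_on r f t0 x0 u d b x"
  shows "ereal t0 < b" "continuous_on {t. t0 - r \<le> t \<and> ereal t < b} x" "history r t0 x = x0"
    "\<And>c. t0 \<le> c \<Longrightarrow> ereal c < b \<Longrightarrow> abs_continuous_on_interval t0 c x"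
    "AE t in lebesgue. t0 \<le> t \<and> ereal t < b \<longrightarrow>
        (x has_vector_derivative f t (history r t x) (u t) (d t)) (at t)"
    "\<And>s t. t0 - r \<le> s \<Longrightarrow> ereal t < b \<Longrightarrow> continuous_on {s..t} x"
proof -
  show c: "continuous_on {t. t0 - r \<le> t \<and> ereal t < b} x" using assms by (simp add: solution_on_def)
  show "continuous_on {s..t} x" if "t0 - r \<le> s" "ereal t < b" for s t
    using that by (intro continuous_on_subset[OF c]) (auto intro: le_less_trans[of "ereal _" "ereal t" b])
qed (use assms in \<open>simp_all add: solution_on_def\<close>)

lemma AE_lebesgue_neq: "AE t in lebesgue. t \<noteq> (c::real)"
  by (rule AE_I'[of "{c}"]) (auto simp: negligible_iff_null_sets[symmetric])

section \<open>Continuation of solutions and forward completeness\<close>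

context retarded_system
begin

text \<open>Bounded state, bounded input and bounded time keep the right-hand side bounded, so the
  solution is Lipschitz and has a limit at a finite end of its interval.\<close>

lemma solution_norm_diff_le:
  assumes sol: "solution_on r f t0 x0 u d b x" and t0: "0 \<le> t0"
    and u: "u \<in> inputs (U \<inter> cball 0 s)" and d: "d \<in> inputs D" and T: "b \<le> ereal T"
    and X: "\<And>t. t0 - r \<le> t \<Longrightarrow> ereal t < b \<Longrightarrow> norm (x t) \<le> X"
  shows "\<exists>L\<ge>0. \<forall>t t'. t0 \<le> t \<longrightarrow> t \<le> t' \<longrightarrow> ereal t' < b \<longrightarrow> norm (x t' - x t) \<le> L * (t' - t)"
proof -
  note sD = solution_onD[OF sol]
  obtain M where "M \<ge> 0" and M: "\<forall>t\<in>{0..T}. \<forall>z\<in>state_space r. \<forall>v\<in>U. \<forall>e\<in>D.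
      norm z \<le> X \<longrightarrow> norm v \<le> s \<longrightarrow> norm (f t z v e) \<le> M"
    using f_norm_bound by blast
  have fM: "norm (f t (history r t x) (u t) (d t)) \<le> M" if t: "t0 \<le> t" "ereal t < b" for t
  proof -
    have "ereal t < ereal T" using t(2) T by (rule less_le_trans)
    then have "t \<in> {0..T}" using t t0 by simp
    moreover have c: "continuous_on {t - r..t} x" using t by (intro sD(6)) auto
    moreover have "norm (history r t x) \<le> X"
    proof (rule norm_history_le[OF r_pos c])
      fix s' assume "s' \<in> {t - r..t}"
      then show "norm (x s') \<le> X" using t by (intro X) (auto intro: le_less_trans[of "ereal _" "ereal t" b])
    qed
    ultimately show ?thesis
      using M inputsD(1)[OF u, of t] inputsD(1)[OF d, of t] history_in_state_space(1)[OF r_pos c] t t0 by auto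
  qed
  have "norm (x t' - x t) \<le> M * (t' - t)" if t: "t0 \<le> t" "t \<le> t'" "ereal t' < b" for t t'
  proof (rule abs_continuous_norm_bound[OF t(2)])
    show "abs_continuous_on_interval t t' x"
      using sD(4)[of t'] t by (auto intro: abs_continuous_on_interval_subset)
    show "AE \<tau> in lebesgue. t < \<tau> \<and> \<tau> < t' \<longrightarrow> (\<exists>v. (x has_vector_derivative v) (at \<tau>) \<and> norm v \<le> M)"
      using sD(5)
    proof eventually_elim
      case (elim \<tau>)
      show ?case
      proof
        assume \<tau>: "t < \<tau> \<and> \<tau> < t'"
        then have "ereal \<tau> < b" using t(3) by (auto intro: less_trans[of "ereal \<tau>" "ereal t'" b])
        with elim \<tau> t fM[of \<tau>] show "\<exists>v. (x has_vector_derivative v) (at \<tau>) \<and> norm v \<le> M" by auto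
      qed
    qed
  qed
  with \<open>M \<ge> 0\<close> show ?thesis by blast
qed

text \<open>At a finite end \<open>\<beta>\<close> the solution, being Lipschitz, extends
  continuously; local existence restarts it there, and the glued function is a strictly longer
  solution, against maximality.\<close>

lemma bounded_maximal_solution_global:
  assumes max: "maximal_solution r f t0 x0 u d b x" and t0: "0 \<le> t0"
    and u: "u \<in> inputs (U \<inter> cball 0 s)" and d: "d \<in> inputs D"
    and X: "\<And>t. t0 - r \<le> t \<Longrightarrow> ereal t < b \<Longrightarrow> norm (x t) \<le> X"
  shows "b = \<infinity>"
proof (rule ccontr)
  assume "b \<noteq> \<infinity>"
  have sol: "solution_on r f t0 x0 u d b x" using max by (simp add: maximal_solution_def)
  note sD = solution_onD[OF sol]
  obtain \<beta> where \<beta>: "b = ereal \<beta>" "t0 < \<beta>"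
    using \<open>b \<noteq> \<infinity>\<close> sD(1) by (cases b) auto
  obtain L where "L \<ge> 0" and L: "\<And>t t'. t0 \<le> t \<Longrightarrow> t \<le> t' \<Longrightarrow> t' < \<beta> \<Longrightarrow> norm (x t' - x t) \<le> L * (t' - t)"
    using solution_norm_diff_le[OF sol t0 u d _ X, of \<beta>] \<beta> by auto
  have lip: "L-lipschitz_on {t0..<\<beta>} x"
  proof (rule lipschitz_onI)
    fix t t' assume "t \<in> {t0..<\<beta>}" "t' \<in> {t0..<\<beta>}"
    then show "dist (x t) (x t') \<le> L * dist t t'"
      using L[of t t'] L[of t' t] by (cases "t \<le> t'") (auto simp: dist_norm norm_minus_commute)
  qed fact
  obtain g where g: "uniformly_continuous_on (closure {t0..<\<beta>}) g" "\<And>t. t \<in> {t0..<\<beta>} \<Longrightarrow> x t = g t"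
    using uniformly_continuous_on_extension_on_closure[OF lipschitz_on_uniformly_continuous[OF lip]] by metis
  have cl: "closure {t0..<\<beta>} = {t0..\<beta>}" using \<beta> by simp
  have g_cont: "continuous_on {t0..\<beta>} g" using g(1) cl uniformly_continuous_imp_continuous by metis
  have "L-lipschitz_on {t0..<\<beta>} g"
    using lip g(2) by (auto simp: lipschitz_on_def)
  then have g_lip: "L-lipschitz_on {t0..\<beta>} g"
    using lipschitz_on_closure[of L "{t0..<\<beta>}" g] g_cont cl by simp
  \<comment> \<open>Local existence takes a continuous function on the whole line, while
    \<open>x\<close> is controlled only on \<open>[t0 - r, \<beta>)\<close>: hence the clamping at
    \<open>t0 - r\<close> and, through the extension \<open>g\<close>, at
    \<open>\<beta>\<close>.\<close>
  define \<xi> where "\<xi> t = (if t \<le> t0 then x (max t (t0 - r)) else g (min t \<beta>))" for t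
  have \<xi>: "continuous_on UNIV \<xi>"
  proof -
    have "continuous_on {..t0} (\<lambda>t. x (max t (t0 - r)))"
      by (rule continuous_on_compose2[OF sD(6)[of "t0 - r" t0]]) (use \<beta> r_pos in \<open>auto intro!: continuous_intros\<close>)
    moreover have "continuous_on {t0..} (\<lambda>t. g (min t \<beta>))"
      by (rule continuous_on_compose2[OF g_cont]) (use \<beta> in \<open>auto intro!: continuous_intros\<close>)
    ultimately have "continuous_on ({..t0} \<union> {t0..}) (\<lambda>t. if t \<le> t0 then x (max t (t0 - r)) else g (min t \<beta>))"
      using g(2)[of t0] \<beta> r_pos by (intro continuous_on_cases) (auto simp: min_def max_def)
    moreover have "{..t0} \<union> {t0..} = UNIV" by auto
    ultimately show ?thesis by (simp add: \<xi>_def[abs_def])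
  qed
  have "0 \<le> \<beta>" using \<beta> t0 by simp
  obtain c M y where c: "c > \<beta>" and y: "continuous_on UNIV y" "\<And>t. t \<le> \<beta> \<Longrightarrow> y t = \<xi> t"
    "M-lipschitz_on {\<beta>..c} y"
    "AE t in lebesgue. \<beta> < t \<and> t < c \<longrightarrow> (y has_vector_derivative f t (history r t y) (u t) (d t)) (at t)"
    using local_solution_exists[OF \<xi> \<open>0 \<le> \<beta>\<close> u d] by blast
  have yx: "y t = x t" if "t0 - r \<le> t" "t < \<beta>" for t
    using that y(2)[of t] g(2)[of t] by (auto simp: \<xi>_def max_def min_def)
  have yg: "y t = g t" if "t0 \<le> t" "t \<le> \<beta>" for t
    using that y(2)[of t] g(2)[of t0] \<beta> r_pos by (cases "t = t0") (auto simp: \<xi>_def max_def min_def)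
  have "(max L M)-lipschitz_on {t0..c} y"
  proof -
    have "L-lipschitz_on {t0..\<beta>} y" using g_lip yg by (auto simp: lipschitz_on_def)
    then show ?thesis using lipschitz_on_concat_max[of L t0 \<beta> y M c y] y(3) 
      by (simp add: if_distrib cong: if_cong)
  qed
  then have y_lip: "abs_continuous_on_interval t0 c y" by (rule lipschitz_imp_abs_continuous)
  have "solution_on r f t0 x0 u d (ereal c) y"
    unfolding solution_on_def
  proof (intro conjI allI impI)
    show "ereal t0 < ereal c" using \<beta> c by simp
    show "continuous_on {t. t0 - r \<le> t \<and> ereal t < ereal c} y" using y(1) by (rule continuous_on_subset) simp
    have "history r t0 y = history r t0 x" using yx \<beta> by (intro history_cong[OF r_pos]) auto
    then show "history r t0 y = x0" using sD(3) by simp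
    show "abs_continuous_on_interval t0 c' y" if "t0 \<le> c' \<and> ereal c' < ereal c" for c'
      using y_lip that by (auto intro: abs_continuous_on_interval_subset)
    \<comment> \<open>Each piece satisfies the equation on its own side; at the junction
      \<open>\<beta>\<close> the derivative may fail to exist, but a single point is null.\<close>
    show "AE t in lebesgue. t0 \<le> t \<and> ereal t < ereal c \<longrightarrow>
        (y has_vector_derivative f t (history r t y) (u t) (d t)) (at t)"
      using sD(5) y(4) AE_lebesgue_neq[of \<beta>]
    proof eventually_elim
      case (elim t)
      show ?case
      proof (intro impI)
        assume t: "t0 \<le> t \<and> ereal t < ereal c"
        show "(y has_vector_derivative f t (history r t y) (u t) (d t)) (at t)"
        proof (cases "t < \<beta>")
          case True
          then have x: "(x has_vector_derivative f t (history r t x) (u t) (d t)) (at t)"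
            using elim t \<beta> by simp
          have "history r t y = history r t x" using yx t True by (intro history_cong[OF r_pos]) auto
          moreover have "(y has_vector_derivative f t (history r t x) (u t) (d t)) (at t)"
            by (rule has_vector_derivative_transform_within_open[OF x, of "{t0 - r<..<\<beta>}"])
               (use t True yx r_pos in auto)
          ultimately show ?thesis by simp
        qed (use elim t in auto)
      qed
    qed
  qed
  moreover have "b \<le> ereal c" using \<beta> c by simp
  moreover have "\<forall>t. t0 - r \<le> t \<and> ereal t < b \<longrightarrow> y t = x t" using yx \<beta> by simp
  ultimately have "ereal c = b" using max unfolding maximal_solution_def by blast
  then show False using \<beta> c by simp
qed

text \<open>\<open>RFC\<close> covers inputs bounded at every time by a constant. The modified input
  \<open>v\<close> is of this kind and leaves the equation unchanged almost everywhere up to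
  \<open>T\<close>, so \<open>x\<close> is maximal for \<open>v\<close> as well, and
  \<open>RFC\<close> with \<open>\<xi> = \<beta> - t0\<close> places \<open>\<beta>\<close> strictly
  before the end \<open>\<beta>\<close>.\<close>

lemma RFC_forward_complete:
  assumes RFC: "RFC r D U f" and max: "maximal_solution r f t0 x0 u d b x" and t0: "0 \<le> t0"
    and x0: "x0 \<in> state_space r" and u: "u \<in> inputs U" and d: "d \<in> inputs D"
  shows "b = \<infinity>"
proof (rule ccontr)
  assume "b \<noteq> \<infinity>"
  have sol: "solution_on r f t0 x0 u d b x" using max by (simp add: maximal_solution_def)
  note sD = solution_onD[OF sol]
  obtain \<beta> where \<beta>: "b = ereal \<beta>" "t0 < \<beta>"
    using \<open>b \<noteq> \<infinity>\<close> sD(1) by (cases b) auto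
  \<comment> \<open>Strictly beyond the supposed end \<open>\<beta>\<close>, so that an extension
    for \<open>v\<close> still overlaps the region where \<open>v\<close> and \<open>u\<close> agree
    almost everywhere.\<close>
  define T where "T = \<beta> + 1"
  have "0 \<le> T" using \<beta> t0 by (simp add: T_def)
  with u obtain M where "AE t in lebesgue_on {0..T}. norm (u t) \<le> M"
    unfolding inputs_def by blast
  then have M: "AE t in lebesgue. t \<in> {0..T} \<longrightarrow> norm (u t) \<le> M"
    by (simp add: AE_restrict_space_iff)
  \<comment> \<open>\<open>RFC\<close> uses one radius for the input and the initial state;
    including \<open>norm x0\<close> also makes it nonnegative.\<close>
  define s where "s = max M (norm x0)"
  have "0 \<le> s" unfolding s_def by (simp add: le_max_iff_disj)
  define v where "v t = (if t \<le> T \<and> norm (u t) \<le> s then u t else 0)" for t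
  have uv: "AE t in lebesgue. 0 \<le> t \<and> t \<le> T \<longrightarrow> v t = u t"
    using M by eventually_elim (auto simp: v_def s_def)
  have [measurable]: "u \<in> borel_measurable (lebesgue_on {0..})" using inputsD(2)[OF u] by simp
  have [measurable]: "(\<lambda>t::real. t) \<in> borel_measurable (lebesgue_on {0..})"
    by (rule continuous_imp_measurable_on_sets_lebesgue) auto
  have "v \<in> borel_measurable (lebesgue_on {0..})" unfolding v_def[abs_def] by measurable
  moreover have v_in: "v t \<in> U \<inter> cball 0 s" if "t \<ge> 0" for t
    using inputsD(1)[OF u that] zero_in_U \<open>0 \<le> s\<close> by (auto simp: v_def)
  moreover have "AE t in lebesgue_on {0..T'}. norm (v t) \<le> s" for T'
    using \<open>0 \<le> s\<close> by (intro AE_I2) (simp add: v_def)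
  ultimately have v: "v \<in> inputs (U \<inter> cball 0 s)" unfolding inputs_def by blast
  have "maximal_solution r f t0 x0 v d b x"
    unfolding maximal_solution_def
  proof (intro conjI allI impI)
    have "AE t in lebesgue. t0 \<le> t \<and> ereal t < b \<longrightarrow>
        (x has_vector_derivative f t (history r t x) (v t) (d t)) (at t)"
      using sD(5) uv by eventually_elim (use \<beta> t0 in \<open>auto simp: T_def\<close>)
    then show "solution_on r f t0 x0 v d b x" using sol by (simp add: solution_on_def)
    fix b' x' assume *: "solution_on r f t0 x0 v d b' x' \<and> b \<le> b' \<and> (\<forall>t. t0 - r \<le> t \<and> ereal t < b \<longrightarrow> x' t = x t)"
    then have s'D: "ereal t0 < b'" "continuous_on {t. t0 - r \<le> t \<and> ereal t < b'} x'" "history r t0 x' = x0"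
      "\<And>c. t0 \<le> c \<Longrightarrow> ereal c < b' \<Longrightarrow> abs_continuous_on_interval t0 c x'"
      "AE t in lebesgue. t0 \<le> t \<and> ereal t < b' \<longrightarrow> (x' has_vector_derivative f t (history r t x') (v t) (d t)) (at t)"
      by (auto simp: solution_on_def)
    \<comment> \<open>Cut off at \<open>T\<close>, an extension for \<open>v\<close> is an extension
      for \<open>u\<close>. Maximality gives \<open>min b' (ereal T) = b\<close>, and
      \<open>T > \<beta>\<close> leaves only \<open>b' = b\<close>.\<close>
    have "solution_on r f t0 x0 u d (min b' (ereal T)) x'"
      unfolding solution_on_def
    proof (intro conjI allI impI)
      show "ereal t0 < min b' (ereal T)" using s'D(1) \<beta> by (simp add: T_def)
      show "continuous_on {t. t0 - r \<le> t \<and> ereal t < min b' (ereal T)} x'"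
        by (rule continuous_on_subset[OF s'D(2)]) auto
      show "AE t in lebesgue. t0 \<le> t \<and> ereal t < min b' (ereal T) \<longrightarrow>
        (x' has_vector_derivative f t (history r t x') (u t) (d t)) (at t)"
        using s'D(5) uv by eventually_elim (use t0 in auto)
    qed (use s'D in auto)
    moreover have "b \<le> min b' (ereal T)" using * \<beta> by (simp add: T_def)
    ultimately have "min b' (ereal T) = b" using max * unfolding maximal_solution_def by blast
    then show "b' = b" using \<beta> by (auto simp: min_def T_def split: if_splits)
  qed
  moreover have "\<beta> - t0 \<in> {0..\<beta>}" "t0 \<in> {0..\<beta>}" "0 \<le> \<beta>" "norm x0 \<le> s" using \<beta> t0 by (auto simp: s_def)
  ultimately have "ereal (t0 + (\<beta> - t0)) < b"
    using RFC \<open>0 \<le> s\<close> v x0 d unfolding RFC_def by blast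
  then show False using \<beta> by simp
qed

end

lemma locally_lipschitz_on_imp_continuous_on:
  assumes "locally_lipschitz_on S g"
  shows "continuous_on S g"
  unfolding continuous_on_eq_continuous_within
proof
  fix z assume "z \<in> S"
  then obtain e L where "e > 0" "L-lipschitz_on (cball z e \<inter> S) g"
    using assms unfolding locally_lipschitz_on_def by blast
  then have "continuous (at z within (cball z e \<inter> S)) g"
    using \<open>z \<in> S\<close> lipschitz_on_continuous_within[of L "cball z e \<inter> S" g z] by simp
  moreover have "at z within (cball z e \<inter> S) = at z within S"
    by (rule at_within_nhd[of z "ball z e"]) (use \<open>e > 0\<close> in auto)
  ultimately show "continuous (at z within S) g" by (simp add: continuous_within)
qed

section \<open>Positive weights: bounds on compact intervals and a sliding maximum\<close>

lemma class_KplusD: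
  assumes "\<beta> \<in> class_Kplus"
  shows "continuous_on {0..} \<beta>" "\<And>t. t \<ge> 0 \<Longrightarrow> \<beta> t > 0"
  using assms by (auto simp: class_Kplus_def)

lemma class_Kplus_bounds:
  assumes "\<beta> \<in> class_Kplus" "T \<ge> 0"
  obtains m M where "0 < m" "\<And>t. 0 \<le> t \<Longrightarrow> t \<le> T \<Longrightarrow> m \<le> \<beta> t \<and> \<beta> t \<le> M"
proof -
  have c: "continuous_on {0..T} \<beta>" by (rule continuous_on_subset[OF class_KplusD(1)[OF assms(1)]]) auto
  have ne: "compact {0..T}" "{0..T} \<noteq> {}" using \<open>T \<ge> 0\<close> by auto
  obtain t1 where t1: "t1 \<in> {0..T}" "\<forall>t\<in>{0..T}. \<beta> t1 \<le> \<beta> t"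
    using continuous_attains_inf[OF ne c] by blast
  obtain t2 where t2: "t2 \<in> {0..T}" "\<forall>t\<in>{0..T}. \<beta> t \<le> \<beta> t2"
    using continuous_attains_sup[OF ne c] by blast
  show thesis
    by (rule that[of "\<beta> t1" "\<beta> t2"]) (use t1 t2 class_KplusD(2)[OF assms(1)] in auto)
qed

text \<open>For a positive weight and \<open>t \<ge> 0\<close> this is the maximum of
  \<open>\<beta>\<close> over \<open>[t, t + r]\<close>. Writing it as the norm of a history makes
  its continuity in \<open>t\<close> an instance of \<open>continuous_on_history\<close>;
  \<open>max 0 s\<close> avoids the meaningless values at negative arguments.\<close>

definition running_majorant :: "real \<Rightarrow> (real \<Rightarrow> real) \<Rightarrow> real \<Rightarrow> real" where
  "running_majorant r \<beta> t = norm (history r (t + r) (\<lambda>s. \<beta> (max 0 s)))"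

lemma running_majorant:
  assumes r: "r > 0" and \<beta>: "\<beta> \<in> class_Kplus"
  shows "running_majorant r \<beta> \<in> class_Kplus"
    and "\<And>s t. 0 \<le> t \<Longrightarrow> t \<le> s \<Longrightarrow> s \<le> t + r \<Longrightarrow> \<beta> s \<le> running_majorant r \<beta> t"
    and "\<And>t B. 0 \<le> t \<Longrightarrow> (\<And>s. 0 \<le> s \<Longrightarrow> \<beta> s \<le> B) \<Longrightarrow> running_majorant r \<beta> t \<le> B"
proof -
  note \<beta>D = class_KplusD[OF \<beta>]
  have c: "continuous_on S (\<lambda>s. \<beta> (max 0 s))" for S
    by (rule continuous_on_compose2[OF \<beta>D(1)]) (auto intro!: continuous_intros)
  show le: "\<beta> s \<le> running_majorant r \<beta> t" if "0 \<le> t" "t \<le> s" "s \<le> t + r" for s t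
    using norm_le_norm_history[OF r c, of s "t + r"] that by (auto simp: running_majorant_def)
  show "running_majorant r \<beta> t \<le> B" if "0 \<le> t" "\<And>s. 0 \<le> s \<Longrightarrow> \<beta> s \<le> B" for t B
    unfolding running_majorant_def using that \<beta>D(2)[THEN less_imp_le]
    by (intro norm_history_le[OF r c]) auto
  have "continuous (at t) (running_majorant r \<beta>)" for t
  proof -
    have "continuous_on {t - 1 + r..t + 1 + r} (\<lambda>t. history r t (\<lambda>s. \<beta> (max 0 s)))"
      by (rule continuous_on_history[OF r c])
    then have "continuous_on {t - 1..t + 1} (\<lambda>t. history r (t + r) (\<lambda>s. \<beta> (max 0 s)))"
      by (rule continuous_on_compose2) (auto intro!: continuous_intros)
    then have "continuous_on {t - 1..t + 1} (running_majorant r \<beta>)"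
      unfolding running_majorant_def[abs_def] by (rule continuous_on_norm)
    then show ?thesis by (rule continuous_on_interior) simp
  qed
  then have "continuous_on {0..} (running_majorant r \<beta>)" by (simp add: continuous_at_imp_continuous_on)
  moreover have "0 < running_majorant r \<beta> t" if "t \<ge> 0" for t
    using le[of t t] \<beta>D(2)[OF that] that r by simp
  ultimately show "running_majorant r \<beta> \<in> class_Kplus" by (simp add: class_Kplus_def)
qed

section \<open>The Lyapunov function along trajectories and the output estimate\<close>

locale lyapunov_razumikhin = retarded_system r D U f H
  for r :: real and D :: "'d::euclidean_space set" and U :: "'u::euclidean_space set"
    and f :: "real \<Rightarrow> (real \<Rightarrow>\<^sub>C 'x::euclidean_space) \<Rightarrow> 'u \<Rightarrow> 'd \<Rightarrow> 'x"
    and H :: "real \<Rightarrow> (real \<Rightarrow>\<^sub>C 'x) \<Rightarrow> 'y::real_normed_vector" +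
  fixes h :: "real \<Rightarrow> 'x \<Rightarrow> 'p::euclidean_space" and V :: "real \<Rightarrow> 'x \<Rightarrow> real"
    and a1 a2 a3 a \<zeta> \<beta> \<delta> \<rho> :: "real \<Rightarrow> real"
  assumes V_nonneg: "\<And>t x. t \<ge> -r \<Longrightarrow> V t x \<ge> 0"
    and V_lipschitz: "locally_lipschitz_on ({-r..} \<times> UNIV) (\<lambda>(t, x). V t x)"
    and a1: "a1 \<in> class_Kinf" and a2: "a2 \<in> class_Kinf" and a3: "a3 \<in> class_Kinf"
    and a: "a \<in> class_Kinf" and \<zeta>: "\<zeta> \<in> class_Kinf"
    and a_less: "\<And>s. s > 0 \<Longrightarrow> a s < s"
    and \<beta>: "\<beta> \<in> class_Kplus" and \<delta>: "\<delta> \<in> class_Kplus"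
    and \<rho>_cont: "continuous_on {0..} \<rho>" and \<rho>_pos: "positive_definite \<rho>"
    and V_bounds: "\<And>t x. t \<ge> 0 \<Longrightarrow> a1 (norm (h (t - r) x)) \<le> V (t - r) x \<and> V (t - r) x \<le> a2 (\<beta> t * norm x)"
    and V_decrease: "\<And>t x u d. t \<ge> 0 \<Longrightarrow> x \<in> state_space r \<Longrightarrow> u \<in> U \<Longrightarrow> d \<in> D \<Longrightarrow>
      max (\<zeta> (\<delta> t * norm u)) (a (SUP \<theta>\<in>{-r..0}. V (t + \<theta>) (apply_bcontfun x \<theta>))) \<le> V t (apply_bcontfun x 0) \<Longrightarrow>
      upper_right_deriv V t (apply_bcontfun x 0) (f t x u d) \<le> ereal (- \<rho> (V t (apply_bcontfun x 0)))"
    and H_upper: "\<And>t x. t \<ge> 0 \<Longrightarrow> x \<in> state_space r \<Longrightarrow>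
      norm (H t x) \<le> a3 (SUP \<theta>\<in>{-r..0}. norm (h (t + \<theta>) (apply_bcontfun x \<theta>)))"
begin

lemmas a_K = class_Kinf_imp_K[OF a]

text \<open>The passage to the scalar theory: the decrease condition is applied to the state
  \<open>history r t x\<close>, whose values are those of \<open>x\<close> on the window, at almost
  every \<open>t\<close> where the equation holds. A bound \<open>q\<close> on the transformed input
  supplies the input part of that condition.\<close>

lemma solution_razumikhin:
  assumes sol: "solution_on r f t0 x0 u d b x" and t0: "0 \<le> t0" and u: "u \<in> inputs U" and d: "d \<in> inputs D"
    and T: "t0 \<le> T" "ereal T < b" and q: "0 \<le> q" "\<And>t. t0 \<le> t \<Longrightarrow> t \<le> T \<Longrightarrow> \<zeta> (\<delta> t * norm (u t)) \<le> q"
  shows "razumikhin r a \<rho> t0 T q (\<lambda>t. V t (x t))"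
  unfolding razumikhin_def
proof (intro conjI ballI)
  note sD = solution_onD[OF sol]
  have x_cont: "continuous_on {t0 - r..T} x" using T by (intro sD(6)) auto
  have "continuous_on {t0 - r..T} (\<lambda>t. (t, x t))" using x_cont by (intro continuous_intros)
  from continuous_on_compose2[OF locally_lipschitz_on_imp_continuous_on[OF V_lipschitz] this]
  show "continuous_on {t0 - r..T} (\<lambda>t. V t (x t))" using t0 by (simp add: image_subset_iff)
  show "0 \<le> V t (x t)" if "t \<in> {t0 - r..T}" for t using that t0 by (intro V_nonneg) auto
  show "abs_continuous_on_interval t0 T (\<lambda>t. V t (x t))"
    by (rule abs_continuous_locally_lipschitz[OF sD(4)[OF T] V_lipschitz]) (use t0 r_pos in auto)
  show "AE t in lebesgue. t0 < t \<and> t < T \<and> q \<le> V t (x t) \<and> a (SUP \<theta>\<in>{-r..0}. V (t + \<theta>) (x (t + \<theta>))) \<le> V t (x t) \<longrightarrow>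
        dini_le (\<lambda>t. V t (x t)) t (- \<rho> (V t (x t)))"
    using sD(5)
  proof eventually_elim
    case (elim t)
    show ?case
    proof
      assume t: "t0 < t \<and> t < T \<and> q \<le> V t (x t) \<and> a (SUP \<theta>\<in>{-r..0}. V (t + \<theta>) (x (t + \<theta>))) \<le> V t (x t)"
      have "ereal t < b" using t T by (auto intro: less_trans[of "ereal t" "ereal T" b])
      with elim t have x: "(x has_vector_derivative f t (history r t x) (u t) (d t)) (at t)" by simp
      have c: "continuous_on {t - r..t} x" using t by (intro continuous_on_subset[OF x_cont]) auto
      note hist = history_in_state_space[OF r_pos c]
      have eq: "(SUP \<theta>\<in>{-r..0}. V (t + \<theta>) (apply_bcontfun (history r t x) \<theta>)) = (SUP \<theta>\<in>{-r..0}. V (t + \<theta>) (x (t + \<theta>)))"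
        using hist(2) by (intro SUP_cong) auto
      have "upper_right_deriv V t (apply_bcontfun (history r t x) 0) (f t (history r t x) (u t) (d t))
          \<le> ereal (- \<rho> (V t (apply_bcontfun (history r t x) 0)))"
      proof (rule V_decrease)
        show "max (\<zeta> (\<delta> t * norm (u t))) (a (SUP \<theta>\<in>{-r..0}. V (t + \<theta>) (apply_bcontfun (history r t x) \<theta>)))
            \<le> V t (apply_bcontfun (history r t x) 0)"
          using t q(2)[of t] hist(2)[of 0] r_pos unfolding eq by simp
      qed (use t t0 hist(1) inputsD(1)[OF u, of t] inputsD(1)[OF d, of t] in auto)
      then have "upper_right_deriv V t (x t) (f t (history r t x) (u t) (d t)) \<le> ereal (- \<rho> (V t (x t)))"
        using hist(2)[of 0] r_pos by simp
      with x show "dini_le (\<lambda>t. V t (x t)) t (- \<rho> (V t (x t)))"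
        using t t0 r_pos by (intro dini_le_along_derivative[OF V_lipschitz]) auto
    qed
  qed
qed (use T q in auto)

text \<open>The upper bound on \<open>V\<close> is stated at time \<open>t - r\<close> with weight
  \<open>\<beta> t\<close>, so on the initial window it uses \<open>\<beta> (t + r)\<close> with
  \<open>t + r\<close> in \<open>[t0, t0 + r]\<close>. This is the reason for the sliding
  maximum.\<close>

lemma initial_bound:
  assumes sol: "solution_on r f t0 x0 u d b x" and t0: "0 \<le> t0" and t: "t \<in> {t0 - r..t0}"
  shows "V t (x t) \<le> a2 (running_majorant r \<beta> t0 * norm x0)"
proof -
  note sD = solution_onD[OF sol]
  have c: "continuous_on {t0 - r..t0} x" using sD(1) by (intro sD(6)) auto
  have "norm (x t) \<le> norm x0"
    using norm_le_norm_history[OF r_pos c t] sD(3) by simp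
  moreover have "0 \<le> \<beta> (t + r)" "\<beta> (t + r) \<le> running_majorant r \<beta> t0"
    using t t0 class_KplusD(2)[OF \<beta>, of "t + r"] by (auto intro!: running_majorant(2)[OF r_pos \<beta>])
  ultimately have "\<beta> (t + r) * norm (x t) \<le> running_majorant r \<beta> t0 * norm x0"
    and "0 \<le> \<beta> (t + r) * norm (x t)"
    by (auto intro!: mult_mono)
  then have "a2 (\<beta> (t + r) * norm (x t)) \<le> a2 (running_majorant r \<beta> t0 * norm x0)"
    by (intro class_KD(5)[OF class_Kinf_imp_K[OF a2]])
  with V_bounds[of "t + r" "x t"] t t0 show ?thesis by simp
qed

text \<open>For data in the ranges \<open>s\<close> and \<open>T\<close>, the scalar bound confines
  \<open>V\<close> to one level \<open>Q\<close>, and the lower bound on \<open>V\<close> converts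
  this into one radius \<open>X\<close> for all solutions. A solution ending by
  \<open>t0 + \<xi>\<close> would be bounded on its whole interval and hence global, a
  contradiction.\<close>

lemma RFC_of_radially_unbounded:
  assumes p: "p \<in> class_Kinf" and \<mu>: "\<mu> \<in> class_Kplus" and
    lower: "\<And>t x. t \<ge> 0 \<Longrightarrow> p (\<mu> t * norm x) \<le> V (t - r) x + R"
  shows "RFC r D U f"
  unfolding RFC_def
proof (intro allI impI)
  fix s T :: real assume "0 \<le> s" "0 \<le> T"
  \<comment> \<open>Times reach \<open>t0 + \<xi> \<le> 2 * T\<close>; below, \<open>\<mu>\<close>
    is bounded up to \<open>2 * T + r\<close> because it is evaluated at
    \<open>t + r\<close>.\<close>
  obtain m\<delta> \<Delta> where \<Delta>: "\<And>t. 0 \<le> t \<Longrightarrow> t \<le> 2 * T \<Longrightarrow> m\<delta> \<le> \<delta> t \<and> \<delta> t \<le> \<Delta>"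
    using class_Kplus_bounds[OF \<delta>, of "2 * T"] \<open>0 \<le> T\<close> by (metis mult_nonneg_nonneg zero_le_numeral)
  obtain m\<beta> B where B: "\<And>t. 0 \<le> t \<Longrightarrow> t \<le> T \<Longrightarrow> m\<beta> \<le> running_majorant r \<beta> t \<and> running_majorant r \<beta> t \<le> B"
    using class_Kplus_bounds[OF running_majorant(1)[OF r_pos \<beta>] \<open>0 \<le> T\<close>] by metis
  obtain m where "m > 0" and m: "\<And>t. 0 \<le> t \<Longrightarrow> t \<le> 2 * T + r \<Longrightarrow> m \<le> \<mu> t"
    using class_Kplus_bounds[OF \<mu>, of "2 * T + r"] \<open>0 \<le> T\<close> r_pos
    by (metis add_nonneg_nonneg less_imp_le mult_nonneg_nonneg zero_le_numeral)
  define q where "q = \<zeta> (\<Delta> * s)"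
  define Q where "Q = max (a2 (B * s)) q"
  \<comment> \<open>The summand \<open>1\<close> makes
    \<open>p (\<mu> (t + r) * norm (x t)) < p y\<close> strict, so that monotonicity of
    \<open>p\<close> can be inverted without an inverse function.\<close>
  obtain y where "y \<ge> 0" and y: "p y \<ge> Q + R + 1" using class_Kinf_ge_ex[OF p] .
  define X where "X = y / m"
  have \<Delta>0: "0 < \<Delta>" using \<Delta>[of 0] class_KplusD(2)[OF \<delta>, of 0] \<open>0 \<le> T\<close> by auto
  have "0 \<le> q" unfolding q_def using \<Delta>0 \<open>0 \<le> s\<close> by (intro class_KD(3)[OF class_Kinf_imp_K[OF \<zeta>]]) auto
  have bound: "norm (x t) \<le> X"
    if sol: "solution_on r f t0 x0 u d b x" and t0: "t0 \<in> {0..T}" and u: "u \<in> inputs (U \<inter> cball 0 s)"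
      and d: "d \<in> inputs D" and x0: "norm x0 \<le> s" and t: "t0 - r \<le> t" "t \<le> 2 * T" "ereal t < b"
    for t0 x0 u d b x t
  proof -
    \<comment> \<open>\<open>t\<close> may lie in the initial window, whereas a Razumikhin horizon
      must not end before \<open>t0\<close>.\<close>
    define c where "c = max t0 t"
    have c: "t0 \<le> c" "c \<le> 2 * T" "ereal c < b"
      using t t0 solution_onD(1)[OF sol] by (auto simp: c_def max_def)
    have uU: "u \<in> inputs U" using u by (auto simp: inputs_def)
    have "razumikhin r a \<rho> t0 c q (\<lambda>t. V t (x t))"
    proof (rule solution_razumikhin[OF sol _ uU d c(1,3) \<open>0 \<le> q\<close>])
      fix \<tau> assume \<tau>: "t0 \<le> \<tau>" "\<tau> \<le> c"
      have "norm (u \<tau>) \<le> s" using inputsD(1)[OF u, of \<tau>] \<tau> t0 by auto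
      then have "\<delta> \<tau> * norm (u \<tau>) \<le> \<Delta> * s"
        using \<Delta>[of \<tau>] \<tau> t0 c \<open>0 \<le> s\<close> \<Delta>0 by (intro mult_mono) auto
      then show "\<zeta> (\<delta> \<tau> * norm (u \<tau>)) \<le> q"
        unfolding q_def using class_KplusD(2)[OF \<delta>, of \<tau>] \<tau> t0
        by (intro class_KD(5)[OF class_Kinf_imp_K[OF \<zeta>]]) auto
    qed (use t0 in simp)
    moreover have "V \<tau> (x \<tau>) \<le> a2 (B * s)" if \<tau>: "t0 - r \<le> \<tau>" "\<tau> \<le> t0" for \<tau>
    proof -
      have "V \<tau> (x \<tau>) \<le> a2 (running_majorant r \<beta> t0 * norm x0)"
        using \<tau> t0 by (intro initial_bound[OF sol]) auto
      also have "\<dots> \<le> a2 (B * s)"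
        using B[of t0] t0 x0 \<open>0 \<le> s\<close> class_KplusD(2)[OF running_majorant(1)[OF r_pos \<beta>], of t0]
        by (intro class_KD(5)[OF class_Kinf_imp_K[OF a2]] mult_mono) auto
      finally show ?thesis .
    qed
    ultimately have "V t (x t) \<le> Q"
      unfolding Q_def using t
      by (intro razumikhin_bounded[OF r_pos a_K a_less \<rho>_cont \<rho>_pos,
            where w = "\<lambda>t. V t (x t)" and T = c]) (auto simp: c_def)
    then have "p (\<mu> (t + r) * norm (x t)) < p y"
      using lower[of "t + r" "x t"] t t0 y by simp
    then have "\<mu> (t + r) * norm (x t) < y"
      using class_KD(5)[OF class_Kinf_imp_K[OF p], of y "\<mu> (t + r) * norm (x t)"] \<open>y \<ge> 0\<close> by (meson not_le)
    moreover have "m * norm (x t) \<le> \<mu> (t + r) * norm (x t)"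
      using m[of "t + r"] t t0 by (intro mult_right_mono) auto
    ultimately have "m * norm (x t) \<le> y" by linarith
    then show ?thesis using \<open>m > 0\<close> by (simp add: X_def field_simps)
  qed
  show "\<exists>M. \<forall>u\<in>inputs (U \<inter> cball 0 s). \<forall>\<xi>\<in>{0..T}. \<forall>x0\<in>state_space r. \<forall>t0\<in>{0..T}.
        \<forall>d\<in>inputs D. norm x0 \<le> s \<longrightarrow>
        (\<forall>b x. maximal_solution r f t0 x0 u d b x \<longrightarrow>
           ereal (t0 + \<xi>) < b \<and> norm (history r (t0 + \<xi>) x) \<le> M)"
  proof (intro exI[of _ X] ballI allI impI)
    fix u \<xi> and x0 :: "real \<Rightarrow>\<^sub>C 'x" and t0 d b x
    assume u: "u \<in> inputs (U \<inter> cball 0 s)" and \<xi>: "\<xi> \<in> {0..T}" and t0: "t0 \<in> {0..T}" and d: "d \<in> inputs D"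
      and x0: "norm x0 \<le> s" and max: "maximal_solution r f t0 x0 u d b x"
    have sol: "solution_on r f t0 x0 u d b x" using max by (simp add: maximal_solution_def)
    have less: "ereal (t0 + \<xi>) < b"
    proof (rule ccontr)
      assume "\<not> ereal (t0 + \<xi>) < b"
      then have *: "b \<le> ereal (t0 + \<xi>)" by simp
      have "norm (x t) \<le> X" if "t0 - r \<le> t" "ereal t < b" for t
      proof (rule bound[OF sol t0 u d x0 that(1) _ that(2)])
        have "ereal t < ereal (t0 + \<xi>)" using that(2) * by (rule less_le_trans)
        then show "t \<le> 2 * T" using t0 \<xi> by simp
      qed
      then have "b = \<infinity>" using t0 by (intro bounded_maximal_solution_global[OF max _ u d]) auto
      with * show False by simp
    qed
    have "norm (history r (t0 + \<xi>) x) \<le> X"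
    proof (rule norm_history_le[OF r_pos])
      show "continuous_on {t0 + \<xi> - r..t0 + \<xi>} x" using \<xi> less by (intro solution_onD(6)[OF sol]) auto
      fix t assume t: "t \<in> {t0 + \<xi> - r..t0 + \<xi>}"
      show "norm (x t) \<le> X"
        by (rule bound[OF sol t0 u d x0])
           (use t \<xi> t0 less in \<open>auto intro: le_less_trans[of "ereal t" "ereal (t0 + \<xi>)" b]\<close>)
    qed
    with less show "ereal (t0 + \<xi>) < b \<and> norm (history r (t0 + \<xi>) x) \<le> X" by simp
  qed
qed

text \<open>Translates a level of \<open>V\<close> into a level of the output:
  \<open>V \<le> W\<close> gives \<open>norm h \<le> inv_into {0..} a1 W\<close>, and
  \<open>a3\<close> passes from \<open>h\<close> to \<open>H\<close>. The stated gain is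
  \<open>\<kappa>\<close> composed with \<open>\<zeta>\<close>.\<close>

definition \<kappa> :: "real \<Rightarrow> real" where
  "\<kappa> s = a3 (inv_into {0..} a1 s)"

lemma kappa_Kinf: "\<kappa> \<in> class_Kinf"
  unfolding \<kappa>_def[abs_def] by (rule class_Kinf_comp[OF a3 class_Kinf_inverse(4)[OF a1]])

lemma output_le:
  assumes c: "continuous_on {t - r..t} x" and "0 \<le> t" and W: "\<And>\<tau>. \<tau> \<in> {t - r..t} \<Longrightarrow> V \<tau> (x \<tau>) \<le> W"
  shows "norm (H t (history r t x)) \<le> \<kappa> W"
proof -
  note hist = history_in_state_space[OF r_pos c]
  have "0 \<le> V t (x t)" using assms r_pos by (intro V_nonneg) auto
  also have "V t (x t) \<le> W" using r_pos by (intro W) auto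
  finally have "0 \<le> W" .
  have le: "norm (h (t + \<theta>) (apply_bcontfun (history r t x) \<theta>)) \<le> inv_into {0..} a1 W" if \<theta>: "\<theta> \<in> {-r..0}" for \<theta>
  proof -
    have "a1 (norm (h (t + \<theta>) (x (t + \<theta>)))) \<le> V (t + \<theta>) (x (t + \<theta>))"
      using V_bounds[of "t + \<theta> + r" "x (t + \<theta>)"] \<theta> \<open>0 \<le> t\<close> by simp
    also have "\<dots> \<le> a1 (inv_into {0..} a1 W)"
      using W[of "t + \<theta>"] \<theta> class_Kinf_inverse(2)[OF a1 \<open>0 \<le> W\<close>] by simp
    finally show ?thesis
      using class_KD(6)[OF class_Kinf_imp_K[OF a1]] class_Kinf_inverse(1)[OF a1 \<open>0 \<le> W\<close>] hist(2)[OF \<theta>] by simp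
  qed
  have "norm (H t (history r t x)) \<le> a3 (SUP \<theta>\<in>{-r..0}. norm (h (t + \<theta>) (apply_bcontfun (history r t x) \<theta>)))"
    using \<open>0 \<le> t\<close> hist(1) by (rule H_upper)
  also have "\<dots> \<le> a3 (inv_into {0..} a1 W)"
  proof (rule class_KD(5)[OF class_Kinf_imp_K[OF a3]])
    have "bdd_above ((\<lambda>\<theta>. norm (h (t + \<theta>) (apply_bcontfun (history r t x) \<theta>))) ` {-r..0})"
      using le by (intro bdd_aboveI[of _ "inv_into {0..} a1 W"]) auto
    then show "0 \<le> (SUP \<theta>\<in>{-r..0}. norm (h (t + \<theta>) (apply_bcontfun (history r t x) \<theta>)))"
      using r_pos by (intro cSUP_upper2[where x = 0]) auto
    show "(SUP \<theta>\<in>{-r..0}. norm (h (t + \<theta>) (apply_bcontfun (history r t x) \<theta>))) \<le> inv_into {0..} a1 W"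
      using le r_pos by (intro cSUP_least) auto
  qed
  finally show ?thesis by (simp add: \<kappa>_def)
qed

text \<open>The scalar bound is used on the horizon \<open>[t0,t]\<close> with the level
  \<open>q\<close> for which \<open>\<kappa> q\<close> is exactly the supremum of the transformed
  input. Since \<open>\<kappa>\<close> is increasing it commutes with \<open>max\<close>, so the two
  terms of the bound separate without loss in the gain.\<close>

lemma output_estimate:
  assumes RFC: "RFC r D U f"
  shows "\<exists>\<sigma>\<in>class_KL. IOS_estimate r D U f H (\<lambda>s t. \<kappa> (\<sigma> (a2 s) t)) (running_majorant r \<beta>) (\<lambda>s. \<kappa> (\<zeta> s)) \<delta>"
proof -
  obtain \<sigma> where "\<sigma> \<in> class_KL" and \<sigma>: "\<And>t0 T q w s t \<tau>. razumikhin r a \<rho> t0 T q w \<Longrightarrow> \<forall>\<tau>\<in>{t0 - r..t0}. w \<tau> \<le> s \<Longrightarrow>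
     t0 \<le> t \<Longrightarrow> t - r \<le> \<tau> \<Longrightarrow> \<tau> \<le> t \<Longrightarrow> \<tau> \<le> T \<Longrightarrow> w \<tau> \<le> max (\<sigma> s (t - t0)) q"
    using razumikhin_KL_bound[OF r_pos a_K a_less \<rho>_cont \<rho>_pos] by blast
  note \<kappa>_K = class_Kinf_imp_K[OF kappa_Kinf]
  have "IOS_estimate r D U f H (\<lambda>s t. \<kappa> (\<sigma> (a2 s) t)) (running_majorant r \<beta>) (\<lambda>s. \<kappa> (\<zeta> s)) \<delta>"
    unfolding IOS_estimate_def
  proof (intro ballI allI impI)
    fix d u and t0 :: real and x0 :: "real \<Rightarrow>\<^sub>C 'x" and b x t
    assume d: "d \<in> inputs D" and u: "u \<in> inputs U" and t0: "0 \<le> t0" and x0: "x0 \<in> state_space r"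
      and max: "maximal_solution r f t0 x0 u d b x" and t: "t0 \<le> t"
    have "b = \<infinity>" by (rule RFC_forward_complete[OF RFC max t0 x0 u d])
    have sol: "solution_on r f t0 x0 u d b x" using max by (simp add: maximal_solution_def)
    define v where "v \<tau> = \<zeta> (\<delta> \<tau> * norm (u \<tau>))" for \<tau>
    define S where "S = (SUP \<tau>\<in>{t0..t}. ereal (\<kappa> (v \<tau>)))"
    have v0: "0 \<le> v \<tau>" if "\<tau> \<ge> 0" for \<tau>
      unfolding v_def using class_KplusD(2)[OF \<delta> that]
      by (intro class_KD(3)[OF class_Kinf_imp_K[OF \<zeta>]]) auto
    have S_ge: "ereal (\<kappa> (v \<tau>)) \<le> S" if "\<tau> \<in> {t0..t}" for \<tau>
      unfolding S_def using that by (rule SUP_upper)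
    have "ereal (norm (H t (history r t x))) \<le> max (ereal (\<kappa> (\<sigma> (a2 (running_majorant r \<beta> t0 * norm x0)) (t - t0)))) S"
    \<comment> \<open>An infinite supremum makes the claim void, and \<open>- \<infinity>\<close> is
      excluded because \<open>t\<close> itself lies in \<open>{t0..t}\<close>.\<close>
    proof (cases S)
      case PInf
      then show ?thesis by simp
    next
      case MInf
      then show ?thesis using S_ge[of t] t by simp
    next
      case (real G)
      have "0 \<le> \<kappa> (v t)" using v0[of t] t t0 by (intro class_KD(3)[OF \<kappa>_K]) auto
      then have "0 \<le> G" using S_ge[of t] t real by simp
      \<comment> \<open>Pulling \<open>G\<close> back through \<open>\<kappa>\<close> turns the
        bound on \<open>\<kappa> (v \<tau>)\<close> into \<open>v \<tau> \<le> q\<close>, the form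
        the Razumikhin estimate expects.\<close>
      define q where "q = inv_into {0..} \<kappa> G"
      have q: "0 \<le> q" "\<kappa> q = G"
        unfolding q_def using class_Kinf_inverse(1,2)[OF kappa_Kinf \<open>0 \<le> G\<close>] by auto
      have "v \<tau> \<le> q" if "t0 \<le> \<tau>" "\<tau> \<le> t" for \<tau>
        using S_ge[of \<tau>] that real q class_KD(6)[OF \<kappa>_K, of "v \<tau>" q] v0[of \<tau>] t0 by simp
      then have raz: "razumikhin r a \<rho> t0 t q (\<lambda>t. V t (x t))"
        unfolding v_def using \<open>b = \<infinity>\<close> by (intro solution_razumikhin[OF sol t0 u d t _ q(1)]) auto
      define s where "s = a2 (running_majorant r \<beta> t0 * norm x0)"
      have "norm (H t (history r t x)) \<le> \<kappa> (max (\<sigma> s (t - t0)) q)"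
      proof (rule output_le)
        show "continuous_on {t - r..t} x" using t \<open>b = \<infinity>\<close> by (intro solution_onD(6)[OF sol]) auto
        show "V \<tau> (x \<tau>) \<le> max (\<sigma> s (t - t0)) q" if "\<tau> \<in> {t - r..t}" for \<tau>
          using that t initial_bound[OF sol t0] unfolding s_def by (intro \<sigma>[OF raz]) auto
      qed (use t t0 in simp)
      also have "\<dots> \<le> max (\<kappa> (\<sigma> s (t - t0))) G" using q by (simp add: max_def)
      finally show ?thesis using real by (simp add: s_def max_def split: if_splits)
    qed
    then show "ereal (norm (H t (history r t x))) \<le> max (ereal (\<kappa> (\<sigma> (a2 (running_majorant r \<beta> t0 * norm x0)) (t - t0))))
        (SUP \<tau>\<in>{t0..t}. ereal (\<kappa> (\<zeta> (\<delta> \<tau> * norm (u \<tau>)))))"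
      by (simp add: S_def v_def)
  qed
  with \<open>\<sigma> \<in> class_KL\<close> show ?thesis by blast
qed

end

section \<open>From the output estimate to IOS and, for bounded weights, UIOS\<close>

lemma IOS_estimate_bounded_weights:
  assumes est: "IOS_estimate r D U f H \<sigma> \<beta> \<gamma> \<delta>" and \<sigma>: "\<sigma> \<in> class_KL" and \<gamma>: "\<gamma> \<in> class_K"
    and \<beta>: "\<And>t. 0 \<le> t \<Longrightarrow> 0 \<le> \<beta> t \<and> \<beta> t \<le> B" and \<delta>: "\<And>t. 0 \<le> t \<Longrightarrow> 0 \<le> \<delta> t \<and> \<delta> t \<le> \<Delta>"
  shows "IOS_estimate r D U f H (\<lambda>s t. \<sigma> (B * s) t) (\<lambda>_. 1) (\<lambda>s. \<gamma> (\<Delta> * s)) (\<lambda>_. 1)"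
  unfolding IOS_estimate_def
proof (intro ballI allI impI)
  fix d u and t0 :: real and x0 b x t
  assume *: "d \<in> inputs D" "u \<in> inputs U" "0 \<le> t0" "x0 \<in> state_space r"
    "maximal_solution r f t0 x0 u d b x" "t0 \<le> t"
  have "ereal (norm (H t (history r t x)))
      \<le> max (ereal (\<sigma> (\<beta> t0 * norm x0) (t - t0))) (SUP \<tau>\<in>{t0..t}. ereal (\<gamma> (\<delta> \<tau> * norm (u \<tau>))))"
    using est[unfolded IOS_estimate_def, rule_format, OF *] .
  also have "\<dots> \<le> max (ereal (\<sigma> (B * (1 * norm x0)) (t - t0))) (SUP \<tau>\<in>{t0..t}. ereal (\<gamma> (\<Delta> * (1 * norm (u \<tau>)))))"
  proof (rule max.mono)
    show "ereal (\<sigma> (\<beta> t0 * norm x0) (t - t0)) \<le> ereal (\<sigma> (B * (1 * norm x0)) (t - t0))"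
      using \<beta>[of t0] * class_KD(5)[OF class_KLD(1)[OF \<sigma>, of "t - t0"], of "\<beta> t0 * norm x0" "B * norm x0"]
      by (simp add: mult_right_mono)
    show "(SUP \<tau>\<in>{t0..t}. ereal (\<gamma> (\<delta> \<tau> * norm (u \<tau>)))) \<le> (SUP \<tau>\<in>{t0..t}. ereal (\<gamma> (\<Delta> * (1 * norm (u \<tau>)))))"
    proof (rule SUP_subset_mono[OF order_refl])
      show "ereal (\<gamma> (\<delta> \<tau> * norm (u \<tau>))) \<le> ereal (\<gamma> (\<Delta> * (1 * norm (u \<tau>))))" if "\<tau> \<in> {t0..t}" for \<tau>
        using \<delta>[of \<tau>] that * class_KD(5)[OF \<gamma>, of "\<delta> \<tau> * norm (u \<tau>)" "\<Delta> * norm (u \<tau>)"]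
        by (simp add: mult_right_mono)
    qed
  qed
  finally show "ereal (norm (H t (history r t x)))
      \<le> max (ereal (\<sigma> (B * (1 * norm x0)) (t - t0))) (SUP \<tau>\<in>{t0..t}. ereal (\<gamma> (\<Delta> * (1 * norm (u \<tau>)))))" .
qed

text \<open>The weight in the estimate is the sliding maximum of \<open>\<beta>\<close>, which
  inherits any upper bound of \<open>\<beta>\<close>. Bounded weights can thus be absorbed by
  rescaling: \<open>B\<close> into the argument of the \<open>KL\<close> function,
  \<open>\<Delta>\<close> into the gain.\<close>

lemma (in lyapunov_razumikhin) IOS_of_RFC:
  assumes RFC: "RFC r D U f"
  shows "IOS r D U f H (\<lambda>s. a3 (inv_into {0..} a1 (\<zeta> s))) \<delta>"
    and "bounded (\<beta> ` {0..}) \<Longrightarrow> bounded (\<delta> ` {0..}) \<Longrightarrow> UIOS r D U f H"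
proof -
  obtain \<sigma> where \<sigma>: "\<sigma> \<in> class_KL"
    and est: "IOS_estimate r D U f H (\<lambda>s t. \<kappa> (\<sigma> (a2 s) t)) (running_majorant r \<beta>) (\<lambda>s. \<kappa> (\<zeta> s)) \<delta>"
    using output_estimate[OF RFC] ..
  have KL: "(\<lambda>s t. \<kappa> (\<sigma> (a2 s) t)) \<in> class_KL"
    by (rule class_KL_comp[OF class_Kinf_imp_K[OF kappa_Kinf] class_Kinf_imp_K[OF a2] \<sigma>])
  have K: "(\<lambda>s. \<kappa> (\<zeta> s)) \<in> class_K"
    by (rule class_K_comp[OF class_Kinf_imp_K[OF kappa_Kinf] class_Kinf_imp_K[OF \<zeta>]])
  have maj: "running_majorant r \<beta> \<in> class_Kplus" by (rule running_majorant(1)[OF r_pos \<beta>])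
  have "IOS r D U f H (\<lambda>s. \<kappa> (\<zeta> s)) \<delta>"
    unfolding IOS_def by (intro conjI bexI[OF _ KL] bexI[OF _ maj] est RFC \<delta> K)
  then show "IOS r D U f H (\<lambda>s. a3 (inv_into {0..} a1 (\<zeta> s))) \<delta>" by (simp add: \<kappa>_def)
  assume "bounded (\<beta> ` {0..})" "bounded (\<delta> ` {0..})"
  then obtain B0 \<Delta>0 where "\<forall>t\<in>{0..}. norm (\<beta> t) \<le> B0" "\<forall>t\<in>{0..}. norm (\<delta> t) \<le> \<Delta>0"
    by (auto simp: bounded_iff)
  \<comment> \<open>The maximum with \<open>1\<close>, here and for \<open>\<Delta>\<close>, makes
    the factor positive, so that rescaling by it is of class \<open>K\<close>.\<close>
  define B where "B = max 1 B0"
  define \<Delta> where "\<Delta> = max 1 \<Delta>0"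
  have B: "B > 0" "\<beta> t \<le> B" if "t \<ge> 0" for t
    using \<open>\<forall>t\<in>{0..}. norm (\<beta> t) \<le> B0\<close>[rule_format, of t] that by (auto simp: B_def abs_le_iff)
  have \<Delta>: "\<Delta> > 0" "\<delta> t \<le> \<Delta>" if "t \<ge> 0" for t
    using \<open>\<forall>t\<in>{0..}. norm (\<delta> t) \<le> \<Delta>0\<close>[rule_format, of t] that by (auto simp: \<Delta>_def abs_le_iff)
  have "IOS_estimate r D U f H (\<lambda>s t. \<kappa> (\<sigma> (a2 (B * s)) t)) (\<lambda>_. 1) (\<lambda>s. \<kappa> (\<zeta> (\<Delta> * s))) (\<lambda>_. 1)"
  proof (rule IOS_estimate_bounded_weights[OF est KL K])
    show "0 \<le> running_majorant r \<beta> t \<and> running_majorant r \<beta> t \<le> B" if "0 \<le> t" for t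
      using running_majorant(3)[OF r_pos \<beta> that B(2)] class_KplusD(2)[OF maj that] by simp
    show "0 \<le> \<delta> t \<and> \<delta> t \<le> \<Delta>" if "0 \<le> t" for t
      using \<Delta>(2)[OF that] class_KplusD(2)[OF \<delta> that] by simp
  qed
  moreover have "(\<lambda>s t. \<kappa> (\<sigma> (a2 (B * s)) t)) \<in> class_KL"
    using class_KL_comp[OF class_Kinf_imp_K[OF kappa_Kinf] class_K_comp[OF class_Kinf_imp_K[OF a2]
        class_Kinf_imp_K[OF class_Kinf_scale[OF B(1)[of 0]]]] \<sigma>] by simp
  moreover have "(\<lambda>s. \<kappa> (\<zeta> (\<Delta> * s))) \<in> class_K"
    using class_K_comp[OF K class_Kinf_imp_K[OF class_Kinf_scale[OF \<Delta>(1)[of 0]]]] by simp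
  ultimately show "UIOS r D U f H" unfolding UIOS_def by (intro conjI RFC bexI)
qed

theorem proposition5p3:
  fixes r :: real
    and D :: "(real ^ 'l) set"
    and U :: "(real ^ 'm) set"
    and f :: "real \<Rightarrow> (real \<Rightarrow>\<^sub>C (real ^ 'n)) \<Rightarrow> real ^ 'm \<Rightarrow> real ^ 'l \<Rightarrow> real ^ 'n"
    and H :: "real \<Rightarrow> (real \<Rightarrow>\<^sub>C (real ^ 'n)) \<Rightarrow> 'y::real_normed_vector"
    and h :: "real \<Rightarrow> real ^ 'n \<Rightarrow> real ^ 'p"
    and V :: "real \<Rightarrow> real ^ 'n \<Rightarrow> real"
    and a1 a2 a3 a \<zeta> \<beta> \<delta> \<rho> :: "real \<Rightarrow> real"
  assumes "retarded_system r D U f H"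
    and "equivalent_to_finite_dim r H h"
    and "\<forall>t\<ge>-r. \<forall>x. V t x \<ge> 0"
    and "locally_lipschitz_on ({-r..} \<times> UNIV) (\<lambda>(t, x). V t x)"
    and "a1 \<in> class_Kinf" and "a2 \<in> class_Kinf" and "a \<in> class_Kinf" and "\<zeta> \<in> class_Kinf"
    and "\<forall>s>0. a s < s"
    and "\<beta> \<in> class_Kplus" and "\<delta> \<in> class_Kplus"
    and "continuous_on {0..} \<rho>" and "positive_definite \<rho>"
    and "\<forall>t\<ge>0. \<forall>x. a1 (norm (h (t - r) x)) \<le> V (t - r) x \<and> V (t - r) x \<le> a2 (\<beta> t * norm x)"
    and "\<forall>t\<ge>0. \<forall>x\<in>state_space r. \<forall>u\<in>U. \<forall>d\<in>D.
      max (\<zeta> (\<delta> t * norm u)) (a (SUP \<theta>\<in>{-r..0}. V (t + \<theta>) (apply_bcontfun x \<theta>))) \<le> V t (apply_bcontfun x 0) \<longrightarrow>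
      upper_right_deriv V t (apply_bcontfun x 0) (f t x u d) \<le> ereal (- \<rho> (V t (apply_bcontfun x 0)))"
    and "RFC r D U f \<or>
      (\<exists>p\<in>class_Kinf. \<exists>\<mu>\<in>class_Kplus. \<exists>R\<ge>0. \<forall>t\<ge>0. \<forall>x. p (\<mu> t * norm x) \<le> V (t - r) x + R)"
    and "a3 \<in> class_Kinf"
    and "\<forall>t\<ge>0. \<forall>x\<in>state_space r.
      norm (H t x) \<le> a3 (SUP \<theta>\<in>{-r..0}. norm (h (t + \<theta>) (apply_bcontfun x \<theta>)))"
  shows "IOS r D U f H (\<lambda>s. a3 (inv_into {0..} a1 (\<zeta> s))) \<delta> \<and>
    (bounded (\<beta> ` {0..}) \<and> bounded (\<delta> ` {0..}) \<longrightarrow> UIOS r D U f H)"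
proof -
  interpret retarded_system r D U f H by fact
  interpret lyapunov_razumikhin r D U f H h V a1 a2 a3 a \<zeta> \<beta> \<delta> \<rho>
    by unfold_locales (use assms in \<open>blast+\<close>)
  have "RFC r D U f"
    using assms(16)
  proof
    assume "\<exists>p\<in>class_Kinf. \<exists>\<mu>\<in>class_Kplus. \<exists>R\<ge>0. \<forall>t\<ge>0. \<forall>x. p (\<mu> t * norm x) \<le> V (t - r) x + R"
    then obtain p \<mu> R where "p \<in> class_Kinf" "\<mu> \<in> class_Kplus"
      "\<And>t x. t \<ge> 0 \<Longrightarrow> p (\<mu> t * norm x) \<le> V (t - r) x + R" by blast
    then show ?thesis by (rule RFC_of_radially_unbounded)
  qed
  then show ?thesis using IOS_of_RFC by blast
qed

end
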